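(* For every integer $t>0$ there are constants $c_t$ and $C_t$ such that the following holds for every $n\ge 3$. Let $P$ be a simple $n$-gon and let $G$ be the visibility graph of $P$. If $G$ does not contain $K_{t,t}$ as a subgraph, then $G$ has at most $C_t\, n\, 2^{\alpha(n)^{c_t}}$ edges, where $\alpha(n)$ is the inverse Ackermann function.
   Context: For a simple polygon $P$ (viewed as a closed region), two points $p,q\in P$ are mutually visible (they "see" each other) if the straight-line segment $\overline{pq}$ is disjoint from the exterior of $P$. The visibility graph of $P$ has the vertices of $P$ as its vertex set, and two vertices are adjacent iff they are mutually visible. $K_{t,t}$ denotes the complete bipartite graph with both parts of size $t$. *)

theory Defs
  imports "HOL-Analysis.Analysis"
begin

text \<open>A polygon with n vertices is given by a map p from indices 0..n-1 to the plane;
  its edges are the closed segments from p i to p ((i+1) mod n).\<close>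

definition poly_edge :: "nat \<Rightarrow> (nat \<Rightarrow> real^2) \<Rightarrow> nat \<Rightarrow> (real^2) set" where
  "poly_edge n p i = closed_segment (p i) (p (Suc i mod n))"

definition simple_polygon :: "nat \<Rightarrow> (nat \<Rightarrow> real^2) \<Rightarrow> bool" where
  "simple_polygon n p \<longleftrightarrow> n \<ge> 3 \<and> inj_on p {..<n} \<and>
     (\<forall>i<n. \<forall>j<n. i \<noteq> j \<longrightarrow>
        (if j = Suc i mod n then poly_edge n p i \<inter> poly_edge n p j = {p j}
         else if i = Suc j mod n then poly_edge n p i \<inter> poly_edge n p j = {p i}
         else poly_edge n p i \<inter> poly_edge n p j = {}))"

definition poly_boundary :: "nat \<Rightarrow> (nat \<Rightarrow> real^2) \<Rightarrow> (real^2) set" where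
  "poly_boundary n p = (\<Union>i<n. poly_edge n p i)"

definition poly_region :: "nat \<Rightarrow> (nat \<Rightarrow> real^2) \<Rightarrow> (real^2) set" where
  "poly_region n p = poly_boundary n p \<union> inside (poly_boundary n p)"

definition sees :: "nat \<Rightarrow> (nat \<Rightarrow> real^2) \<Rightarrow> real^2 \<Rightarrow> real^2 \<Rightarrow> bool" where
  "sees n p x y \<longleftrightarrow> closed_segment x y \<inter> (- poly_region n p) = {}"

definition vis_edges :: "nat \<Rightarrow> (nat \<Rightarrow> real^2) \<Rightarrow> nat set set" where
  "vis_edges n p = {{i, j} | i j. i < n \<and> j < n \<and> i \<noteq> j \<and> sees n p (p i) (p j)}"

definition contains_Ktt :: "nat \<Rightarrow> nat set set \<Rightarrow> nat \<Rightarrow> bool" where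
  "contains_Ktt n E t \<longleftrightarrow> (\<exists>A B. A \<subseteq> {..<n} \<and> B \<subseteq> {..<n} \<and> A \<inter> B = {} \<and>
      card A = t \<and> card B = t \<and> (\<forall>a\<in>A. \<forall>b\<in>B. {a, b} \<in> E))"

fun ack :: "nat \<Rightarrow> nat \<Rightarrow> nat" where
  "ack 0 m = Suc m"
| "ack (Suc k) 0 = ack k 1"
| "ack (Suc k) (Suc m) = ack k (ack (Suc k) m)"

definition inv_ack :: "nat \<Rightarrow> nat" where
  "inv_ack n = (LEAST k. ack k k \<ge> n)"

end

theory Submission
  imports Defs "HOL-Complex_Analysis.Complex_Analysis"
begin

text \<open>Number the vertices along the boundary.  If \<open>a1 < a < a2 < c1 < c < c2\<close> and
  \<open>a\<close> sees \<open>c1\<close>, \<open>c2\<close> while \<open>c\<close> sees \<open>a1\<close>, \<open>a2\<close>, then \<open>a\<close> sees \<open>c\<close>: the four chords enclose a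
  quadrilateral inside the polygon that has the segment from \<open>a\<close> to \<open>c\<close> as its diagonal.
  This closure property of the (strict) visibility graph is all that is used about polygons.

  Edges between two disjoint intervals of indices are then incidences of horizontal and vertical
  segments, so a \<open>K\<^sub>t\<^sub>,\<^sub>t\<close>-free graph has linearly many of them.  Cut the index set into
  blocks: up to a linear term, the number of edges between different blocks is bounded by the number of
  adjacent pairs of blocks.  Bounding the latter recursively, with a hierarchy of coarser and coarser
  partitions whose block sizes grow like the previous level of the Ackermann function, gives
  \<open>O(\<kappa>\<^sup>k n x)\<close> edges whenever \<open>n \<le> ack k x\<close>.\<close>

section \<open>Bipartite pieces of plus-closed graphs\<close>

text \<open>The recursion gains because the sizes match. A node of the hierarchy at level
  \<open>l\<close> holds \<open>B l\<close> blocks and its parent has \<open>ack k (B l)\<close>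
  children; the bound for \<open>k\<close>, used with \<open>B l\<close> in place of
  \<open>x\<close>, costs \<open>B l\<close> per child, that is, a constant per block. As
  \<open>B (Suc x)\<close> reaches \<open>ack (Suc k) x\<close>, there are only \<open>x + 1\<close>
  such levels, whence the summand \<open>N * x\<close>. Each increment of \<open>k\<close>
  multiplies the constant by \<open>288 * t ^ 4\<close>, and \<open>k = x = inv_ack n\<close> turns
  the resulting power into 2 to a multiple of the inverse Ackermann value, which the exponent
  \<open>c\<close> absorbs. On the geometric side, the order of the indices forces chords to cross,
  but does not say on which side of the line through \<open>P a\<close> and \<open>P c\<close>; the
  sign of the winding number around inner points decides that. Visible pairs whose segment touches
  the boundary are not in the strict graph: apart from polygon edges they come from collinear
  vertices, and are paid for by bounding the cliques on a ray.\<close>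

text \<open>The pair \<^term>\<open>(a, c)\<close> is viewed as the cell in row \<^term>\<open>a\<close> and column \<^term>\<open>c\<close> of
  an upper triangular 0-1 matrix.  The side condition \<^term>\<open>a2 < c1\<close> is the whole difficulty: without
  it, the graph would be an intersection graph of horizontal and vertical segments, which has linearly
  many edges when it is biclique-free.\<close>

definition plus_closed :: "(nat \<times> nat) set \<Rightarrow> bool" where
  "plus_closed E \<longleftrightarrow> (\<forall>a1 a a2 c1 c c2. a1 \<le> a \<longrightarrow> a \<le> a2 \<longrightarrow> a2 < c1 \<longrightarrow> c1 \<le> c \<longrightarrow> c \<le> c2 \<longrightarrow>
     (a, c1) \<in> E \<longrightarrow> (a, c2) \<in> E \<longrightarrow> (a1, c) \<in> E \<longrightarrow> (a2, c) \<in> E \<longrightarrow> (a, c) \<in> E)"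

text \<open>For positive \<open>t\<close> the cardinalities force both sides to be finite. Rows and
  columns count as separate copies of the indices.\<close>

definition biclique_free :: "nat \<Rightarrow> (nat \<times> nat) set \<Rightarrow> bool" where
  "biclique_free t E \<longleftrightarrow> (\<forall>A B. card A = t \<longrightarrow> card B = t \<longrightarrow> \<not> A \<times> B \<subseteq> E)"

text \<open>Isolated indices do not count, so a subgraph is charged only for the rows and columns it
  uses; an index occurring on both sides counts twice.\<close>

definition order_of_graph :: "(nat \<times> nat) set \<Rightarrow> nat" where
  "order_of_graph E = card (fst ` E) + card (snd ` E)"

lemma plus_closedD:
  "\<lbrakk>plus_closed E; a1 \<le> a; a \<le> a2; a2 < c1; c1 \<le> c; c \<le> c2;
    (a, c1) \<in> E; (a, c2) \<in> E; (a1, c) \<in> E; (a2, c) \<in> E\<rbrakk> \<Longrightarrow> (a, c) \<in> E"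
  unfolding plus_closed_def by blast

lemma plus_closed_restrict: "plus_closed E \<Longrightarrow> plus_closed (E \<inter> A \<times> B)"
  unfolding plus_closed_def by blast

lemma biclique_free_mono: "biclique_free t E \<Longrightarrow> F \<subseteq> E \<Longrightarrow> biclique_free t F"
  unfolding biclique_free_def by blast

lemma biclique_free_card:
  assumes "biclique_free t E" "A \<times> B \<subseteq> E" "t \<le> card A" "finite B"
  shows "card B < t"
proof (rule ccontr)
  assume "\<not> card B < t"
  then obtain B' where B': "B' \<subseteq> B" "card B' = t"
    using obtain_subset_with_card_n[of t B] by (metis not_less)
  obtain A' where A': "A' \<subseteq> A" "card A' = t"
    using obtain_subset_with_card_n[of t A] assms(3) by metis
  have "A' \<times> B' \<subseteq> E" using A' B' assms(2) by blast
  then show False using assms(1) A' B' unfolding biclique_free_def by blast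
qed

section \<open>Initial segments and windows of finite index sets\<close>

lemma initial_segment:
  fixes X :: "nat set"
  assumes "finite X" "k \<le> card X"
  shows "\<exists>T\<subseteq>X. card T = k \<and> (\<forall>x\<in>X. \<forall>w\<in>T. x \<le> w \<longrightarrow> x \<in> T)"
  using assms(2)
proof (induction k)
  case 0 then show ?case by (intro exI[of _ "{}"]) auto
next
  case (Suc k)
  then obtain T where T: "T \<subseteq> X" "card T = k" "\<forall>x\<in>X. \<forall>w\<in>T. x \<le> w \<longrightarrow> x \<in> T" by auto
  have fT: "finite T" using T assms finite_subset by blast
  have "X - T \<noteq> {}" using Suc.prems T fT by (metis card_mono Diff_eq_empty_iff not_less_eq_eq)
  define m where "m = Min (X - T)"
  have m: "m \<in> X - T" unfolding m_def using \<open>X - T \<noteq> {}\<close> assms(1) by (intro Min_in) auto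
  have mle: "m \<le> x" if "x \<in> X - T" for x unfolding m_def using that assms(1) by auto
  show ?case
  proof (intro exI[of _ "insert m T"] conjI ballI impI)
    show "insert m T \<subseteq> X" using m T by auto
    show "card (insert m T) = Suc k" using m T fT by auto
    fix x w assume "x \<in> X" "w \<in> insert m T" "x \<le> w"
    then show "x \<in> insert m T" using T mle by (metis DiffI insert_iff le_antisym)
  qed
qed

lemma final_segment:
  fixes X :: "nat set"
  assumes "finite X" "k \<le> card X"
  shows "\<exists>T\<subseteq>X. card T = k \<and> (\<forall>x\<in>X. \<forall>w\<in>T. w \<le> x \<longrightarrow> x \<in> T)"
proof -
  obtain U where U: "U \<subseteq> X" "card U = card X - k" "\<forall>x\<in>X. \<forall>w\<in>U. x \<le> w \<longrightarrow> x \<in> U"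
    using initial_segment[OF assms(1), of "card X - k"] by auto
  have "card (X - U) = k" using U assms by (metis card_Diff_subset diff_diff_cancel finite_subset)
  moreover have "\<forall>x\<in>X. \<forall>w\<in>X - U. w \<le> x \<longrightarrow> x \<in> X - U" using U by blast
  ultimately show ?thesis by (intro exI[of _ "X - U"]) auto
qed

text \<open>If \<open>X\<close> has fewer than \<open>t\<close> elements then \<open>T = X\<close>
  and the last clause is vacuous. Otherwise each remaining element has \<open>t\<close> elements of
  \<open>T\<close> before it, and these serve as one side of a biclique.\<close>

lemma first_elements:
  fixes X :: "nat set"
  assumes "finite X"
  obtains T where "T \<subseteq> X" "card T \<le> t" "\<And>x. x \<in> X - T \<Longrightarrow> card T = t \<and> (\<forall>w\<in>T. w < x)"
proof (cases "t \<le> card X")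
  case True
  then obtain T where T: "T \<subseteq> X" "card T = t" "\<forall>x\<in>X. \<forall>w\<in>T. x \<le> w \<longrightarrow> x \<in> T"
    using initial_segment[OF assms] by blast
  then show ?thesis by (intro that[of T]) (auto simp: not_le[symmetric])
next
  case False then show ?thesis by (intro that[of X]) auto
qed

lemma last_elements:
  fixes X :: "nat set"
  assumes "finite X"
  obtains T where "T \<subseteq> X" "card T \<le> t" "\<And>x. x \<in> X - T \<Longrightarrow> card T = t \<and> (\<forall>w\<in>T. x < w)"
proof (cases "t \<le> card X")
  case True
  then obtain T where T: "T \<subseteq> X" "card T = t" "\<forall>x\<in>X. \<forall>w\<in>T. w \<le> x \<longrightarrow> x \<in> T"
    using final_segment[OF assms] by blast
  then show ?thesis by (intro that[of T]) (auto simp: not_le[symmetric])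
next
  case False then show ?thesis by (intro that[of X]) auto
qed

text \<open>Runs of \<open>t\<close> consecutive elements of \<open>S\<close>, expressed by
  convexity inside \<open>S\<close> to avoid an enumeration.\<close>

definition windows :: "nat \<Rightarrow> nat set \<Rightarrow> nat set set" where
  "windows t S = {W. W \<subseteq> S \<and> card W = t \<and> (\<forall>x\<in>S. (\<exists>u\<in>W. u \<le> x) \<longrightarrow> (\<exists>v\<in>W. x \<le> v) \<longrightarrow> x \<in> W)}"

text \<open>An element of one set that is missing from the other lies above no element of the other,
  so the sets are comparable by inclusion and equal size finishes.\<close>

lemma eq_if_up_closed_card_eq:
  fixes L L' :: "nat set"
  assumes "finite L" "finite L'" "card L = card L'"
    "\<And>u s. u \<in> L \<Longrightarrow> s \<in> L' \<Longrightarrow> u \<le> s \<Longrightarrow> s \<in> L" "\<And>u s. u \<in> L' \<Longrightarrow> s \<in> L \<Longrightarrow> u \<le> s \<Longrightarrow> s \<in> L'"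
  shows "L = L'"
proof (rule ccontr)
  assume ne: "L \<noteq> L'"
  have "L \<subseteq> L' \<or> L' \<subseteq> L" using assms(4,5) by (meson nle_le subsetI)
  then show False using ne assms(1-3) card_subset_eq by metis
qed

lemma eq_if_down_closed_card_eq:
  fixes L L' :: "nat set"
  assumes "finite L" "finite L'" "card L = card L'"
    "\<And>u s. u \<in> L \<Longrightarrow> s \<in> L' \<Longrightarrow> s \<le> u \<Longrightarrow> s \<in> L" "\<And>u s. u \<in> L' \<Longrightarrow> s \<in> L \<Longrightarrow> s \<le> u \<Longrightarrow> s \<in> L'"
  shows "L = L'"
proof (rule ccontr)
  assume ne: "L \<noteq> L'"
  have "L \<subseteq> L' \<or> L' \<subseteq> L" using assms(4,5) by (meson nle_le subsetI)
  then show False using ne assms(1-3) card_subset_eq by metis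
qed

text \<open>Such a window is determined by the number of its elements up to \<open>x\<close>: it
  consists of that many last elements of \<open>S\<close> up to \<open>x\<close> and of the first
  elements of \<open>S\<close> beyond \<open>x\<close>. The number lies between 1 and
  \<open>t\<close>.\<close>

lemma card_windows_around:
  assumes fS: "finite S"
  shows "card {W \<in> windows t S. (\<exists>u\<in>W. u \<le> x) \<and> (\<exists>v\<in>W. x \<le> v)} \<le> t"
proof -
  let ?A = "{W \<in> windows t S. (\<exists>u\<in>W. u \<le> x) \<and> (\<exists>v\<in>W. x \<le> v)}"
  have fin: "finite W" if "W \<in> ?A" for W using that fS finite_subset unfolding windows_def by blast
  have "inj_on (\<lambda>W. card {w\<in>W. w \<le> x}) ?A"
  proof (rule inj_onI)
    fix W V assume W: "W \<in> ?A" and V: "V \<in> ?A" and eq: "card {w\<in>W. w \<le> x} = card {w\<in>V. w \<le> x}"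
    have WS: "W \<subseteq> S" "V \<subseteq> S" "card W = t" "card V = t" using W V unfolding windows_def by auto
    have cW: "s \<in> W" if "s \<in> S" "u \<in> W" "v \<in> W" "u \<le> s" "s \<le> v" for s u v
      using W that unfolding windows_def by blast
    have cV: "s \<in> V" if "s \<in> S" "u \<in> V" "v \<in> V" "u \<le> s" "s \<le> v" for s u v
      using V that unfolding windows_def by blast
    obtain v v' u u' where vv: "v \<in> W" "x \<le> v" "v' \<in> V" "x \<le> v'" "u \<in> W" "u \<le> x" "u' \<in> V" "u' \<le> x"
      using W V by auto
    have low: "{w\<in>W. w \<le> x} = {w\<in>V. w \<le> x}"
    proof (rule eq_if_up_closed_card_eq[OF _ _ eq])
      show "finite {w\<in>W. w \<le> x}" "finite {w\<in>V. w \<le> x}" using fin W V by auto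
      show "s \<in> {w\<in>W. w \<le> x}" if "a \<in> {w\<in>W. w \<le> x}" "s \<in> {w\<in>V. w \<le> x}" "a \<le> s" for a s
        using that cW[of s a v] WS vv by auto
      show "s \<in> {w\<in>V. w \<le> x}" if "a \<in> {w\<in>V. w \<le> x}" "s \<in> {w\<in>W. w \<le> x}" "a \<le> s" for a s
        using that cV[of s a v'] WS vv by auto
    qed
    have split: "card {w\<in>Y. x < w} = card Y - card {w\<in>Y. w \<le> x}" if "finite Y" for Y
    proof -
      have "{w\<in>Y. x < w} = Y - {w\<in>Y. w \<le> x}" by auto
      then show ?thesis using that by (simp add: card_Diff_subset)
    qed
    have "card {w\<in>W. x < w} = card {w\<in>V. x < w}" using split fin W V eq WS by simp
    then have "{w\<in>W. x < w} = {w\<in>V. x < w}"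
    proof (rule eq_if_down_closed_card_eq[rotated 2])
      show "finite {w\<in>W. x < w}" "finite {w\<in>V. x < w}" using fin W V by auto
      show "s \<in> {w\<in>W. x < w}" if "a \<in> {w\<in>W. x < w}" "s \<in> {w\<in>V. x < w}" "s \<le> a" for a s
        using that cW[of s u a] WS vv by auto
      show "s \<in> {w\<in>V. x < w}" if "a \<in> {w\<in>V. x < w}" "s \<in> {w\<in>W. x < w}" "s \<le> a" for a s
        using that cV[of s u' a] WS vv by auto
    qed
    moreover have "Y = {w\<in>Y. w \<le> x} \<union> {w\<in>Y. x < w}" for Y by auto
    ultimately show "W = V" using low by metis
  qed
  moreover have "(\<lambda>W. card {w\<in>W. w \<le> x}) ` ?A \<subseteq> {1..t}"
  proof
    fix y assume "y \<in> (\<lambda>W. card {w\<in>W. w \<le> x}) ` ?A"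
    then obtain W where W: "W \<in> ?A" "y = card {w\<in>W. w \<le> x}" by blast
    have "{w\<in>W. w \<le> x} \<noteq> {}" using W by auto
    then have "card {w\<in>W. w \<le> x} > 0" using fin[OF W(1)] by (simp add: card_gt_0_iff)
    moreover have "card {w\<in>W. w \<le> x} \<le> card W" using fin[OF W(1)] by (intro card_mono) auto
    moreover have "card W = t" using W unfolding windows_def by auto
    ultimately show "y \<in> {1..t}" using W(2) by auto
  qed
  ultimately show ?thesis using card_inj_on_le[of _ ?A "{1..t}"] by force
qed

text \<open>If all rows precede all columns, row \<^term>\<open>a\<close> is alive between its first and its last entry,
  and a column meets a set of consecutive alive rows.  A set of \<^term>\<open>t\<close> consecutive alive rows can
  appear only when a row is born or dies, so there are linearly many such sets, and each of them lies
  in fewer than \<^term>\<open>t\<close> columns.\<close>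

lemma bipartite_bound:
  assumes fE: "finite E" and pc: "plus_closed E" and bf: "biclique_free t E" and t: "t > 0"
    and sep: "\<And>a c. (a, c) \<in> E \<Longrightarrow> a < m \<and> m \<le> c"
  shows "card E \<le> 3 * t * t * order_of_graph E"
proof -
  define R where "R = fst ` E"
  define C where "C = snd ` E"
  define fr where "fr a = Min {c. (a, c) \<in> E}" for a
  define la where "la a = Max {c. (a, c) \<in> E}" for a
  define col where "col c = {a. (a, c) \<in> E}" for c
  define alive where "alive c = {a\<in>R. fr a \<le> c \<and> c \<le> la a}" for c
  have fR: "finite R" and fC: "finite C" using fE by (auto simp: R_def C_def)
  have frow: "finite {c. (a, c) \<in> E}" for a
    by (rule finite_subset[OF _ fC]) (force simp: C_def)
  have fcol: "finite (col c)" for c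
    by (rule finite_subset[OF _ fR]) (force simp: R_def col_def)
  have frla: "(a, fr a) \<in> E" "(a, la a) \<in> E" if "a \<in> R" for a
  proof -
    have "{c. (a, c) \<in> E} \<noteq> {}" using that by (auto simp: R_def)
    then show "(a, fr a) \<in> E" "(a, la a) \<in> E"
      using Min_in[OF frow] Max_in[OF frow] unfolding fr_def la_def by blast+
  qed
  have frle: "fr a \<le> c" "c \<le> la a" if "(a, c) \<in> E" for a c
    using that frow unfolding fr_def la_def by auto
  have colR: "col c \<subseteq> alive c" for c using frle by (force simp: col_def alive_def R_def)
  have fal: "finite (alive c)" for c using fR by (auto simp: alive_def)
  have conv: "a \<in> col c" if "a \<in> alive c" "b \<in> col c" "b' \<in> col c" "b \<le> a" "a \<le> b'" for a b b' c
  proof -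
    have "a \<in> R" "fr a \<le> c" "c \<le> la a" using that by (auto simp: alive_def)
    \<comment> \<open>This is where the separation by \<open>m\<close> enters: it supplies the side
      condition of plus-closedness.\<close>
    moreover have "b' < fr a" using that sep[of b' c] sep[OF frla(1)[OF \<open>a \<in> R\<close>]] by (simp add: col_def)
    ultimately show ?thesis using that frla[of a] plus_closedD[OF pc, of b a b' "fr a" c "la a"]
      by (auto simp: col_def)
  qed
  define Ws where "Ws = (\<Union>c\<in>C. windows t (alive c))"
  \<comment> \<open>The first column after the death of \<open>x\<close>. If \<open>x\<close> lives
    until the last column this is the minimum of the empty set; \<open>cardAr\<close> holds for any
    column, so the value is harmless.\<close>
  define nxt where "nxt x = Min {c\<in>C. la x < c}" for x
  define Ar where "Ar x c = {W \<in> windows t (alive c). (\<exists>u\<in>W. u \<le> x) \<and> (\<exists>v\<in>W. x \<le> v)}" for x c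
  have Ws_sub: "Ws \<subseteq> (\<Union>x\<in>R. Ar x (fr x) \<union> Ar x (nxt x))"
  proof
    fix W assume "W \<in> Ws"
    then have ex: "\<exists>c. c \<in> C \<and> W \<in> windows t (alive c)" by (auto simp: Ws_def)
    \<comment> \<open>In the first column where \<open>W\<close> is a window, either a row of
      \<open>W\<close> is born or a row that interrupted \<open>W\<close> in the preceding column
      \<open>cm\<close> has died.\<close>
    define c0 where "c0 = (LEAST c. c \<in> C \<and> W \<in> windows t (alive c))"
    have c0: "c0 \<in> C" "W \<in> windows t (alive c0)" unfolding c0_def using LeastI_ex[OF ex] by auto
    have least: "\<not> W \<in> windows t (alive c)" if "c \<in> C" "c < c0" for c
      using that not_less_Least unfolding c0_def by blast
    have WA: "W \<subseteq> alive c0" "card W = t" using c0 by (auto simp: windows_def)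
    have Wne: "W \<noteq> {}" using WA t by auto
    show "W \<in> (\<Union>x\<in>R. Ar x (fr x) \<union> Ar x (nxt x))"
    proof (cases "\<exists>x\<in>W. fr x = c0")
      case True
      then obtain x where "x \<in> W" "fr x = c0" by blast
      then have "x \<in> R" "W \<in> Ar x (fr x)" using WA c0 by (auto simp: alive_def Ar_def)
      then show ?thesis by blast
    next
      case False
      then have lt: "fr x < c0" if "x \<in> W" for x using that WA by (force simp: alive_def)
      obtain w where w: "w \<in> W" using Wne by blast
      have wR: "w \<in> R" using w WA by (auto simp: alive_def)
      then have "fr w \<in> C" using frla by (force simp: C_def)
      then have ne: "{c\<in>C. c < c0} \<noteq> {}" using lt[OF w] by auto
      define cm where "cm = Max {c\<in>C. c < c0}"
      have cm: "cm \<in> C" "cm < c0" using Max_in[OF _ ne] fC by (auto simp: cm_def)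
      have cmax: "c \<le> cm" if "c \<in> C" "c < c0" for c unfolding cm_def using that fC by auto
      have Wal: "W \<subseteq> alive cm"
      proof
        fix x assume x: "x \<in> W"
        then have xR: "x \<in> R" "c0 \<le> la x" using WA by (auto simp: alive_def)
        have "fr x \<in> C" using frla[OF xR(1)] by (force simp: C_def)
        then have "fr x \<le> cm" using cmax lt[OF x] by auto
        then show "x \<in> alive cm" using xR cm by (auto simp: alive_def)
      qed
      have "\<not> W \<in> windows t (alive cm)" using least cm by blast
      then obtain x where x: "x \<in> alive cm" "\<exists>u\<in>W. u \<le> x" "\<exists>v\<in>W. x \<le> v" "x \<notin> W"
        using Wal WA by (auto simp: windows_def)
      have "x \<notin> alive c0" using x c0 by (auto simp: windows_def)
      then have lx: "la x < c0" "x \<in> R" "cm \<le> la x" using x cm by (auto simp: alive_def)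
      have "nxt x = c0" unfolding nxt_def
      proof (rule Min_eqI)
        show "finite {c\<in>C. la x < c}" using fC by auto
        show "c0 \<in> {c\<in>C. la x < c}" using c0 lx by auto
        show "c0 \<le> y" if "y \<in> {c\<in>C. la x < c}" for y
          using that cmax[of y] lx by force
      qed
      then show ?thesis using x c0 lx by (auto simp: Ar_def)
    qed
  qed
  have cardAr: "card (Ar x c) \<le> t" for x c unfolding Ar_def using card_windows_around[OF fal] .
  have finW: "finite (windows t (alive c))" for c
    by (rule finite_subset[of _ "Pow (alive c)"]) (auto simp: windows_def fal)
  have finAr: "finite (Ar x c)" for x c unfolding Ar_def using finW by auto
  have "card Ws \<le> card (\<Union>x\<in>R. Ar x (fr x) \<union> Ar x (nxt x))"
    using Ws_sub fR finAr by (intro card_mono) auto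
  also have "\<dots> \<le> (\<Sum>x\<in>R. card (Ar x (fr x) \<union> Ar x (nxt x)))" by (rule card_UN_le[OF fR])
  also have "\<dots> \<le> (\<Sum>x\<in>R. 2 * t)"
    by (intro sum_mono order.trans[OF card_Un_le]) (metis add_mono cardAr mult_2)
  finally have cardWs: "card Ws \<le> card R * (2 * t)" by simp
  have finWs: "finite Ws" unfolding Ws_def using fC finW by auto
  \<comment> \<open>An edge is charged to the window of the \<open>t\<close> lowest entries from
    \<open>b\<close> upwards in its column; fewer than \<open>t\<close> entries upwards can happen
    for at most \<open>t\<close> edges of a column.\<close>
  define up where "up b c = {a\<in>col c. b \<le> a}" for b c
  define E1 where "E1 = {(b, c). (b, c) \<in> E \<and> card (up b c) < t}"
  define E2 where "E2 = {(b, c). (b, c) \<in> E \<and> t \<le> card (up b c)}"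
  have e1: "E1 = (\<Union>c\<in>C. (\<lambda>b. (b, c)) ` {b\<in>col c. card (up b c) < t})"
    by (auto simp: E1_def C_def col_def)
  have "card E1 \<le> (\<Sum>c\<in>C. card ((\<lambda>b. (b, c)) ` {b\<in>col c. card (up b c) < t}))"
    unfolding e1 by (rule card_UN_le[OF fC])
  also have "\<dots> \<le> (\<Sum>c\<in>C. t)"
  proof (intro sum_mono order.trans[OF card_image_le])
    fix c
    let ?S = "{b\<in>col c. card (up b c) < t}"
    show fS: "finite ?S" using fcol by auto
    show "card ?S \<le> t"
    proof (cases "?S = {}")
      case False
      then have "Min ?S \<in> ?S" using fS Min_in by blast
      moreover have "?S \<subseteq> up (Min ?S) c" using fS by (auto simp: up_def)
      ultimately show ?thesis using card_mono[of "up (Min ?S) c" ?S] fcol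
        by (auto simp: up_def)
    qed (simp only: card.empty)
  qed
  finally have c1: "card E1 \<le> card C * t" by simp
  have exW: "\<exists>W. W \<subseteq> up b c \<and> b \<in> W \<and> W \<in> windows t (alive c)" if "(b, c) \<in> E2" for b c
  proof -
    have E: "(b, c) \<in> E" "t \<le> card (up b c)" using that by (auto simp: E2_def)
    have "finite (up b c)" using fcol by (auto simp: up_def)
    then obtain W where W: "W \<subseteq> up b c" "card W = t" "\<forall>x\<in>up b c. \<forall>w\<in>W. x \<le> w \<longrightarrow> x \<in> W"
      using initial_segment[OF _ E(2)] by blast
    obtain w where w: "w \<in> W" using W t by fastforce
    have "b \<in> up b c" using E by (auto simp: up_def col_def)
    then have "b \<in> W" using W w by (auto simp: up_def)
    moreover have "W \<in> windows t (alive c)" unfolding windows_def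
    proof (intro CollectI conjI ballI impI)
      show "W \<subseteq> alive c" using W colR by (auto simp: up_def)
      show "card W = t" by fact
      fix x assume x: "x \<in> alive c" "\<exists>u\<in>W. u \<le> x" "\<exists>v\<in>W. x \<le> v"
      then obtain u v where uv: "u \<in> W" "v \<in> W" "u \<le> x" "x \<le> v" by blast
      then have "x \<in> col c" using conv[OF x(1), of u v] W by (auto simp: up_def)
      then have "x \<in> up b c" using uv W by (auto simp: up_def)
      then show "x \<in> W" using W uv by blast
    qed
    ultimately show ?thesis using W by blast
  qed
  define wn where "wn e = (SOME W. W \<subseteq> up (fst e) (snd e) \<and> fst e \<in> W \<and> W \<in> windows t (alive (snd e)))" for e
  have wn: "wn e \<subseteq> up (fst e) (snd e) \<and> fst e \<in> wn e \<and> wn e \<in> windows t (alive (snd e))" if "e \<in> E2" for e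
    unfolding wn_def using someI_ex[OF exW[of "fst e" "snd e"]] that by simp
  have "E2 \<subseteq> (\<Union>W\<in>Ws. {e\<in>E2. wn e = W})"
  proof
    fix e assume e: "e \<in> E2"
    then have "snd e \<in> C" by (auto simp: E2_def C_def)
    then have "wn e \<in> Ws" using wn[OF e] by (auto simp: Ws_def)
    then show "e \<in> (\<Union>W\<in>Ws. {e\<in>E2. wn e = W})" using e by auto
  qed
  moreover have fE2: "finite E2" by (rule finite_subset[OF _ fE]) (auto simp: E2_def)
  ultimately have "card E2 \<le> card (\<Union>W\<in>Ws. {e\<in>E2. wn e = W})"
    using finWs by (intro card_mono) auto
  also have "\<dots> \<le> (\<Sum>W\<in>Ws. card {e\<in>E2. wn e = W})" by (rule card_UN_le[OF finWs])
  also have "\<dots> \<le> (\<Sum>W\<in>Ws. t)"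
  proof (rule sum_mono)
    fix W assume "W \<in> Ws"
    then have cW: "card W = t" by (auto simp: Ws_def windows_def)
    let ?X = "{e\<in>E2. wn e = W}"
    have Wup: "W \<subseteq> up (fst e) (snd e)" "fst e \<in> W" if "e \<in> ?X" for e using wn[of e] that by auto
    \<comment> \<open>The row of an edge charged to \<open>W\<close> is the least element of
      \<open>W\<close>, so each column contributes at most one edge, and \<open>W\<close> together
      with these columns is a biclique.\<close>
    have "inj_on snd ?X"
    proof (rule inj_onI)
      fix e e' assume e: "e \<in> ?X" "e' \<in> ?X" "snd e = snd e'"
      have "fst e \<le> fst e'" "fst e' \<le> fst e" using Wup[OF e(1)] Wup[OF e(2)] by (auto simp: up_def)
      then show "e = e'" using e by (simp add: prod_eq_iff)
    qed
    then have "card ?X = card (snd ` ?X)" by (simp add: card_image)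
    moreover have "W \<times> snd ` ?X \<subseteq> E" using Wup by (fastforce simp: up_def col_def)
    then have "card (snd ` ?X) < t"
      by (rule biclique_free_card[OF bf]) (use cW fE2 in auto)
    ultimately show "card ?X \<le> t" by simp
  qed
  finally have c2: "card E2 \<le> card Ws * t" by simp
  have "E = E1 \<union> E2" by (auto simp: E1_def E2_def)
  then have "card E \<le> card E1 + card E2" using card_Un_le by metis
  also have "\<dots> \<le> card C * t + card R * (2 * t) * t" using c1 c2 cardWs mult_le_mono1[of "card Ws" "card R * (2*t)" t] by linarith
  also have "\<dots> \<le> 3 * t * t * (card R + card C)"
  proof -
    have "card C * t \<le> card C * (3 * t * t)" using t by simp
    moreover have "card R * (2 * t) * t \<le> card R * (3 * t * t)" by simp
    moreover have "3 * t * t * (card R + card C) = card R * (3 * t * t) + card C * (3 * t * t)"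
      by (simp add: algebra_simps)
    ultimately show ?thesis by linarith
  qed
  finally show ?thesis by (simp add: order_of_graph_def R_def C_def)
qed

section \<open>Counting edges between blocks\<close>

text \<open>Since edges run between different blocks, all rows adjacent to a column block
  \<open>J\<close> precede its first index, so \<open>bipartite_bound\<close> applies to each
  \<open>J\<close>. The gain lies in choosing \<open>R J\<close> small on average.\<close>

lemma column_block_bound:
  assumes fE: "finite E" and pc: "plus_closed E" and bf: "biclique_free t E" and t: "t > 0"
    and f: "mono f" and cross: "\<And>a c. (a, c) \<in> E \<Longrightarrow> f a < f c"
    and F: "F \<subseteq> E" "\<And>b c. (b, c) \<in> F \<Longrightarrow> b \<in> R (f c)" and fR: "\<And>J. finite (R J)"
  shows "card F \<le> 3 * t * t * ((\<Sum>J\<in>f ` snd ` E. card (R J)) + card (snd ` E))"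
proof -
  define G where "G J = E \<inter> R J \<times> {c. f c = J}" for J
  have fin: "finite (f ` snd ` E)" using fE by auto
  have fG: "finite (G J)" for J using fE by (auto simp: G_def)
  have cG: "card (G J) \<le> 3 * t * t * (card (R J) + card {c\<in>snd ` E. f c = J})" for J
  proof -
    have "card (G J) \<le> 3 * t * t * order_of_graph (G J)"
    proof (rule bipartite_bound[OF fG _ _ t])
      show "plus_closed (G J)" unfolding G_def by (rule plus_closed_restrict[OF pc])
      show "biclique_free t (G J)" using bf by (rule biclique_free_mono) (auto simp: G_def)
      show "a < (LEAST c. f c = J) \<and> (LEAST c. f c = J) \<le> c" if "(a, c) \<in> G J" for a c
      proof
        have c: "f c = J" and lt: "f a < J" using that cross by (auto simp: G_def)
        have "f (LEAST c. f c = J) = J" by (rule LeastI[of _ c]) (fact c)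
        then show "a < (LEAST c. f c = J)" using lt f by (metis leD leI monoD)
        show "(LEAST c. f c = J) \<le> c" by (rule Least_le) (fact c)
      qed
    qed
    also have "\<dots> \<le> 3 * t * t * (card (R J) + card {c\<in>snd ` E. f c = J})"
    proof -
      have "card (fst ` G J) \<le> card (R J)" by (rule card_mono[OF fR]) (auto simp: G_def)
      moreover have "card (snd ` G J) \<le> card {c\<in>snd ` E. f c = J}"
        using fE by (intro card_mono) (auto simp: G_def)
      ultimately show ?thesis unfolding order_of_graph_def by (intro mult_le_mono2) simp
    qed
    finally show ?thesis .
  qed
  have "F \<subseteq> (\<Union>J\<in>f ` snd ` E. G J)" using F by (force simp: G_def)
  then have "card F \<le> card (\<Union>J\<in>f ` snd ` E. G J)" using fE fG by (intro card_mono) auto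
  also have "\<dots> \<le> (\<Sum>J\<in>f ` snd ` E. card (G J))" by (rule card_UN_le[OF fin])
  also have "\<dots> \<le> (\<Sum>J\<in>f ` snd ` E. 3 * t * t * (card (R J) + card {c\<in>snd ` E. f c = J}))"
    by (intro sum_mono cG)
  also have "\<dots> = 3 * t * t * ((\<Sum>J\<in>f ` snd ` E. card (R J)) + (\<Sum>J\<in>f ` snd ` E. card {c\<in>snd ` E. f c = J}))"
    by (simp add: sum.distrib flip: sum_distrib_left)
  also have "(\<Sum>J\<in>f ` snd ` E. card {c\<in>snd ` E. f c = J}) = card (snd ` E)"
    using sum.image_gen[of "snd ` E" "\<lambda>_. 1::nat" f] fE by simp
  finally show ?thesis .
qed

text \<open>The mirror image; the separating index is now the first one beyond the row
  block.\<close>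

lemma row_block_bound:
  assumes fE: "finite E" and pc: "plus_closed E" and bf: "biclique_free t E" and t: "t > 0"
    and f: "mono f" and cross: "\<And>a c. (a, c) \<in> E \<Longrightarrow> f a < f c"
    and F: "F \<subseteq> E" "\<And>b c. (b, c) \<in> F \<Longrightarrow> c \<in> R (f b)" and fR: "\<And>J. finite (R J)"
  shows "card F \<le> 3 * t * t * ((\<Sum>J\<in>f ` fst ` E. card (R J)) + card (fst ` E))"
proof -
  define G where "G J = E \<inter> {b. f b = J} \<times> R J" for J
  have fin: "finite (f ` fst ` E)" using fE by auto
  have fG: "finite (G J)" for J using fE by (auto simp: G_def)
  have cG: "card (G J) \<le> 3 * t * t * (card (R J) + card {b\<in>fst ` E. f b = J})" for J
  proof -
    have "card (G J) \<le> 3 * t * t * order_of_graph (G J)"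
    proof (rule bipartite_bound[OF fG _ _ t])
      show "plus_closed (G J)" unfolding G_def by (rule plus_closed_restrict[OF pc])
      show "biclique_free t (G J)" using bf by (rule biclique_free_mono) (auto simp: G_def)
      show "a < (LEAST c. J < f c) \<and> (LEAST c. J < f c) \<le> c" if "(a, c) \<in> G J" for a c
      proof
        have a: "f a = J" and lt: "J < f c" using that cross by (auto simp: G_def)
        have "J < f (LEAST c. J < f c)" by (rule LeastI[of _ c]) (fact lt)
        then show "a < (LEAST c. J < f c)" using a f by (metis leD leI monoD)
        show "(LEAST c. J < f c) \<le> c" by (rule Least_le) (fact lt)
      qed
    qed
    also have "\<dots> \<le> 3 * t * t * (card (R J) + card {b\<in>fst ` E. f b = J})"
    proof -
      have "card (snd ` G J) \<le> card (R J)" by (rule card_mono[OF fR]) (auto simp: G_def)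
      moreover have "card (fst ` G J) \<le> card {b\<in>fst ` E. f b = J}"
        using fE by (intro card_mono) (auto simp: G_def)
      ultimately show ?thesis unfolding order_of_graph_def by (intro mult_le_mono2) simp
    qed
    finally show ?thesis .
  qed
  have "F \<subseteq> (\<Union>J\<in>f ` fst ` E. G J)" using F by (force simp: G_def)
  then have "card F \<le> card (\<Union>J\<in>f ` fst ` E. G J)" using fE fG by (intro card_mono) auto
  also have "\<dots> \<le> (\<Sum>J\<in>f ` fst ` E. card (G J))" by (rule card_UN_le[OF fin])
  also have "\<dots> \<le> (\<Sum>J\<in>f ` fst ` E. 3 * t * t * (card (R J) + card {b\<in>fst ` E. f b = J}))"
    by (intro sum_mono cG)
  also have "\<dots> = 3 * t * t * ((\<Sum>J\<in>f ` fst ` E. card (R J)) + (\<Sum>J\<in>f ` fst ` E. card {b\<in>fst ` E. f b = J}))"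
    by (simp add: sum.distrib flip: sum_distrib_left)
  also have "(\<Sum>J\<in>f ` fst ` E. card {b\<in>fst ` E. f b = J}) = card (fst ` E)"
    using sum.image_gen[of "fst ` E" "\<lambda>_. 1::nat" f] fE by simp
  finally show ?thesis .
qed

lemma sum_card_fibres_le:
  assumes "finite A" "finite S"
  shows "(\<Sum>J\<in>S. card {b\<in>A. g b = J}) \<le> card A"
proof -
  have "(\<Sum>J\<in>S. card {b\<in>A. g b = J}) = card (\<Union>J\<in>S. {b\<in>A. g b = J})"
    by (rule card_UN_disjoint[symmetric]) (use assms in auto)
  also have "\<dots> \<le> card A" using assms by (intro card_mono) auto
  finally show ?thesis .
qed

text \<open>The graph with every block contracted. It need not be plus-closed, because the edges at
  a block may use different rows of it; therefore the recursion carries \<open>E\<close> and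
  \<open>f\<close> along instead of this graph.\<close>

definition block_pairs :: "(nat \<Rightarrow> nat) \<Rightarrow> (nat \<times> nat) set \<Rightarrow> (nat \<times> nat) set" where
  "block_pairs f E = (\<lambda>(a, c). (f a, f c)) ` E"

definition first_nbr :: "(nat \<times> nat) set \<Rightarrow> nat \<Rightarrow> nat" where "first_nbr E a = Min {c. (a, c) \<in> E}"
definition last_nbr :: "(nat \<times> nat) set \<Rightarrow> nat \<Rightarrow> nat" where "last_nbr E a = Max {c. (a, c) \<in> E}"
text \<open>Rows precede columns, so the neighbour of a column closest to the diagonal is its
  greatest row.\<close>

definition near_nbr :: "(nat \<times> nat) set \<Rightarrow> nat \<Rightarrow> nat" where "near_nbr E c = Max {a. (a, c) \<in> E}"
definition far_nbr :: "(nat \<times> nat) set \<Rightarrow> nat \<Rightarrow> nat" where "far_nbr E c = Min {a. (a, c) \<in> E}"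

lemma extreme_nbrs:
  assumes "finite E" "(a, c) \<in> E"
  shows "(a, first_nbr E a) \<in> E" "first_nbr E a \<le> c" "(a, last_nbr E a) \<in> E" "c \<le> last_nbr E a"
    "(near_nbr E c, c) \<in> E" "a \<le> near_nbr E c" "(far_nbr E c, c) \<in> E" "far_nbr E c \<le> a"
proof -
  have f1: "finite {c. (a, c) \<in> E}" by (rule finite_subset[of _ "snd ` E"]) (use assms in force)+
  have f2: "finite {a. (a, c) \<in> E}" by (rule finite_subset[of _ "fst ` E"]) (use assms in force)+
  have "{c. (a, c) \<in> E} \<noteq> {}" "{a. (a, c) \<in> E} \<noteq> {}" using assms by auto
  then show "(a, first_nbr E a) \<in> E" "(a, last_nbr E a) \<in> E" "(near_nbr E c, c) \<in> E" "(far_nbr E c, c) \<in> E"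
    using Min_in[OF f1] Max_in[OF f1] Min_in[OF f2] Max_in[OF f2]
    unfolding first_nbr_def last_nbr_def near_nbr_def far_nbr_def by auto
  show "first_nbr E a \<le> c" "c \<le> last_nbr E a" "a \<le> near_nbr E c" "far_nbr E c \<le> a"
    using f1 f2 assms unfolding first_nbr_def last_nbr_def near_nbr_def far_nbr_def by auto
qed

text \<open>Edges from a row into the first or last block it meets, and from a column into the nearest or
  farthest one, are handled by the bipartite bound.  Between two blocks the remaining edges are closed
  under moving up and to the right, hence they only use \<^term>\<open>t\<close> rows or \<^term>\<open>t\<close> columns.\<close>

lemma crossing_edges_bound:
  assumes fE: "finite E" and pc: "plus_closed E" and bf: "biclique_free t E" and t: "t > 0"
    and f: "mono f" and cross: "\<And>a c. (a, c) \<in> E \<Longrightarrow> f a < f c"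
  shows "card E \<le> 18 * t ^ 3 * (order_of_graph E + card (block_pairs f E))"
proof -
  define rows where "rows = fst ` E"
  define cols where "cols = snd ` E"
  have fr: "finite rows" and fc: "finite cols" using fE by (auto simp: rows_def cols_def)
  note ex = extreme_nbrs[OF fE]
  have lt: "x < y" if "f x < f y" for x y using that f by (metis leD leI monoD)
  define E1 where "E1 = {(b, c). (b, c) \<in> E \<and> f c = f (first_nbr E b)}"
  define E2 where "E2 = {(b, c). (b, c) \<in> E \<and> f c = f (last_nbr E b)}"
  define E3 where "E3 = {(b, c). (b, c) \<in> E \<and> f b = f (near_nbr E c)}"
  define E4 where "E4 = {(b, c). (b, c) \<in> E \<and> f b = f (far_nbr E c)}"
  define Q where "Q = E - E1 - E2 - E3 - E4"
  have memr: "b \<in> rows" "c \<in> cols" if "(b, c) \<in> E" for b c using that by (auto simp: rows_def cols_def image_iff) force+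
  let ?K = "3 * t * t"
  \<comment> \<open>Each row has a single first block, so the row sets belonging to the blocks are
    disjoint and the total is linear. The other three extremes are treated alike.\<close>
  have c1: "card E1 \<le> ?K * (card rows + card cols)"
  proof -
    have "card E1 \<le> ?K * ((\<Sum>J\<in>f ` snd ` E. card {b\<in>rows. f (first_nbr E b) = J}) + card (snd ` E))"
      by (rule column_block_bound[OF fE pc bf t f cross]) (auto simp: E1_def memr fr)
    also have "\<dots> \<le> ?K * (card rows + card cols)"
      using sum_card_fibres_le[OF fr, of "f ` snd ` E" "\<lambda>b. f (first_nbr E b)"] fE by (simp add: cols_def)
    finally show ?thesis .
  qed
  have c2: "card E2 \<le> ?K * (card rows + card cols)"
  proof -
    have "card E2 \<le> ?K * ((\<Sum>J\<in>f ` snd ` E. card {b\<in>rows. f (last_nbr E b) = J}) + card (snd ` E))"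
      by (rule column_block_bound[OF fE pc bf t f cross]) (auto simp: E2_def memr fr)
    also have "\<dots> \<le> ?K * (card rows + card cols)"
      using sum_card_fibres_le[OF fr, of "f ` snd ` E" "\<lambda>b. f (last_nbr E b)"] fE by (simp add: cols_def)
    finally show ?thesis .
  qed
  have c3: "card E3 \<le> ?K * (card rows + card cols)"
  proof -
    have "card E3 \<le> ?K * ((\<Sum>J\<in>f ` fst ` E. card {b\<in>cols. f (near_nbr E b) = J}) + card (fst ` E))"
      by (rule row_block_bound[OF fE pc bf t f cross]) (auto simp: E3_def memr fc)
    also have "\<dots> \<le> ?K * (card rows + card cols)"
      using sum_card_fibres_le[OF fc, of "f ` fst ` E" "\<lambda>b. f (near_nbr E b)"] fE by (simp add: rows_def)
    finally show ?thesis .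
  qed
  have c4: "card E4 \<le> ?K * (card rows + card cols)"
  proof -
    have "card E4 \<le> ?K * ((\<Sum>J\<in>f ` fst ` E. card {b\<in>cols. f (far_nbr E b) = J}) + card (fst ` E))"
      by (rule row_block_bound[OF fE pc bf t f cross]) (auto simp: E4_def memr fc)
    also have "\<dots> \<le> ?K * (card rows + card cols)"
      using sum_card_fibres_le[OF fc, of "f ` fst ` E" "\<lambda>b. f (far_nbr E b)"] fE by (simp add: rows_def)
    finally show ?thesis .
  qed
  have QE: "Q \<subseteq> E" by (auto simp: Q_def)
  have Qrow: "f (first_nbr E b) < f c \<and> f c < f (last_nbr E b) \<and> f (far_nbr E c) < f b \<and> f b < f (near_nbr E c)"
    if "(b, c) \<in> Q" for b c
  proof -
    have "(b, c) \<in> E" using that QE by auto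
    then have "f (first_nbr E b) \<le> f c" "f c \<le> f (last_nbr E b)" "f (far_nbr E c) \<le> f b" "f b \<le> f (near_nbr E c)"
      using ex f by (auto intro: monoD)
    moreover have "f (first_nbr E b) \<noteq> f c" "f c \<noteq> f (last_nbr E b)" "f (far_nbr E c) \<noteq> f b" "f b \<noteq> f (near_nbr E c)"
      using that \<open>(b, c) \<in> E\<close> by (auto simp: Q_def E1_def E2_def E3_def E4_def)
    ultimately show ?thesis by auto
  qed
  define A where "A I J = {b. \<exists>c. (b, c) \<in> Q \<and> f b = I \<and> f c = J}" for I J
  define B where "B I J = {c. \<exists>b. (b, c) \<in> Q \<and> f b = I \<and> f c = J}" for I J
  have fA: "finite (A I J)" for I J by (rule finite_subset[OF _ fr]) (use QE memr in \<open>auto simp: A_def\<close>)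
  have fB: "finite (B I J)" for I J by (rule finite_subset[OF _ fc]) (use QE memr in \<open>auto simp: B_def\<close>)
  \<comment> \<open>Two applications of plus-closedness. The row \<open>b0\<close> bounds
    \<open>(b, c0)\<close> from above; then the new edge \<open>(b, c0)\<close> is the left arm for
    \<open>(b, c')\<close>. The remaining arms are extreme neighbours, which lie in other blocks, so
    all comparisons follow from those of blocks.\<close>
  have fill: "(b, c') \<in> E" if asm: "(b0, c0) \<in> Q" "b \<in> A (f b0) (f c0)" "b \<le> b0" "c' \<in> B (f b0) (f c0)" "c0 \<le> c'"
    for b0 c0 b c'
  proof -
    obtain d where d: "(b, d) \<in> Q" "f b = f b0" "f d = f c0" using asm(2) by (auto simp: A_def)
    obtain h where h: "(h, c') \<in> Q" "f h = f b0" "f c' = f c0" using asm(4) by (auto simp: B_def)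
    have E: "(b, d) \<in> E" "(h, c') \<in> E" "(b0, c0) \<in> E" using d h asm QE by auto
    have fb: "(b, first_nbr E b) \<in> E" "(b, last_nbr E b) \<in> E" using ex[OF E(1)] by auto
    have hc: "(far_nbr E c', c') \<in> E" "(near_nbr E c', c') \<in> E" using ex[OF E(2)] by auto
    have 1: "(b, c0) \<in> E" 
    proof (rule plus_closedD[OF pc, where ?a1.0="far_nbr E c0" and ?a2.0=b0 and ?c1.0="first_nbr E b" and ?c2.0="last_nbr E b"])
      show "far_nbr E c0 \<le> b" using Qrow[OF asm(1)] d lt by (metis less_imp_le)
      show "b0 < first_nbr E b" using cross[OF fb(1)] d lt by metis
      show "first_nbr E b \<le> c0" "c0 \<le> last_nbr E b" using Qrow[OF d(1)] d lt by (metis less_imp_le)+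
      show "(far_nbr E c0, c0) \<in> E" using ex[OF E(3)] by auto
    qed (use asm fb E in auto)
    show ?thesis
    proof (rule plus_closedD[OF pc, where ?a1.0="far_nbr E c'" and ?a2.0="near_nbr E c'" and ?c1.0=c0 and ?c2.0="last_nbr E b"])
      show "far_nbr E c' \<le> b" "b \<le> near_nbr E c'" using Qrow[OF h(1)] d h lt by (metis less_imp_le)+
      show "near_nbr E c' < c0" using cross[OF hc(2)] h lt by metis
      show "c' \<le> last_nbr E b" using Qrow[OF d(1)] d h lt by (metis less_imp_le)
    qed (use asm 1 fb hc in auto)
  qed
  have "\<exists>T. T \<subseteq> A I J \<and> card T \<le> t \<and> (\<forall>x\<in>A I J - T. card T = t \<and> (\<forall>w\<in>T. w < x))" for I J
    using first_elements[OF fA, where t=t] by metis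
  then obtain S where S: "\<And>I J. S I J \<subseteq> A I J" "\<And>I J. card (S I J) \<le> t"
      "\<And>I J x. x \<in> A I J - S I J \<Longrightarrow> card (S I J) = t \<and> (\<forall>w\<in>S I J. w < x)" by metis
  have "\<exists>T. T \<subseteq> B I J \<and> card T \<le> t \<and> (\<forall>x\<in>B I J - T. card T = t \<and> (\<forall>w\<in>T. x < w))" for I J
    using last_elements[OF fB, where t=t] by metis
  then obtain U where U: "\<And>I J. U I J \<subseteq> B I J" "\<And>I J. card (U I J) \<le> t"
      "\<And>I J x. x \<in> B I J - U I J \<Longrightarrow> card (U I J) = t \<and> (\<forall>w\<in>U I J. x < w)" by metis
  define Q1 where "Q1 = {(b, c). (b, c) \<in> Q \<and> b \<in> S (f b) (f c)}"
  define Q2 where "Q2 = {(b, c). (b, c) \<in> Q \<and> c \<in> U (f b) (f c)}"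
  \<comment> \<open>An edge in neither part would have the \<open>t\<close> least rows before its
    row and the \<open>t\<close> greatest columns after its column, and \<open>fill\<close> would
    join all of them.\<close>
  have "Q \<subseteq> Q1 \<union> Q2"
  proof clarify
    fix b c assume q: "(b, c) \<in> Q" "(b, c) \<notin> Q2"
    show "(b, c) \<in> Q1"
    proof (rule ccontr)
      assume "(b, c) \<notin> Q1"
      then have b: "b \<in> A (f b) (f c) - S (f b) (f c)" using q by (auto simp: Q1_def A_def)
      have c: "c \<in> B (f b) (f c) - U (f b) (f c)" using q by (auto simp: Q2_def B_def)
      have "S (f b) (f c) \<times> U (f b) (f c) \<subseteq> E"
      proof clarify
        fix x y assume "x \<in> S (f b) (f c)" "y \<in> U (f b) (f c)"
        then show "(x, y) \<in> E" using fill[OF q(1), of x y] S(1) U(1) S(3)[OF b] U(3)[OF c] by (meson less_imp_le subsetD)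
      qed
      then show False using bf S(3)[OF b] U(3)[OF c] unfolding biclique_free_def by blast
    qed
  qed
  define PP where "PP = block_pairs f E"
  have fPP: "finite PP" using fE by (auto simp: PP_def block_pairs_def)
  have SA: "S I J = {}" if "(I, J) \<notin> PP" for I J
    using S(1)[of I J] that QE by (force simp: A_def PP_def block_pairs_def)
  have UB: "U I J = {}" if "(I, J) \<notin> PP" for I J
    using U(1)[of I J] that QE by (force simp: B_def PP_def block_pairs_def)
  have fS: "finite (S I J)" for I J by (rule finite_subset[OF S(1) fA])
  have fU: "finite (U I J)" for I J by (rule finite_subset[OF U(1) fB])
  have q1: "card Q1 \<le> ?K * (t * card PP + card cols)"
  proof -
    \<comment> \<open>Column block \<open>J\<close> needs \<open>t\<close> rows from each adjacent
      row block, hence \<open>t * card PP\<close> rows over all \<open>J\<close>.\<close>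
    define R where "R J = (\<Union>I\<in>{I. (I, J) \<in> PP}. S I J)" for J
    have fI: "finite {I. (I, J) \<in> PP}" for J by (rule finite_subset[of _ "fst ` PP"]) (use fPP in force)+
    have cR: "card (R J) \<le> t * card {I. (I, J) \<in> PP}" for J
    proof -
      have "card (R J) \<le> (\<Sum>I\<in>{I. (I, J) \<in> PP}. card (S I J))" unfolding R_def by (rule card_UN_le[OF fI])
      also have "\<dots> \<le> (\<Sum>I\<in>{I. (I, J) \<in> PP}. t)" by (intro sum_mono S(2))
      finally show ?thesis by (simp add: mult.commute)
    qed
    have "card Q1 \<le> ?K * ((\<Sum>J\<in>f ` snd ` E. card (R J)) + card (snd ` E))"
    proof (rule column_block_bound[OF fE pc bf t f cross])
      show "Q1 \<subseteq> E" using QE by (auto simp: Q1_def)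
      show "b \<in> R (f c)" if "(b, c) \<in> Q1" for b c
        using that SA[of "f b" "f c"] by (auto simp: Q1_def R_def)
      show "finite (R J)" for J using fI fS by (auto simp: R_def)
    qed
    also have "(\<Sum>J\<in>f ` snd ` E. card (R J)) \<le> t * card PP"
    proof -
      have "(\<Sum>J\<in>f ` snd ` E. card (R J)) \<le> (\<Sum>J\<in>f ` snd ` E. t * card {I. (I, J) \<in> PP})"
        by (intro sum_mono cR)
      also have "\<dots> = t * (\<Sum>J\<in>f ` snd ` E. card {I. (I, J) \<in> PP})" by (simp add: sum_distrib_left)
      also have "(\<Sum>J\<in>f ` snd ` E. card {I. (I, J) \<in> PP}) = (\<Sum>J\<in>f ` snd ` E. card {p\<in>PP. snd p = J})"
      proof (rule sum.cong[OF refl])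
        fix J
        have "{p\<in>PP. snd p = J} = (\<lambda>I. (I, J)) ` {I. (I, J) \<in> PP}" by auto
        then show "card {I. (I, J) \<in> PP} = card {p\<in>PP. snd p = J}" by (simp add: card_image inj_on_def)
      qed
      also have "\<dots> \<le> card PP" by (rule sum_card_fibres_le[OF fPP]) (simp add: fE)
      finally show ?thesis by simp
    qed
    finally show ?thesis by (simp add: cols_def)
  qed
  have q2: "card Q2 \<le> ?K * (t * card PP + card rows)"
  proof -
    define R where "R I = (\<Union>J\<in>{J. (I, J) \<in> PP}. U I J)" for I
    have fI: "finite {J. (I, J) \<in> PP}" for I by (rule finite_subset[of _ "snd ` PP"]) (use fPP in force)+
    have cR: "card (R I) \<le> t * card {J. (I, J) \<in> PP}" for I
    proof -
      have "card (R I) \<le> (\<Sum>J\<in>{J. (I, J) \<in> PP}. card (U I J))" unfolding R_def by (rule card_UN_le[OF fI])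
      also have "\<dots> \<le> (\<Sum>J\<in>{J. (I, J) \<in> PP}. t)" by (intro sum_mono U(2))
      finally show ?thesis by (simp add: mult.commute)
    qed
    have "card Q2 \<le> ?K * ((\<Sum>J\<in>f ` fst ` E. card (R J)) + card (fst ` E))"
    proof (rule row_block_bound[OF fE pc bf t f cross])
      show "Q2 \<subseteq> E" using QE by (auto simp: Q2_def)
      show "c \<in> R (f b)" if "(b, c) \<in> Q2" for b c
        using that UB[of "f b" "f c"] by (auto simp: Q2_def R_def)
      show "finite (R J)" for J using fI fU by (auto simp: R_def)
    qed
    also have "(\<Sum>J\<in>f ` fst ` E. card (R J)) \<le> t * card PP"
    proof -
      have "(\<Sum>J\<in>f ` fst ` E. card (R J)) \<le> (\<Sum>I\<in>f ` fst ` E. t * card {J. (I, J) \<in> PP})"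
        by (intro sum_mono cR)
      also have "\<dots> = t * (\<Sum>I\<in>f ` fst ` E. card {J. (I, J) \<in> PP})" by (simp add: sum_distrib_left)
      also have "(\<Sum>I\<in>f ` fst ` E. card {J. (I, J) \<in> PP}) = (\<Sum>I\<in>f ` fst ` E. card {p\<in>PP. fst p = I})"
      proof (rule sum.cong[OF refl])
        fix I
        have "{p\<in>PP. fst p = I} = (\<lambda>J. (I, J)) ` {J. (I, J) \<in> PP}" by auto
        then show "card {J. (I, J) \<in> PP} = card {p\<in>PP. fst p = I}" by (simp add: card_image inj_on_def)
      qed
      also have "\<dots> \<le> card PP" by (rule sum_card_fibres_le[OF fPP]) (simp add: fE)
      finally show ?thesis by simp
    qed
    finally show ?thesis by (simp add: rows_def)
  qed
  have "E \<subseteq> E1 \<union> (E2 \<union> (E3 \<union> (E4 \<union> (Q1 \<union> Q2))))" using \<open>Q \<subseteq> Q1 \<union> Q2\<close> by (auto simp: Q_def)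
  moreover have fin: "finite E1" "finite E2" "finite E3" "finite E4" "finite Q1" "finite Q2"
    by (rule finite_subset[OF _ fE], use QE in \<open>auto simp: E1_def E2_def E3_def E4_def Q1_def Q2_def\<close>)+
  ultimately have "card E \<le> card (E1 \<union> (E2 \<union> (E3 \<union> (E4 \<union> (Q1 \<union> Q2)))))" by (intro card_mono) auto
  also have "\<dots> \<le> card E1 + (card E2 + (card E3 + (card E4 + (card Q1 + card Q2))))"
    by (intro order.trans[OF card_Un_le] add_mono order.refl)
  also have "\<dots> \<le> 4 * (?K * (card rows + card cols)) + ?K * (t * card PP + card cols) + ?K * (t * card PP + card rows)"
    using c1 c2 c3 c4 q1 q2 by linarith
  also have "\<dots> = 15 * t * t * (card rows + card cols) + 6 * t * t * t * card PP" by (simp add: algebra_simps)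
  also have "\<dots> \<le> 18 * t ^ 3 * (card rows + card cols) + 18 * t ^ 3 * card PP"
  proof (intro add_mono mult_le_mono1)
    have "t * t * 1 \<le> t * t * t" using t by (intro mult_le_mono2) simp
    then show "15 * t * t \<le> 18 * t ^ 3" by (simp add: power3_eq_cube)
    show "6 * t * t * t \<le> 18 * t ^ 3" by (simp add: power3_eq_cube)
  qed
  finally show ?thesis by (simp add: algebra_simps order_of_graph_def PP_def rows_def cols_def)
qed

section \<open>The Ackermann recursion\<close>

lemma ack_gt: "m < ack k m"
proof (induction k m rule: ack.induct)
  case (3 k m) then show ?case by (metis Suc_leI ack.simps(3) order.strict_trans1)
qed auto

lemma ack_less_Suc: "ack k m < ack k (Suc m)"
  by (cases k) (auto simp: ack_gt)

lemma ack_mono: "m \<le> m' \<Longrightarrow> ack k m \<le> ack k m'"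
  by (rule lift_Suc_mono_le[of "ack k"]) (auto simp: less_imp_le[OF ack_less_Suc])

lemma card_image_pair_le:
  assumes "finite X" "\<And>p. p \<in> X \<Longrightarrow> h p \<in> Y" "inj_on h X" "finite Y"
  shows "card X \<le> card Y"
  using assms card_inj_on_le by (metis image_subsetI)

text \<open>The blocks are grouped into a tree whose nodes of level \<^term>\<open>l\<close> contain \<^term>\<open>B l\<close> of them, and
  every edge is counted at the level where its ends separate.  A row whose first or last edge belongs to
  level \<^term>\<open>l\<close> pays for itself; among the other rows of a block that are active at this level, all but
  \<^term>\<open>t\<close> are redundant by plus-closedness.  So each level costs a constant per block, and there are only
  \<^term>\<open>x + 1\<close> levels.\<close>

lemma block_pairs_step:
  assumes t: "t > 0" and D: "D \<ge> 1"
    and IH: "\<And>E f N x. finite E \<Longrightarrow> plus_closed E \<Longrightarrow> biclique_free t E \<Longrightarrow> mono f \<Longrightarrow>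
        (\<And>a c. (a, c) \<in> E \<Longrightarrow> f a < f c \<and> f c < N) \<Longrightarrow> 1 \<le> x \<Longrightarrow> N \<le> ack k x \<Longrightarrow>
        card (block_pairs f E) \<le> D * (order_of_graph E + N * x)"
    and fE: "finite E" and pc: "plus_closed E" and bf: "biclique_free t E" and f: "mono f"
    and cross: "\<And>a c. (a, c) \<in> E \<Longrightarrow> f a < f c \<and> f c < N" and x: "1 \<le> x" and N: "N \<le> ack (Suc k) x"
  shows "card (block_pairs f E) \<le> 288 * t ^ 4 * D * (order_of_graph E + N * x)"
proof -
  define rows where "rows = fst ` E"
  define cols where "cols = snd ` E"
  have fr: "finite rows" and fc: "finite cols" using fE by (auto simp: rows_def cols_def)
  have mem: "b \<in> rows" "c \<in> cols" if "(b, c) \<in> E" for b c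
    using that by (force simp: rows_def cols_def)+
  note ex = extreme_nbrs[OF fE]
  have exr: "(b, first_nbr E b) \<in> E" "(b, last_nbr E b) \<in> E" if "b \<in> rows" for b
    using that ex by (auto simp: rows_def)
  have exc: "(near_nbr E c, c) \<in> E" "(far_nbr E c, c) \<in> E" if "c \<in> cols" for c
    using that ex by (auto simp: cols_def)

  \<comment> \<open>The hierarchy of blocks and the level of an edge\<close>
  define B where "B = rec_nat 1 (\<lambda>_ b. b * ack k b)"
  \<comment> \<open>A node of level \<open>Suc l\<close> has \<open>ack k (B l)\<close> children,
    the largest number for which the bound for \<open>k\<close> may be used with \<open>B l\<close>
    in the role of \<open>x\<close>.\<close>
  have B0: "B 0 = 1" and BS: "B (Suc l) = B l * ack k (B l)" for l by (simp_all add: B_def)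
  have Bpos: "B l \<ge> 1" for l
  proof (induction l)
    case (Suc l)
    have "1 \<le> ack k (B l)" using ack_gt[of "B l" k] by simp
    then show ?case using Suc BS by (metis mult_le_mono nat_mult_1)
  qed (simp add: B0)
  \<comment> \<open>With \<open>l = x\<close> this puts all \<open>N\<close> blocks into one node of
    level \<open>Suc x\<close>.\<close>
  have Back: "ack (Suc k) l \<le> B (Suc l)" for l
  proof (induction l)
    case 0 show ?case by (simp add: BS B0)
  next
    case (Suc l)
    have "ack (Suc k) (Suc l) \<le> ack k (B (Suc l))" using ack_mono[OF Suc] by simp
    also have "\<dots> \<le> B (Suc l) * ack k (B (Suc l))" using Bpos[of "Suc l"] by simp
    finally show ?case by (simp add: BS)
  qed
  define g where "g l y = f y div B l" for l y
  have g0: "g 0 y = f y" for y by (simp add: g_def B0)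
  have gS: "g (Suc l) y = g l y div ack k (B l)" for l y by (simp add: g_def BS div_mult2_eq)
  have gmono: "mono (g l)" for l using f by (auto simp: mono_def g_def intro: div_le_mono)
  have glt: "y < z" if "g l y < g l z" for l y z using that gmono by (metis leD leI monoD)
  have flt: "y < z" if "f y < f z" for y z using that f by (metis leD leI monoD)
  have gref: "g l' y = g l' z" if "g l y = g l z" "l \<le> l'" for l l' y z
    using that(2,1) by (induction l' rule: dec_induct) (auto simp: gS)
  have gtop: "g (Suc x) y = 0" if "f y < N" for y
    using that N Back[of x] by (simp add: g_def)
  \<comment> \<open>Separated at level \<open>lev b c\<close>, together at the next. Nodes of level
    0 are single blocks, so every edge is separated there.\<close>
  define lev where "lev b c = (LEAST l. g (Suc l) b = g (Suc l) c)" for b c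
  have lev_ex: "g (Suc x) b = g (Suc x) c" if "(b, c) \<in> E" for b c
    using cross[OF that] gtop by simp
  have lev_le: "lev b c \<le> x" if "(b, c) \<in> E" for b c
    unfolding lev_def by (rule Least_le) (fact lev_ex[OF that])
  have lev_eq: "g (Suc (lev b c)) b = g (Suc (lev b c)) c" if "(b, c) \<in> E" for b c
    unfolding lev_def by (rule LeastI[of _ x]) (fact lev_ex[OF that])
  have lev_neq: "g l b < g l c" if "(b, c) \<in> E" "l \<le> lev b c" for b c l
  proof -
    have "g l b \<noteq> g l c"
    proof (cases l)
      case 0 then show ?thesis using cross[OF that(1)] g0 by simp
    next
      case (Suc m) then show ?thesis using that not_less_Least[of m "\<lambda>l. g (Suc l) b = g (Suc l) c"] unfolding lev_def by auto
    qed
    moreover have "g l b \<le> g l c" using gmono flt cross[OF that(1)] by (metis less_imp_le monoD)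
    ultimately show ?thesis by simp
  qed
  have lev_mono_c: "lev b c \<le> lev b c'" if "(b, c) \<in> E" "(b, c') \<in> E" "c \<le> c'" for b c c'
  proof -
    have bc: "b < c" using cross[OF that(1)] flt by blast
    let ?l = "Suc (lev b c')"
    have "g ?l b \<le> g ?l c" "g ?l c \<le> g ?l c'" using bc that(3) gmono by (auto intro: monoD)
    then have "g ?l b = g ?l c" using lev_eq[OF that(2)] by simp
    then show ?thesis unfolding lev_def[of b c] by (rule Least_le)
  qed
  have lev_mono_b: "lev b c \<le> lev b' c" if "(b, c) \<in> E" "(b', c) \<in> E" "b' \<le> b" for b b' c
  proof -
    have bc: "b < c" using cross[OF that(1)] flt by blast
    let ?l = "Suc (lev b' c)"
    have "g ?l b' \<le> g ?l b" "g ?l b \<le> g ?l c" using bc that(3) gmono by (auto intro: monoD)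
    then have "g ?l b = g ?l c" using lev_eq[OF that(2)] by simp
    then show ?thesis unfolding lev_def[of b c] by (rule Least_le)
  qed
  have lev_below: "g l b = g l c" if "(b, c) \<in> E" "lev b c < l" for b c l
    using gref[OF lev_eq[OF that(1)]] that(2) by simp

  \<comment> \<open>Rows and columns that are not extreme at a level\<close>
  define MR where "MR l I = {b\<in>rows. f b = I \<and> lev b (first_nbr E b) < l \<and> l < lev b (last_nbr E b)}" for l I
  define MC where "MC l J = {c\<in>cols. f c = J \<and> lev (near_nbr E c) c < l \<and> l < lev (far_nbr E c) c}" for l J
  have fMR: "finite (MR l I)" "finite (MC l I)" for l I using fr fc by (auto simp: MR_def MC_def)
  \<comment> \<open>Only the first \<open>t\<close> of these rows enter the graph of the level; a
    later row has \<open>t\<close> of them before it, which makes its representatives few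
    (\<open>cZr\<close>).\<close>
  have "\<exists>T. T \<subseteq> MR l I \<and> card T \<le> t \<and> (\<forall>x\<in>MR l I - T. card T = t \<and> (\<forall>w\<in>T. w < x))" for l I
    using first_elements[OF fMR(1), where t=t] by metis
  then obtain T where T: "\<And>l I. T l I \<subseteq> MR l I" "\<And>l I. card (T l I) \<le> t"
      "\<And>l I x. x \<in> MR l I - T l I \<Longrightarrow> card (T l I) = t \<and> (\<forall>w\<in>T l I. w < x)" by metis
  have "\<exists>T. T \<subseteq> MC l I \<and> card T \<le> t \<and> (\<forall>x\<in>MC l I - T. card T = t \<and> (\<forall>w\<in>T. x < w))" for l I
    using last_elements[OF fMR(2), where t=t] by metis
  then obtain U where U: "\<And>l I. U l I \<subseteq> MC l I" "\<And>l I. card (U l I) \<le> t"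
      "\<And>l I x. x \<in> MC l I - U l I \<Longrightarrow> card (U l I) = t \<and> (\<forall>w\<in>U l I. x < w)" by metis
  have fT: "finite (T l I)" "finite (U l I)" for l I
    using finite_subset[OF T(1) fMR(1)] finite_subset[OF U(1) fMR(2)] by auto

  \<comment> \<open>One representative edge for each pair of blocks\<close>
  define F where "F = (\<lambda>(a, c). (f a, f c))"
  obtain Z where Z: "Z \<subseteq> E" "inj_on F Z" "F ` E = F ` Z" using subset_image_inj[of "F ` E" F E] by auto
  have fZ: "finite Z" using Z fE finite_subset by blast
  have cZ: "card (block_pairs f E) = card Z"
    using Z by (simp add: block_pairs_def F_def[symmetric] card_image)
  have injZ: "p = q" if "p \<in> Z" "q \<in> Z" "f (fst p) = f (fst q)" "f (snd p) = f (snd q)" for p q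
    using inj_onD[OF Z(2), of p q] that by (simp add: F_def case_prod_beta)
  \<comment> \<open>Discarding one representative per row and one per column makes the comparisons
    strict: the last neighbour of the row then lies in a later block than the column, the far
    neighbour of the column in an earlier block than the row. Hence they also lie beyond all other
    members of these blocks.\<close>
  define Za where "Za = {p\<in>Z. f (snd p) = f (last_nbr E (fst p))}"
  define Zb where "Zb = {p\<in>Z. f (fst p) = f (far_nbr E (snd p))}"
  define Zr where "Zr l I = {p\<in>Z - Za - Zb. lev (fst p) (snd p) = l \<and> f (fst p) = I \<and> fst p \<in> MR l I - T l I}" for l I
  define Zc where "Zc l J = {p\<in>Z - Za - Zb. lev (fst p) (snd p) = l \<and> f (snd p) = J \<and> snd p \<in> MC l J - U l J}" for l J
  define R where "R l = {b\<in>rows. lev b (first_nbr E b) = l} \<union> {b\<in>rows. lev b (last_nbr E b) = l} \<union> (\<Union>I<N. T l I)" for l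
  define C where "C l = {c\<in>cols. lev (near_nbr E c) c = l} \<union> {c\<in>cols. lev (far_nbr E c) c = l} \<union> (\<Union>I<N. U l I)" for l
  define G where "G l = {(b, c). (b, c) \<in> E \<and> b \<in> R l \<and> c \<in> C l \<and> lev b c = l}" for l
  have GE: "G l \<subseteq> E" for l by (auto simp: G_def)
  have fG: "finite (G l)" for l using GE fE finite_subset by blast
  have Zsub: "Z \<subseteq> Za \<union> (Zb \<union> (\<Union>l\<le>x. (\<Union>I<N. Zr l I) \<union> ((\<Union>J<N. Zc l J) \<union> G l)))"
  proof
    fix p assume p: "p \<in> Z"
    obtain b c where bc: "p = (b, c)" by (cases p)
    have E: "(b, c) \<in> E" using p bc Z by auto
    have fN: "f b < N" "f c < N" using cross[OF E] by auto
    define l where "l = lev b c"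
    have lx: "l \<le> x" using lev_le[OF E] l_def by simp
    have o: "lev b (first_nbr E b) \<le> l" "l \<le> lev b (last_nbr E b)" "lev (near_nbr E c) c \<le> l" "l \<le> lev (far_nbr E c) c"
      unfolding l_def using ex[OF E] E by (auto intro: lev_mono_c lev_mono_b)
    have br: "b \<in> R l \<or> b \<in> MR l (f b) - T l (f b)"
      using o mem[OF E] fN by (auto simp: R_def MR_def)
    have cr: "c \<in> C l \<or> c \<in> MC l (f c) - U l (f c)"
      using o mem[OF E] fN by (auto simp: C_def MC_def)
    show "p \<in> Za \<union> (Zb \<union> (\<Union>l\<le>x. (\<Union>I<N. Zr l I) \<union> ((\<Union>J<N. Zc l J) \<union> G l)))"
    proof (cases "p \<in> Za \<union> Zb")
      case False
      have "p \<in> (\<Union>I<N. Zr l I) \<union> ((\<Union>J<N. Zc l J) \<union> G l)"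
      proof (cases "b \<in> R l \<and> c \<in> C l")
        case True then show ?thesis using E bc by (auto simp: G_def l_def)
      next
        case F: False
        show ?thesis
        proof (cases "b \<in> R l")
          case True
          then have "p \<in> Zc l (f c)" using cr F False p bc by (auto simp: Zc_def l_def)
          then show ?thesis using fN by blast
        next
          case F: False
          then have "p \<in> Zr l (f b)" using br False p bc by (auto simp: Zr_def l_def)
          then show ?thesis using fN by blast
        qed
      qed
      then show ?thesis using lx by blast
    qed auto
  qed
  have cZa: "card Za \<le> card rows"
  proof (rule card_image_pair_le[of _ fst])
    show "inj_on fst Za" by (rule inj_onI, rule injZ) (simp_all add: Za_def)
    show "fst p \<in> rows" if "p \<in> Za" for p using that Z mem[of "fst p" "snd p"] by (auto simp: Za_def)
  qed (use fZ fr in \<open>auto simp: Za_def\<close>)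
  have cZb: "card Zb \<le> card cols"
  proof (rule card_image_pair_le[of _ snd])
    show "inj_on snd Zb" by (rule inj_onI, rule injZ) (simp_all add: Zb_def)
    show "snd p \<in> cols" if "p \<in> Zb" for p using that Z mem[of "fst p" "snd p"] by (auto simp: Zb_def)
  qed (use fZ fc in \<open>auto simp: Zb_def\<close>)
  \<comment> \<open>All \<open>t\<close> rows of \<open>T l I\<close> are joined to every column
    occurring in \<open>Zr l I\<close>. Distinct representatives have distinct columns here, because
    their rows share the block \<open>I\<close>.\<close>
  have cZr: "card (Zr l I) \<le> t" for l I
  proof (cases "Zr l I = {}")
    case False
    have fin: "finite (Zr l I)" using fZ by (auto simp: Zr_def)
    have inj: "inj_on snd (Zr l I)" by (rule inj_onI, rule injZ) (simp_all add: Zr_def)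
    obtain p0 where p0: "p0 \<in> Zr l I" using False by blast
    have cT: "card (T l I) = t" using T(3)[of "fst p0" l I] p0 by (auto simp: Zr_def)
    have "T l I \<times> snd ` Zr l I \<subseteq> E"
    proof clarify
      fix b0 b c assume b0: "b0 \<in> T l I" and p: "(b, c) \<in> Zr l I"
      have E: "(b, c) \<in> E" using p Z by (auto simp: Zr_def)
      have p': "f c \<noteq> f (last_nbr E b)" "f b \<noteq> f (far_nbr E c)" "lev b c = l" "f b = I" "b \<in> MR l I - T l I"
        using p by (auto simp: Zr_def Za_def Zb_def)
      have b0M: "b0 \<in> rows" "f b0 = I" "lev b0 (first_nbr E b0) < l" "l < lev b0 (last_nbr E b0)"
        using T(1) b0 by (auto simp: MR_def)
      note e0 = exr[OF b0M(1)]
      show "(b0, snd (b, c)) \<in> E" unfolding snd_conv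
      proof (rule plus_closedD[OF pc, where ?a1.0="far_nbr E c" and ?a2.0=b and ?c1.0="first_nbr E b0" and ?c2.0="last_nbr E b0"])
        have "f (far_nbr E c) \<le> f b" using ex[OF E] f by (auto intro: monoD)
        then have "f (far_nbr E c) < f b0" using p' b0M by simp
        then show "far_nbr E c \<le> b0" using flt by (simp add: less_imp_le)
        show "b0 \<le> b" using T(3)[OF p'(5)] b0 by (auto simp: less_imp_le)
        have "f b < f (first_nbr E b0)" using cross[OF e0(1)] b0M p' by simp
        then show "b < first_nbr E b0" using flt by simp
        \<comment> \<open>The first neighbour of \<open>b0\<close> is still in the node of
          \<open>b0\<close> at level \<open>l\<close>, where \<open>c\<close> is already in a later
          one; at level \<open>Suc l\<close> the column \<open>c\<close> has joined that node and
          the last neighbour of \<open>b0\<close> has not. So \<open>c\<close> lies between the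
          two.\<close>
        have gb: "g l b0 = g l b" using gref[of 0 b0 b l] g0 b0M p' by simp
        have "g l (first_nbr E b0) = g l b" using lev_below[OF e0(1) b0M(3)] gb by simp
        also have "\<dots> < g l c" using lev_neq[OF E] p' by simp
        finally show "first_nbr E b0 \<le> c" using glt less_imp_le by blast
        have "g (Suc l) c = g (Suc l) b0" using lev_eq[OF E] p' gref[OF gb, of "Suc l"] by simp
        also have "\<dots> < g (Suc l) (last_nbr E b0)" using lev_neq[OF e0(2)] b0M by simp
        finally show "c \<le> last_nbr E b0" using glt less_imp_le by blast
      qed (use ex[OF E] e0 E in auto)
    qed
    then have "card (snd ` Zr l I) < t" by (rule biclique_free_card[OF bf]) (use cT fin in auto)
    then show ?thesis using card_image[OF inj] by simp
  qed simp
  \<comment> \<open>The mirror image; the strict comparison now comes from excluding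
    \<open>Za\<close> instead of \<open>Zb\<close>.\<close>
  have cZc: "card (Zc l J) \<le> t" for l J
  proof (cases "Zc l J = {}")
    case False
    have fin: "finite (Zc l J)" using fZ by (auto simp: Zc_def)
    have inj: "inj_on fst (Zc l J)" by (rule inj_onI, rule injZ) (simp_all add: Zc_def)
    obtain p0 where p0: "p0 \<in> Zc l J" using False by blast
    have cU: "card (U l J) = t" using U(3)[of "snd p0" l J] p0 by (auto simp: Zc_def)
    have "fst ` Zc l J \<times> U l J \<subseteq> E"
    proof clarify
      fix b c c0 assume c0: "c0 \<in> U l J" and p: "(b, c) \<in> Zc l J"
      have E: "(b, c) \<in> E" using p Z by (auto simp: Zc_def)
      have p': "f c \<noteq> f (last_nbr E b)" "f b \<noteq> f (far_nbr E c)" "lev b c = l" "f c = J" "c \<in> MC l J - U l J"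
        using p by (auto simp: Zc_def Za_def Zb_def)
      have c0M: "c0 \<in> cols" "f c0 = J" "lev (near_nbr E c0) c0 < l" "l < lev (far_nbr E c0) c0"
        using U(1) c0 by (auto simp: MC_def)
      note e0 = exc[OF c0M(1)]
      have gc: "g l c0 = g l c" using gref[of 0 c0 c l] g0 c0M p' by simp
      show "(fst (b, c), c0) \<in> E" unfolding fst_conv
      proof (rule plus_closedD[OF pc, where ?a1.0="far_nbr E c0" and ?a2.0="near_nbr E c0" and ?c1.0=c and ?c2.0="last_nbr E b"])
        have "f c \<le> f (last_nbr E b)" using ex[OF E] f by (auto intro: monoD)
        then have "f c0 < f (last_nbr E b)" using p' c0M by simp
        then show "c0 \<le> last_nbr E b" using flt by (simp add: less_imp_le)
        show "c \<le> c0" using U(3)[OF p'(5)] c0 by (auto simp: less_imp_le)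
        have "f (near_nbr E c0) < f c" using cross[OF e0(1)] c0M p' by simp
        then show "near_nbr E c0 < c" using flt by simp
        have "g l b < g l c" using lev_neq[OF E] p' by simp
        also have "\<dots> = g l (near_nbr E c0)" using lev_below[OF e0(1) c0M(3)] gc by simp
        finally show "b \<le> near_nbr E c0" using glt less_imp_le by blast
        have "g (Suc l) (far_nbr E c0) < g (Suc l) c0" using lev_neq[OF e0(2)] c0M by simp
        also have "\<dots> = g (Suc l) b" using lev_eq[OF E] p' gref[OF gc, of "Suc l"] by simp
        finally show "far_nbr E c0 \<le> b" using glt less_imp_le by blast
      qed (use ex[OF E] e0 E in auto)
    qed
    then have sub: "fst ` Zc l J \<times> U l J \<subseteq> E" .
    have "card (fst ` Zc l J) < t"
    proof (rule ccontr)
      assume "\<not> card (fst ` Zc l J) < t"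
      then have "card (U l J) < t" using biclique_free_card[OF bf sub] fT by simp
      then show False using cU by simp
    qed
    then show ?thesis using card_image[OF inj] by simp
  qed simp

  \<comment> \<open>The graph of a single level\<close>
  have Gpc: "plus_closed (G l)" for l unfolding plus_closed_def
  proof (intro allI impI)
    fix a1 a a2 c1 c c2
    assume *: "a1 \<le> a" "a \<le> a2" "a2 < c1" "c1 \<le> c" "c \<le> c2" "(a, c1) \<in> G l" "(a, c2) \<in> G l" "(a1, c) \<in> G l" "(a2, c) \<in> G l"
    then have E: "(a, c1) \<in> E" "(a, c2) \<in> E" "(a1, c) \<in> E" "(a2, c) \<in> E" using GE by auto
    have ac: "(a, c) \<in> E" using plus_closedD[OF pc *(1-5) E] .
    \<comment> \<open>The level grows along a row, so that of the new edge is squeezed between two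
      copies of \<open>l\<close>; membership in \<open>R l\<close> and \<open>C l\<close> is
      inherited from the given edges.\<close>
    have "lev a c1 = l" "lev a c2 = l" "a \<in> R l" "c \<in> C l" using * by (auto simp: G_def)
    moreover have "lev a c1 \<le> lev a c" "lev a c \<le> lev a c2" using lev_mono_c ac E * by auto
    ultimately show "(a, c) \<in> G l" using ac by (auto simp: G_def)
  qed
  have Gbf: "biclique_free t (G l)" for l using biclique_free_mono[OF bf GE] .
  have Gcross: "g l b < g l c \<and> g (Suc l) b = g (Suc l) c" if "(b, c) \<in> G l" for b c l
    using that lev_neq[of b c l] lev_eq[of b c] by (auto simp: G_def)
  have cPG: "card (block_pairs (g l) (G l)) \<le> D * (order_of_graph (G l) + 2 * N)" for l
  proof (cases "G l = {}")
    case False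
    then obtain b0 c0 where bc0: "(b0, c0) \<in> G l" by auto
    have BN: "B l \<le> N"
    proof -
      have "0 < f c0 div B l" using Gcross[OF bc0] by (simp add: g_def)
      then have "B l \<le> f c0" by (simp add: div_greater_zero_iff)
      then show ?thesis using cross bc0 GE by (metis le_trans less_imp_le subsetD)
    qed
    define A where "A = ack k (B l)"
    \<comment> \<open>The minimum matters when a parent node exceeds the whole range: then only
      \<open>N div B l + 1\<close> children can occur, and \<open>BN\<close> keeps
      \<open>N' * B l\<close> below \<open>2 * N\<close>.\<close>
    define N' where "N' = min A (N div B l + 1)"
    define Gv where "Gv v = G l \<inter> {b. g (Suc l) b = v} \<times> UNIV" for v
    have Apos: "A > 0" using ack_gt[of "B l" k] by (simp add: A_def)
    have gA: "g (Suc l) y = g l y div A" for y by (simp add: gS A_def)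
    have fGv: "finite (Gv v)" for v using fG by (auto simp: Gv_def)
    have cv: "card (block_pairs (g l) (Gv v)) \<le> D * (order_of_graph (Gv v) + N' * B l)" for v
    proof -
      \<comment> \<open>Renumbers the children of node \<open>v\<close> from 0. On
        \<open>Gv v\<close> the truncated subtraction is exact because of
        \<open>rng\<close>.\<close>
      define f' where "f' y = g l y - v * A" for y
      have rng: "v * A \<le> g l b \<and> g l b < g l c \<and> g l c < v * A + A \<and> g l c \<le> N div B l" if "(b, c) \<in> Gv v" for b c
      proof -
        have m: "(b, c) \<in> G l" "g l b div A = v" using that gA by (auto simp: Gv_def)
        have "g l c div A = v" using Gcross[OF m(1)] gA m by simp
        then have "g l c < v * A + A" using Apos by (metis add.commute div_mult_mod_eq mod_less_divisor nat_add_left_cancel_less)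
        moreover have "v * A \<le> g l b" using m(2) by (metis div_times_less_eq_dividend)
        moreover have "g l c \<le> N div B l" using cross[of b c] m(1) GE[of l] unfolding g_def by (intro div_le_mono) (auto simp: less_imp_le)
        ultimately show ?thesis using Gcross[OF m(1)] by simp
      qed
      have "card (block_pairs f' (Gv v)) \<le> D * (order_of_graph (Gv v) + N' * B l)"
      proof (rule IH)
        show "plus_closed (Gv v)" unfolding Gv_def by (rule plus_closed_restrict[OF Gpc])
        show "biclique_free t (Gv v)" by (rule biclique_free_mono[OF Gbf[of l]]) (auto simp: Gv_def)
        show "mono f'" using gmono[of l] by (auto simp: mono_def f'_def intro: diff_le_mono)
        show "f' a < f' c \<and> f' c < N'" if "(a, c) \<in> Gv v" for a c
          using rng[OF that] by (auto simp: f'_def N'_def)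
        show "1 \<le> B l" by (rule Bpos)
        show "N' \<le> ack k (B l)" by (simp add: N'_def A_def)
      qed (rule fGv)
      moreover have "block_pairs (g l) (Gv v) \<subseteq> (\<lambda>(i, j). (i + v * A, j + v * A)) ` block_pairs f' (Gv v)"
      proof
        fix q assume "q \<in> block_pairs (g l) (Gv v)"
        then obtain b c where bc: "(b, c) \<in> Gv v" "q = (g l b, g l c)" by (auto simp: block_pairs_def)
        have "(f' b, f' c) \<in> block_pairs f' (Gv v)" using bc by (force simp: block_pairs_def)
        moreover have "q = (\<lambda>(i, j). (i + v * A, j + v * A)) (f' b, f' c)" using rng[OF bc(1)] bc by (simp add: f'_def)
        ultimately show "q \<in> (\<lambda>(i, j). (i + v * A, j + v * A)) ` block_pairs f' (Gv v)" by blast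
      qed
      then have "card (block_pairs (g l) (Gv v)) \<le> card (block_pairs f' (Gv v))"
        using fGv by (metis block_pairs_def card_image_le card_mono finite_imageI le_trans)
      ultimately show ?thesis by simp
    qed
    define Vs where "Vs = {..N div B (Suc l)}"
    have "block_pairs (g l) (G l) \<subseteq> (\<Union>v\<in>Vs. block_pairs (g l) (Gv v))"
    proof
      fix q assume "q \<in> block_pairs (g l) (G l)"
      then obtain b c where bc: "(b, c) \<in> G l" "q = (g l b, g l c)" by (auto simp: block_pairs_def)
      have "f b \<le> N" using cross bc GE by (metis less_imp_le less_trans subsetD)
      then have "g (Suc l) b \<in> Vs" by (auto simp: Vs_def g_def intro: div_le_mono)
      moreover have "q \<in> block_pairs (g l) (Gv (g (Suc l) b))" using bc by (force simp: block_pairs_def Gv_def)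
      ultimately show "q \<in> (\<Union>v\<in>Vs. block_pairs (g l) (Gv v))" by blast
    qed
    then have "card (block_pairs (g l) (G l)) \<le> card (\<Union>v\<in>Vs. block_pairs (g l) (Gv v))"
      using fGv by (intro card_mono) (auto simp: Vs_def block_pairs_def)
    also have "\<dots> \<le> (\<Sum>v\<in>Vs. card (block_pairs (g l) (Gv v)))" by (rule card_UN_le) (simp add: Vs_def)
    also have "\<dots> \<le> (\<Sum>v\<in>Vs. D * (order_of_graph (Gv v) + N' * B l))" by (intro sum_mono cv)
    also have "\<dots> = D * ((\<Sum>v\<in>Vs. order_of_graph (Gv v)) + card Vs * (N' * B l))"
      by (simp add: sum.distrib flip: sum_distrib_left)
    also have "\<dots> \<le> D * (order_of_graph (G l) + 2 * N)"
    proof (intro mult_le_mono2 add_mono)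
      have "(\<Sum>v\<in>Vs. order_of_graph (Gv v)) \<le> (\<Sum>v\<in>Vs. card {b\<in>fst ` G l. g (Suc l) b = v} + card {c\<in>snd ` G l. g (Suc l) c = v})"
        unfolding order_of_graph_def
      proof (intro sum_mono add_mono card_mono)
        fix v
        show "fst ` Gv v \<subseteq> {b\<in>fst ` G l. g (Suc l) b = v}" by (auto simp: Gv_def)
        show "snd ` Gv v \<subseteq> {c\<in>snd ` G l. g (Suc l) c = v}"
        proof
          fix c assume "c \<in> snd ` Gv v"
          then obtain b where b: "(b, c) \<in> G l" "g (Suc l) b = v" by (auto simp: Gv_def)
          then show "c \<in> {c\<in>snd ` G l. g (Suc l) c = v}" using Gcross[OF b(1)] by force
        qed
      qed (use fG in auto)
      also have "\<dots> \<le> card (fst ` G l) + card (snd ` G l)" unfolding sum.distrib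
        using fG by (intro add_mono sum_card_fibres_le) (auto simp: Vs_def)
      finally show "(\<Sum>v\<in>Vs. order_of_graph (Gv v)) \<le> order_of_graph (G l)" by (simp add: order_of_graph_def)
      have BSA: "B (Suc l) = A * B l" by (simp add: BS A_def)
      show "card Vs * (N' * B l) \<le> 2 * N"
      proof (cases "B (Suc l) \<le> N")
        case True
        have "card Vs * (N' * B l) \<le> (N div B (Suc l) + 1) * B (Suc l)"
          unfolding BSA by (intro mult_le_mono) (auto simp: Vs_def N'_def BSA)
        also have "\<dots> = N div B (Suc l) * B (Suc l) + B (Suc l)" by simp
        also have "\<dots> \<le> N + N" by (intro add_mono div_times_less_eq_dividend True)
        finally show ?thesis by simp
      next
        case False
        then have "card Vs * (N' * B l) = N' * B l" by (simp add: Vs_def)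
        also have "\<dots> \<le> (N div B l + 1) * B l" by (intro mult_le_mono1) (simp add: N'_def)
        also have "\<dots> = N div B l * B l + B l" by simp
        also have "\<dots> \<le> N + N" by (intro add_mono div_times_less_eq_dividend BN)
        finally show ?thesis by simp
      qed
    qed
    finally show ?thesis .
  qed (simp add: block_pairs_def)
  let ?K = "18 * t ^ 3"
  have cG: "card (G l) \<le> ?K * (order_of_graph (G l) + D * (order_of_graph (G l) + 2 * N))" for l
  proof -
    have "card (G l) \<le> ?K * (order_of_graph (G l) + card (block_pairs (g l) (G l)))"
      by (rule crossing_edges_bound[OF fG Gpc Gbf t gmono]) (use Gcross in blast)
    also have "\<dots> \<le> ?K * (order_of_graph (G l) + D * (order_of_graph (G l) + 2 * N))"
      by (intro mult_le_mono2 add_mono cPG order_refl)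
    finally show ?thesis .
  qed

  \<comment> \<open>Summation over the levels\<close>
  have cardT: "card (\<Union>I<N. T l I) \<le> N * t" "card (\<Union>I<N. U l I) \<le> N * t" for l
  proof -
    have "card (\<Union>I<N. T l I) \<le> (\<Sum>I<N. card (T l I))" by (rule card_UN_le) simp
    also have "\<dots> \<le> (\<Sum>I<N. t)" by (intro sum_mono T(2))
    finally show "card (\<Union>I<N. T l I) \<le> N * t" by simp
    have "card (\<Union>I<N. U l I) \<le> (\<Sum>I<N. card (U l I))" by (rule card_UN_le) simp
    also have "\<dots> \<le> (\<Sum>I<N. t)" by (intro sum_mono U(2))
    finally show "card (\<Union>I<N. U l I) \<le> N * t" by simp
  qed
  have ordG: "order_of_graph (G l) \<le> (card {b\<in>rows. lev b (first_nbr E b) = l} + card {b\<in>rows. lev b (last_nbr E b) = l} + N * t)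
     + (card {c\<in>cols. lev (near_nbr E c) c = l} + card {c\<in>cols. lev (far_nbr E c) c = l} + N * t)" for l
  proof -
    have "card (fst ` G l) \<le> card (R l)" by (rule card_mono) (auto simp: G_def R_def fr fT)
    also have "\<dots> \<le> card {b\<in>rows. lev b (first_nbr E b) = l} + card {b\<in>rows. lev b (last_nbr E b) = l} + N * t"
      unfolding R_def by (intro order.trans[OF card_Un_le] add_mono cardT order_refl)
    finally have 1: "card (fst ` G l) \<le> card {b\<in>rows. lev b (first_nbr E b) = l} + card {b\<in>rows. lev b (last_nbr E b) = l} + N * t" .
    have "card (snd ` G l) \<le> card (C l)" by (rule card_mono) (auto simp: G_def C_def fc fT)
    also have "\<dots> \<le> card {c\<in>cols. lev (near_nbr E c) c = l} + card {c\<in>cols. lev (far_nbr E c) c = l} + N * t"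
      unfolding C_def by (intro order.trans[OF card_Un_le] add_mono cardT order_refl)
    finally show ?thesis using 1 unfolding order_of_graph_def by linarith
  qed
  define V where "V = order_of_graph E"
  \<comment> \<open>Each row and each column has two extreme edges, hence is counted at most twice
    over all levels in that role; only the sets \<open>T l I\<close> and \<open>U l I\<close> are
    paid for again at every level.\<close>
  define S where "S = (\<Sum>l\<le>x. order_of_graph (G l))"
  have "S \<le> (\<Sum>l\<le>x. (card {b\<in>rows. lev b (first_nbr E b) = l} + card {b\<in>rows. lev b (last_nbr E b) = l} + N * t)
     + (card {c\<in>cols. lev (near_nbr E c) c = l} + card {c\<in>cols. lev (far_nbr E c) c = l} + N * t))"
    unfolding S_def by (intro sum_mono ordG)
  also have "\<dots> \<le> (card rows + card rows + Suc x * (N * t)) + (card cols + card cols + Suc x * (N * t))"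
    unfolding sum.distrib by (intro add_mono sum_card_fibres_le fr fc) auto
  finally have S: "S \<le> 2 * V + 2 * (Suc x * (N * t))" by (simp add: V_def order_of_graph_def rows_def cols_def)
  have fZs: "finite (Zr l I)" "finite (Zc l I)" "finite Za" "finite Zb" for l I
    using fZ by (auto simp: Zr_def Zc_def Za_def Zb_def)
  have "card Z \<le> card (Za \<union> (Zb \<union> (\<Union>l\<le>x. (\<Union>I<N. Zr l I) \<union> ((\<Union>J<N. Zc l J) \<union> G l))))"
    by (rule card_mono[OF _ Zsub]) (auto simp: fZs fG)
  also have "\<dots> \<le> card rows + (card cols + (\<Sum>l\<le>x. N * t + (N * t + ?K * (order_of_graph (G l) + D * (order_of_graph (G l) + 2 * N)))))"
  proof (intro order.trans[OF card_Un_le] add_mono cZa cZb)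
    show "card (\<Union>l\<le>x. (\<Union>I<N. Zr l I) \<union> ((\<Union>J<N. Zc l J) \<union> G l))
      \<le> (\<Sum>l\<le>x. N * t + (N * t + ?K * (order_of_graph (G l) + D * (order_of_graph (G l) + 2 * N))))"
    proof (rule order.trans[OF card_UN_le], simp, rule sum_mono)
      fix l
      have "card (\<Union>I<N. Zr l I) \<le> (\<Sum>I<N. card (Zr l I))" by (rule card_UN_le) simp
      also have "\<dots> \<le> (\<Sum>I<N. t)" by (intro sum_mono cZr)
      finally have 1: "card (\<Union>I<N. Zr l I) \<le> N * t" by simp
      have "card (\<Union>I<N. Zc l I) \<le> (\<Sum>I<N. card (Zc l I))" by (rule card_UN_le) simp
      also have "\<dots> \<le> (\<Sum>I<N. t)" by (intro sum_mono cZc)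
      finally have 2: "card (\<Union>I<N. Zc l I) \<le> N * t" by simp
      show "card ((\<Union>I<N. Zr l I) \<union> ((\<Union>J<N. Zc l J) \<union> G l))
         \<le> N * t + (N * t + ?K * (order_of_graph (G l) + D * (order_of_graph (G l) + 2 * N)))"
        by (intro order.trans[OF card_Un_le] add_mono 1 2 cG)
    qed
  qed
  also have "\<dots> = V + Suc x * (2 * (N * t)) + ?K * (S + D * (S + Suc x * (2 * N)))"
    by (simp add: sum.distrib S_def V_def order_of_graph_def rows_def cols_def flip: sum_distrib_left)
  also have "\<dots> \<le> 16 * t * ?K * D * (V + N * x)"
  proof -
    define K where "K = 18 * t ^ 3"
    \<comment> \<open>In units of \<open>M\<close>, the terms add up to 5 times \<open>V\<close> and
      16 times \<open>N * x\<close>; the constant 288 is 16 times the 18 of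
      \<open>crossing_edges_bound\<close>.\<close>
    define M where "M = K * D * t"
    have K1: "1 \<le> K" using t by (simp add: K_def)
    have M: "1 \<le> M" "t \<le> M" "K * D \<le> M" "K \<le> M" "K * t \<le> M"
      using K1 D t by (auto simp: M_def Suc_le_eq)
    have Sx: "Suc x * (N * t) \<le> 2 * (N * x * t)"
    proof -
      have "Suc x * (N * t) \<le> (2 * x) * (N * t)" using x by (intro mult_le_mono1) simp
      then show ?thesis by (simp add: algebra_simps)
    qed
    have SxN: "Suc x * N \<le> 2 * (N * x)"
    proof -
      have "Suc x * N \<le> (2 * x) * N" using x by (intro mult_le_mono1) simp
      then show ?thesis by (simp add: algebra_simps)
    qed
    have S': "S \<le> 2 * V + 4 * (N * x * t)" using S Sx by linarith
    have "K * S \<le> K * (2 * V + 4 * (N * x * t))" using S' by simp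
    also have "\<dots> = 2 * (K * V) + 4 * (K * t * (N * x))" by (simp add: algebra_simps)
    also have "\<dots> \<le> 2 * (M * V) + 4 * (M * (N * x))" using M by (intro add_mono mult_le_mono) auto
    finally have a: "K * S \<le> 2 * (M * V) + 4 * (M * (N * x))" .
    have "K * D * S \<le> K * D * (2 * V + 4 * (N * x * t))" using S' by simp
    also have "\<dots> = 2 * (K * D * V) + 4 * (M * (N * x))" by (simp add: algebra_simps M_def)
    also have "\<dots> \<le> 2 * (M * V) + 4 * (M * (N * x))" using M by (intro add_mono mult_le_mono) auto
    finally have b: "K * D * S \<le> 2 * (M * V) + 4 * (M * (N * x))" .
    have "K * D * (Suc x * N) \<le> M * (2 * (N * x))" by (rule mult_le_mono[OF M(3) SxN])
    then have c: "K * D * (Suc x * N) \<le> 2 * (M * (N * x))" by (simp only: mult.left_commute)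
    have "N * x * t \<le> N * x * M" using M by (intro mult_le_mono2) simp
    then have d: "Suc x * (N * t) \<le> 2 * (M * (N * x))" using Sx by (simp only: mult.commute[of M])
    have e: "V \<le> M * V" using M by simp
    have "V + Suc x * (2 * (N * t)) + K * (S + D * (S + Suc x * (2 * N)))
       = V + 2 * (Suc x * (N * t)) + K * S + K * D * S + 2 * (K * D * (Suc x * N))" by (simp add: algebra_simps)
    also have "\<dots> \<le> M * V + 4 * (M * (N * x)) + (2 * (M * V) + 4 * (M * (N * x))) + (2 * (M * V) + 4 * (M * (N * x))) + 4 * (M * (N * x))"
      using a b c d e by linarith
    also have "\<dots> \<le> 16 * (M * V) + 16 * (M * (N * x))" by simp
    also have "\<dots> = 16 * t * K * D * (V + N * x)" by (simp add: algebra_simps M_def)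
    finally show ?thesis unfolding K_def .
  qed
  also have "16 * t * ?K * D = 288 * t ^ 4 * D" by (simp add: power3_eq_cube power4_eq_xxxx)
  finally show ?thesis using cZ by (simp add: V_def)
qed

text \<open>The initial factor 2 stems from \<open>k = 0\<close>: there \<open>N\<close> is at most
  \<open>x + 1\<close>, hence at most \<open>2 * x\<close>, and all pairs are counted.\<close>

lemma block_pairs_bound:
  assumes t: "t > 0" and "finite E" "plus_closed E" "biclique_free t E" "mono f"
    "\<And>a c. (a, c) \<in> E \<Longrightarrow> f a < f c \<and> f c < N" "1 \<le> x" "N \<le> ack k x"
  shows "card (block_pairs f E) \<le> 2 * (288 * t ^ 4) ^ k * (order_of_graph E + N * x)"
  using assms(2-)
proof (induction k arbitrary: E f N x)
  case 0
  have "block_pairs f E \<subseteq> {..<N} \<times> {..<N}" using 0(5) by (force simp: block_pairs_def)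
  then have "card (block_pairs f E) \<le> card ({..<N} \<times> {..<N})" by (intro card_mono) auto
  also have "\<dots> = N * N" by (simp add: card_cartesian_product)
  also have "\<dots> \<le> N * (2 * x)" using 0(6,7) by (intro mult_le_mono2) simp
  finally show ?case by simp
next
  case (Suc k)
  have "card (block_pairs f E) \<le> 288 * t ^ 4 * (2 * (288 * t ^ 4) ^ k) * (order_of_graph E + N * x)"
    by (rule block_pairs_step[OF t _ Suc.IH Suc.prems]) (use t in auto)
  then show ?case by (simp add: algebra_simps)
qed

text \<open>Uses the partition into singletons, for which pairs of blocks are edges. The 2 in
  \<open>x + 2\<close> is the order of the graph, at most \<open>2 * n\<close>.\<close>

lemma plus_closed_edge_bound:
  assumes t: "t > 0" and pc: "plus_closed E" and bf: "biclique_free t E"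
    and E: "\<And>a c. (a, c) \<in> E \<Longrightarrow> a < c \<and> c < n" and x: "1 \<le> x" "n \<le> ack k x"
  shows "card E \<le> 2 * (288 * t ^ 4) ^ k * (n * (x + 2))"
proof -
  have sub: "E \<subseteq> {..<n} \<times> {..<n}" using E by force
  then have fE: "finite E" using finite_subset by blast
  have "card (fst ` E) \<le> card {..<n}" "card (snd ` E) \<le> card {..<n}"
    using sub by (intro card_mono; force)+
  then have o: "order_of_graph E \<le> 2 * n" by (simp add: order_of_graph_def)
  have "card E = card (block_pairs (\<lambda>y. y) E)" by (simp add: block_pairs_def case_prod_beta)
  also have "\<dots> \<le> 2 * (288 * t ^ 4) ^ k * (order_of_graph E + n * x)"
    by (rule block_pairs_bound[OF t fE pc bf _ E x]) (simp add: mono_def)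
  also have "\<dots> \<le> 2 * (288 * t ^ 4) ^ k * (n * (x + 2))"
    using o by (intro mult_le_mono2) (simp add: algebra_simps)
  finally show ?thesis .
qed

section \<open>Winding numbers and segments\<close>

text \<open>The determinant of the two vectors: positive iff \<open>v\<close> points to the left of
  \<open>u\<close>.\<close>

definition cross2 :: "complex \<Rightarrow> complex \<Rightarrow> real" where
  "cross2 u v = Re u * Im v - Im u * Re v"

lemma cross2_simps:
  "cross2 (u + v) w = cross2 u w + cross2 v w" "cross2 u (v + w) = cross2 u v + cross2 u w"
  "cross2 (u - v) w = cross2 u w - cross2 v w" "cross2 u (v - w) = cross2 u v - cross2 u w"
  "cross2 (- u) w = - cross2 u w" "cross2 u (- w) = - cross2 u w"
  "cross2 (r *\<^sub>R u) w = r * cross2 u w" "cross2 u (r *\<^sub>R w) = r * cross2 u w"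
  "cross2 u u = 0" "cross2 0 u = 0" "cross2 u 0 = 0"
  by (auto simp: cross2_def algebra_simps)

lemma cross2_eq_0_imp_parallel:
  assumes "cross2 u v = 0" "u \<noteq> 0"
  obtains r where "v = r *\<^sub>R u"
proof -
  define r where "r = (Re u * Re v + Im u * Im v) / (Re u * Re u + Im u * Im u)"
  have pos: "Re u * Re u + Im u * Im u \<noteq> 0"
    using assms(2) by (metis complex_eq_iff sum_squares_eq_zero_iff zero_complex.sel)
  have c: "Re u * Im v = Im u * Re v" using assms by (simp add: cross2_def)
  have "Re v = r * Re u" "Im v = r * Im u"
  proof -
    have "(Re u * Re v + Im u * Im v) * Re u = Re v * (Re u * Re u + Im u * Im u)"
      using c by algebra
    then have "r * Re u = Re v * (Re u * Re u + Im u * Im u) / (Re u * Re u + Im u * Im u)"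
      by (simp only: r_def times_divide_eq_left)
    then show "Re v = r * Re u" by (metis nonzero_mult_div_cancel_right pos)
    have "(Re u * Re v + Im u * Im v) * Im u = Im v * (Re u * Re u + Im u * Im u)"
      using c by algebra
    then have "r * Im u = Im v * (Re u * Re u + Im u * Im u) / (Re u * Re u + Im u * Im u)"
      by (simp only: r_def times_divide_eq_left)
    then show "Im v = r * Im u" by (metis nonzero_mult_div_cancel_right pos)
  qed
  then have "v = r *\<^sub>R u" by (simp add: complex_eq_iff)
  then show ?thesis by (rule that)
qed

lemma not_collinear_cross2:
  assumes "cross2 (b - a) (c - a) \<noteq> 0"
  shows "\<not> collinear {a, b, c :: complex}"
proof
  assume "collinear {a, b, c}"
  then obtain u where u: "\<forall>x\<in>{a, b, c}. \<forall>y\<in>{a, b, c}. \<exists>r. x - y = r *\<^sub>R u"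
    unfolding collinear_def by blast
  obtain r s where "b - a = r *\<^sub>R u" "c - a = s *\<^sub>R u" using u by (metis insertCI)
  then show False using assms by (simp add: cross2_simps)
qed

lemma open_segment_altE:
  fixes a b x :: complex
  assumes "x \<in> open_segment a b"
  obtains s where "0 < s" "s < 1" "x - a = s *\<^sub>R (b - a)" "b - x = (1 - s) *\<^sub>R (b - a)"
    "x = a + s *\<^sub>R (b - a)"
proof -
  obtain s where s: "0 < s" "s < 1" "x = (1 - s) *\<^sub>R a + s *\<^sub>R b"
    using assms by (auto simp: in_segment)
  show ?thesis by (rule that[OF s(1,2)]) (auto simp: s algebra_simps)
qed

lemma open_segmentI:
  fixes a b x :: complex
  assumes "a \<noteq> b" "x = a + s *\<^sub>R (b - a)" "0 < s" "s < 1"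
  shows "x \<in> open_segment a b"
  using assms by (auto simp: in_segment algebra_simps intro!: exI[of _ s])

text \<open>Two overlapping open intervals on a line coincide if neither contains an end of the
  other. This excludes parallel chords at a crossing and chords running along an edge.\<close>

lemma collinear_open_segments_eq:
  fixes a b c d x :: complex
  assumes x: "x \<in> open_segment a b" "x \<in> open_segment c d" and par: "cross2 (b - a) (d - c) = 0"
    and no: "c \<notin> open_segment a b" "d \<notin> open_segment a b" "a \<notin> open_segment c d" "b \<notin> open_segment c d"
  shows "{a, b} = {c, d}"
proof -
  have ab: "a \<noteq> b" and cd: "c \<noteq> d" using x by auto
  obtain s where s: "0 < s" "s < 1" "x - a = s *\<^sub>R (b - a)" "b - x = (1 - s) *\<^sub>R (b - a)" "x = a + s *\<^sub>R (b - a)"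
    using x(1) by (rule open_segment_altE)
  obtain q where q: "0 < q" "q < 1" "x - c = q *\<^sub>R (d - c)" "d - x = (1 - q) *\<^sub>R (d - c)" "x = c + q *\<^sub>R (d - c)"
    using x(2) by (rule open_segment_altE)
  have "b - a \<noteq> 0" using ab by simp
  then obtain r where r: "d - c = r *\<^sub>R (b - a)" using cross2_eq_0_imp_parallel[OF par] by blast
  have r0: "r \<noteq> 0" using r cd by auto
  have ceq: "c = a + (s - q * r) *\<^sub>R (b - a)" using q(3) s(5) r by (simp add: algebra_simps)
  have deq: "d = a + (s + (1 - q) * r) *\<^sub>R (b - a)" using q(4) s(5) r by (simp add: algebra_simps)
  define u where "u = s - q * r"
  define v where "v = s + (1 - q) * r"
  have vu: "v - u = r" by (simp add: u_def v_def algebra_simps)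
  have cu: "c = a + u *\<^sub>R (b - a)" and dv: "d = a + v *\<^sub>R (b - a)" using ceq deq by (auto simp: u_def v_def)
  have nu: "\<not> (0 < u \<and> u < 1)" "\<not> (0 < v \<and> v < 1)"
    using no(1,2) open_segmentI[OF ab cu] open_segmentI[OF ab dv] by blast+
  have acd: "a = c + (- u / r) *\<^sub>R (d - c)" "b = c + ((1 - u) / r) *\<^sub>R (d - c)"
  proof -
    have "(- u / r) *\<^sub>R (d - c) = (- u) *\<^sub>R (b - a)" "((1 - u) / r) *\<^sub>R (d - c) = (1 - u) *\<^sub>R (b - a)"
      using r r0 by simp_all
    then show "a = c + (- u / r) *\<^sub>R (d - c)" "b = c + ((1 - u) / r) *\<^sub>R (d - c)"
      using cu by (simp_all only:) (simp_all add: algebra_simps)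
  qed
  have na: "\<not> (0 < - u / r \<and> - u / r < 1)" "\<not> (0 < (1 - u) / r \<and> (1 - u) / r < 1)"
    using no(3,4) open_segmentI[OF cd acd(1)] open_segmentI[OF cd acd(2)] by blast+
  show ?thesis
  proof (cases "r > 0")
    case True
    have "u < s" "s < v" using True q by (auto simp: u_def v_def)
    then have "u \<le> 0" "1 \<le> v" using nu s by auto
    have "\<not> (u < 0)"
    proof
      assume "u < 0"
      then have "0 < - u / r" using True by (intro divide_pos_pos) auto
      moreover have "- u / r < 1" using True vu \<open>1 \<le> v\<close> by (simp add: field_simps)
      ultimately show False using na by blast
    qed
    moreover have "\<not> (1 < v)"
    proof
      assume "1 < v"
      then have "(1 - u) / r < 1" using True vu by (simp add: field_simps)
      moreover have "0 < (1 - u) / r" using True \<open>u \<le> 0\<close> by (intro divide_pos_pos) auto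
      ultimately show False using na by blast
    qed
    ultimately have "u = 0" "v = 1" using \<open>u \<le> 0\<close> \<open>1 \<le> v\<close> by auto
    then show ?thesis using cu dv by auto
  next
    case False
    then have rn: "r < 0" using r0 by simp
    have "q * r < 0" "(1 - q) * r < 0" using rn q by (auto simp: mult_pos_neg)
    then have "s < u" "v < s" by (auto simp: u_def v_def)
    then have "1 \<le> u" "v \<le> 0" using nu s by auto
    have "\<not> (v < 0)"
    proof
      assume "v < 0"
      then have "- u / r < 1" using rn vu by (simp add: field_simps)
      moreover have "0 < - u / r" using rn \<open>1 \<le> u\<close> by (intro divide_neg_neg) auto
      ultimately show False using na by blast
    qed
    moreover have "\<not> (1 < u)"
    proof
      assume "1 < u"
      then have "0 < (1 - u) / r" using rn by (intro divide_neg_neg) auto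
      moreover have "(1 - u) / r < 1" using rn vu \<open>v \<le> 0\<close> by (simp add: field_simps)
      ultimately show False using na by blast
    qed
    ultimately have "u = 1" "v = 0" using \<open>1 \<le> u\<close> \<open>v \<le> 0\<close> by auto
    then show ?thesis using cu dv by auto
  qed
qed

text \<open>Cramer's rule: the doubled signed areas of the three triangles at \<open>p\<close> are
  its barycentric coordinates, before normalisation.\<close>

lemma barycentric_cross2:
  "cross2 (c - a) (y - a) *\<^sub>R p = cross2 (c - p) (y - p) *\<^sub>R a + cross2 (y - p) (a - p) *\<^sub>R c + cross2 (a - p) (c - p) *\<^sub>R y"
  "cross2 (c - a) (y - a) = cross2 (c - p) (y - p) + cross2 (y - p) (a - p) + cross2 (a - p) (c - p)"
  by (auto simp: cross2_def complex_eq_iff algebra_simps)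

lemma in_triangle_cross2:
  fixes a c y p :: complex
  defines "\<Delta> \<equiv> cross2 (c - a) (y - a)"
  assumes "\<Delta> \<noteq> 0" "cross2 (c - p) (y - p) / \<Delta> \<ge> 0" "cross2 (y - p) (a - p) / \<Delta> \<ge> 0" "cross2 (a - p) (c - p) / \<Delta> \<ge> 0"
  shows "p \<in> convex hull {a, c, y}"
proof -
  have "p = (1 / \<Delta>) *\<^sub>R (\<Delta> *\<^sub>R p)" using assms(2) by simp
  also have "\<dots> = (cross2 (c - p) (y - p) / \<Delta>) *\<^sub>R a + (cross2 (y - p) (a - p) / \<Delta>) *\<^sub>R c + (cross2 (a - p) (c - p) / \<Delta>) *\<^sub>R y"
    unfolding \<Delta>_def barycentric_cross2(1)[of c a y p] by (simp add: scaleR_add_right)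
  finally have "p = (cross2 (c - p) (y - p) / \<Delta>) *\<^sub>R a + (cross2 (y - p) (a - p) / \<Delta>) *\<^sub>R c + (cross2 (a - p) (c - p) / \<Delta>) *\<^sub>R y" .
  moreover have "cross2 (c - p) (y - p) / \<Delta> + cross2 (y - p) (a - p) / \<Delta> + cross2 (a - p) (c - p) / \<Delta> = 1"
    using assms(2) barycentric_cross2(2)[of c a y p] unfolding \<Delta>_def by (simp add: add_divide_distrib[symmetric])
  ultimately show ?thesis unfolding convex_hull_3 using assms(3-5) by blast
qed

text \<open>Replacing the segment by a detour around one of the two points changes the loop by a triangle.\<close>

lemma winding_number_jump:
  fixes u v y d :: complex
  assumes \<gamma>: "path \<gamma>" "pathstart \<gamma> = v" "pathfinish \<gamma> = u"
    and y: "y \<in> open_segment u v" and \<alpha>: "\<alpha> > 0" and \<beta>: "\<beta> > 0" and left: "cross2 (v - u) d > 0"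
    and avoid: "\<And>\<tau>. - \<beta> \<le> \<tau> \<Longrightarrow> \<tau> \<le> \<alpha> \<Longrightarrow> y + \<tau> *\<^sub>R d \<notin> path_image \<gamma>"
  shows "winding_number (\<gamma> +++ linepath u v) (y + \<alpha> *\<^sub>R d) = winding_number (\<gamma> +++ linepath u v) (y - \<beta> *\<^sub>R d) + 1"
proof -
  define w where "w = v - u"
  obtain s where s: "0 < s" "s < 1" "y - u = s *\<^sub>R w" "v - y = (1 - s) *\<^sub>R w" "y = u + s *\<^sub>R w"
    using open_segment_altE[OF y] unfolding w_def by metis
  \<comment> \<open>The apex of the triangle; the factor 2 puts \<open>q\<close> in the middle
    between \<open>y\<close> and the apex, hence in the interior.\<close>
  define x where "x = y - (2 * \<beta>) *\<^sub>R d"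
  define p where "p = y + \<alpha> *\<^sub>R d"
  define q where "q = y - \<beta> *\<^sub>R d"
  have wd: "cross2 w d > 0" using left by (simp add: w_def)
  have ueq: "u = y - s *\<^sub>R w" and veq: "v = y + (1 - s) *\<^sub>R w" using s by (auto simp: algebra_simps)
  have indep: "r1 = r2 \<and> t1 = t2" if "y + r1 *\<^sub>R w + t1 *\<^sub>R d = y + r2 *\<^sub>R w + t2 *\<^sub>R d" for r1 r2 t1 t2
  proof -
    have "(r1 - r2) *\<^sub>R w + (t1 - t2) *\<^sub>R d = 0" using that by (simp add: algebra_simps)
    then have "cross2 ((r1 - r2) *\<^sub>R w + (t1 - t2) *\<^sub>R d) d = 0" "cross2 w ((r1 - r2) *\<^sub>R w + (t1 - t2) *\<^sub>R d) = 0"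
      by (simp_all add: cross2_simps)
    then show ?thesis using wd by (simp add: cross2_simps)
  qed
  define seg where "seg = closed_segment p q"
  have seg: "\<exists>\<tau>. z = y + \<tau> *\<^sub>R d \<and> - \<beta> \<le> \<tau> \<and> \<tau> \<le> \<alpha>" if z: "z \<in> seg" for z
  proof -
    obtain k where k: "0 \<le> k" "k \<le> 1" "z = (1 - k) *\<^sub>R p + k *\<^sub>R q" using z by (auto simp: seg_def in_segment)
    have "z = y + (\<alpha> - k * (\<alpha> + \<beta>)) *\<^sub>R d" using k by (simp add: p_def q_def algebra_simps)
    moreover have "k * (\<alpha> + \<beta>) \<le> \<alpha> + \<beta>" using k \<alpha> \<beta> by (simp add: mult_left_le_one_le)
    moreover have "0 \<le> k * (\<alpha> + \<beta>)" using k \<alpha> \<beta> by simp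
    ultimately show ?thesis by (intro exI[of _ "\<alpha> - k * (\<alpha> + \<beta>)"]) auto
  qed
  have pqs: "p \<in> seg" "q \<in> seg" by (auto simp: seg_def)
  have s\<gamma>: "z \<notin> path_image \<gamma>" if "z \<in> seg" for z using seg[OF that] avoid by blast
  have sux: "z \<notin> closed_segment u x" if "z \<in> seg" for z
  proof
    assume "z \<in> closed_segment u x"
    then obtain k where k: "0 \<le> k" "k \<le> 1" "z = (1 - k) *\<^sub>R u + k *\<^sub>R x" by (auto simp: in_segment)
    obtain \<tau> where \<tau>: "z = y + \<tau> *\<^sub>R d" "- \<beta> \<le> \<tau>" using seg[OF \<open>z \<in> seg\<close>] by blast
    have "y + 0 *\<^sub>R w + \<tau> *\<^sub>R d = y + (- (1 - k) * s) *\<^sub>R w + (- 2 * \<beta> * k) *\<^sub>R d"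
      using k \<tau> by (simp add: ueq x_def algebra_simps)
    from indep[OF this] have "(1 - k) * s = 0" "\<tau> = - 2 * \<beta> * k" by auto
    then show False using s \<tau> \<beta> by auto
  qed
  have sxv: "z \<notin> closed_segment x v" if "z \<in> seg" for z
  proof
    assume "z \<in> closed_segment x v"
    then obtain k where k: "0 \<le> k" "k \<le> 1" "z = (1 - k) *\<^sub>R x + k *\<^sub>R v" by (auto simp: in_segment)
    obtain \<tau> where \<tau>: "z = y + \<tau> *\<^sub>R d" "- \<beta> \<le> \<tau>" using seg[OF \<open>z \<in> seg\<close>] by blast
    have "y + 0 *\<^sub>R w + \<tau> *\<^sub>R d = y + (k * (1 - s)) *\<^sub>R w + (- 2 * \<beta> * (1 - k)) *\<^sub>R d"
      using k \<tau> by (simp add: veq x_def algebra_simps)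
    from indep[OF this] have "k * (1 - s) = 0" "\<tau> = - 2 * \<beta> * (1 - k)" by auto
    then show False using s \<tau> \<beta> by auto
  qed
  have nuv: "y + \<tau> *\<^sub>R d \<notin> closed_segment u v" if "\<tau> \<noteq> 0" for \<tau>
  proof
    assume "y + \<tau> *\<^sub>R d \<in> closed_segment u v"
    then obtain k where k: "y + \<tau> *\<^sub>R d = (1 - k) *\<^sub>R u + k *\<^sub>R v" by (auto simp: in_segment)
    have "y + 0 *\<^sub>R w + \<tau> *\<^sub>R d = y + (k - s) *\<^sub>R w + 0 *\<^sub>R d"
      using k by (simp add: ueq veq algebra_simps)
    from indep[OF this] show False using that by auto
  qed
  have puv: "p \<notin> closed_segment u v" unfolding p_def using nuv[of \<alpha>] \<alpha> by simp
  have quv: "q \<notin> closed_segment u v" unfolding q_def using nuv[of "-\<beta>"] \<beta> by simp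
  \<comment> \<open>The detour misses the whole segment from \<open>p\<close> to \<open>q\<close>,
    so its winding number is the same at both ends; the triangle contributes -1 at \<open>q\<close>
    and 0 at \<open>p\<close>.\<close>
  define det where "det = \<gamma> +++ (linepath u x +++ linepath x v)"
  define tri where "tri = linepath u v +++ linepath v x +++ linepath x u"
  have decomp: "winding_number (\<gamma> +++ linepath u v) z = winding_number det z + winding_number tri z"
    if "z \<in> seg" "z \<notin> closed_segment u v" for z
  proof -
    have n: "z \<notin> closed_segment u x" "z \<notin> closed_segment x v" "z \<notin> closed_segment x u" "z \<notin> closed_segment v x" "z \<notin> path_image \<gamma>"
      using sux sxv s\<gamma> that by (auto simp: closed_segment_commute)
    have "winding_number (linepath x u) z = - winding_number (linepath u x) z"
      using winding_number_reversepath[of "linepath u x" z] n by simp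
    moreover have "winding_number (linepath v x) z = - winding_number (linepath x v) z"
      using winding_number_reversepath[of "linepath x v" z] n by simp
    ultimately show ?thesis using n that \<gamma> unfolding det_def tri_def
      by (simp add: winding_number_join path_image_join)
  qed
  have "winding_number det p = winding_number det q"
  proof (rule winding_number_eq[of _ _ seg])
    show "path det" "pathfinish det = pathstart det" using \<gamma> by (auto simp: det_def)
    show "connected seg" by (simp add: seg_def)
    show "seg \<inter> path_image det = {}" using s\<gamma> sux sxv \<gamma> by (auto simp: det_def path_image_join)
  qed (use pqs in auto)
  moreover have "winding_number tri q = -1"
  proof -
    have ncol: "\<not> collinear {u, v, x}"
    proof (rule not_collinear_cross2)
      have "cross2 (v - u) (x - u) = - 2 * \<beta> * cross2 w d"
      proof -
        have "x - u = s *\<^sub>R w - (2 * \<beta>) *\<^sub>R d" by (simp add: x_def ueq)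
        then show ?thesis by (simp add: w_def[symmetric] cross2_simps)
      qed
      then show "cross2 (v - u) (x - u) \<noteq> 0" using wd \<beta> by simp
    qed
    have "q \<in> interior (convex hull {u, v, x})"
    proof -
      have "(1 - s) / 2 > 0" "s / 2 > 0" "(1::real) / 2 > 0" "(1 - s) / 2 + s / 2 + 1 / 2 = 1" using s by (auto simp: field_simps)
      moreover have "((1 - s) / 2) *\<^sub>R u + (s / 2) *\<^sub>R v + (1 / 2) *\<^sub>R x = q"
        by (simp add: ueq veq x_def q_def complex_eq_iff field_simps)
      ultimately show ?thesis unfolding interior_convex_hull_3_minimal[OF ncol DIM_complex] by blast
    qed
    then have "winding_number tri q = (if 0 < Im ((v - u) * cnj (v - q)) then 1 else -1)"
      unfolding tri_def by (rule winding_number_triangle)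
    moreover have "Im ((v - u) * cnj (v - q)) = - cross2 w (v - q)"
      by (simp add: cross2_def w_def algebra_simps)
    moreover have "cross2 w (v - q) = \<beta> * cross2 w d" by (simp add: veq q_def cross2_simps)
    moreover have "\<beta> * cross2 w d > 0" using wd \<beta> by simp
    ultimately show ?thesis by simp
  qed
  moreover have "winding_number tri p = 0"
  proof (rule winding_number_zero_outside[of _ "convex hull {u, v, x}"])
    show "path tri" "pathfinish tri = pathstart tri" by (auto simp: tri_def)
    show "path_image tri \<subseteq> convex hull {u, v, x}"
      unfolding tri_def by (auto simp: path_image_join segment_convex_hull intro: hull_mono[THEN subsetD, rotated])
    show "p \<notin> convex hull {u, v, x}"
    proof
      assume "p \<in> convex hull {u, v, x}"
      then obtain k1 k2 k3 where k: "0 \<le> k1" "0 \<le> k2" "0 \<le> k3" "k1 + k2 + k3 = 1" "p = k1 *\<^sub>R u + k2 *\<^sub>R v + k3 *\<^sub>R x"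
        unfolding convex_hull_3 by blast
      have ky: "k1 *\<^sub>R y + (k2 *\<^sub>R y + k3 *\<^sub>R y) = y"
        using k(4) by (metis add.assoc scaleR_left_distrib scaleR_one)
      have "y + 0 *\<^sub>R w + \<alpha> *\<^sub>R d = y + (- k1 * s + k2 * (1 - s)) *\<^sub>R w + (- 2 * \<beta> * k3) *\<^sub>R d"
        using k(5) ky by (simp add: p_def ueq veq x_def algebra_simps)
      from indep[OF this] have "\<alpha> = - 2 * \<beta> * k3" by auto
      moreover have "0 \<le> \<beta> * k3" using \<beta> k by (intro mult_nonneg_nonneg) auto
      ultimately show False using \<alpha> by linarith
    qed
  qed simp
  ultimately show ?thesis using decomp[OF pqs(1) puv] decomp[OF pqs(2) quv] by (simp add: p_def q_def)
qed

lemma closed_segment_altE: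
  fixes a b x :: complex
  assumes "x \<in> closed_segment a b"
  obtains s where "0 \<le> s" "s \<le> 1" "x = a + s *\<^sub>R (b - a)"
proof -
  obtain s where s: "0 \<le> s" "s \<le> 1" "x = (1 - s) *\<^sub>R a + s *\<^sub>R b"
    using assms by (auto simp: in_segment)
  show ?thesis by (rule that[OF s(1,2)]) (simp add: s algebra_simps)
qed

section \<open>Chords of a simple polygon\<close>

text \<open>Vertices are indexed periodically by all naturals, so that the boundary can be cut at
  any vertex and a range of consecutive indices never wraps around.\<close>

locale polygon =
  fixes n :: nat and P :: "nat \<Rightarrow> complex"
  assumes n3: "3 \<le> n" and periodic: "\<And>m. P (m + n) = P m"
    and distinct: "\<And>i j. i < j \<Longrightarrow> j < i + n \<Longrightarrow> P i \<noteq> P j"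
    and adjacent: "\<And>m. closed_segment (P m) (P (Suc m)) \<inter> closed_segment (P (Suc m)) (P (Suc (Suc m))) = {P (Suc m)}"
    and nonadjacent: "\<And>m m'. m + 2 \<le> m' \<Longrightarrow> m' + 2 \<le> m + n \<Longrightarrow>
       closed_segment (P m) (P (Suc m)) \<inter> closed_segment (P m') (P (Suc m')) = {}"
begin

definition edge :: "nat \<Rightarrow> complex set" where "edge m = closed_segment (P m) (P (Suc m))"

definition bd :: "complex set" where "bd = (\<Union>m<n. edge m)"

text \<open>For distinct end vertices such a segment is a crosscut, meeting the boundary only in its
  ends, and so splits the interior into two parts.\<close>

definition strict :: "nat \<Rightarrow> nat \<Rightarrow> bool" where "strict i j \<longleftrightarrow> open_segment (P i) (P j) \<subseteq> inside bd"

text \<open>Note the shift: \<open>chain i d\<close> consists of \<open>d + 1\<close> edges.\<close>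

primrec chain :: "nat \<Rightarrow> nat \<Rightarrow> real \<Rightarrow> complex" where
  "chain i 0 = linepath (P i) (P (Suc i))"
| "chain i (Suc d) = chain i d +++ linepath (P (i + Suc d)) (P (Suc (i + Suc d)))"

lemma chain_simps [simp]:
  "pathstart (chain i d) = P i" "pathfinish (chain i d) = P (Suc (i + d))" "path (chain i d)"
  by (induction d) (auto simp: path_join)

lemma path_image_chain: "path_image (chain i d) = (\<Union>m\<in>{i..i + d}. edge m)"
proof (induction d)
  case (Suc d)
  have "{i..i + Suc d} = insert (i + Suc d) {i..i + d}" by auto
  then show ?case using Suc by (simp add: path_image_join edge_def Un_commute)
qed (simp add: edge_def)

lemma edge_periodic: "edge (m + n) = edge m"
  using periodic[of m] periodic[of "Suc m"] by (simp add: edge_def)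

lemma edge_Int:
  assumes "m < m'" "m' < m + n" "x \<in> edge m" "x \<in> edge m'"
  shows "(m' = Suc m \<and> x = P m') \<or> (Suc m' = m + n \<and> x = P m)"
proof -
  consider "m' = Suc m" | "Suc m' = m + n" | "m + 2 \<le> m'" "m' + 2 \<le> m + n" using assms by linarith
  then show ?thesis
  proof cases
    case 1 then show ?thesis using adjacent[of m] assms by (auto simp: edge_def)
  next
    case 2
    have "x \<in> edge (Suc m')" using 2 assms edge_periodic[of m] by simp
    then have "x = P (Suc m')" using adjacent[of m'] assms by (auto simp: edge_def)
    then show ?thesis using 2 periodic[of m] by simp
  next
    case 3 then show ?thesis using nonadjacent[of m m'] assms by (auto simp: edge_def)
  qed
qed

text \<open>At most \<open>n - 1\<close> edges are joined, so at least one edge of the polygon is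
  missing and the ends do not meet.\<close>

lemma arc_chain: "d + 2 \<le> n \<Longrightarrow> arc (chain i d)"
proof (induction d)
  case 0
  then show ?case using distinct[of i "Suc i"] n3 by simp
next
  case (Suc d)
  have ne: "P (i + Suc d) \<noteq> P (Suc (i + Suc d))" using distinct[of "i + Suc d" "Suc (i + Suc d)"] n3 by simp
  have "path_image (chain i d) \<inter> edge (i + Suc d) \<subseteq> {P (i + Suc d)}"
  proof
    fix x assume "x \<in> path_image (chain i d) \<inter> edge (i + Suc d)"
    then obtain m where m: "i \<le> m" "m \<le> i + d" "x \<in> edge m" "x \<in> edge (i + Suc d)" by (auto simp: path_image_chain)
    then show "x \<in> {P (i + Suc d)}" using edge_Int[of m "i + Suc d" x] Suc.prems by auto
  qed
  then show ?case using Suc ne by (auto intro!: arc_join simp: edge_def)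
qed

lemma bd_eq: "bd = (\<Union>m\<in>{i..<i + n}. edge m)"
proof (induction i)
  case 0 show ?case by (auto simp: bd_def)
next
  case (Suc i)
  have "{Suc i..<Suc i + n} = insert (i + n) {Suc i..<i + n}" "{i..<i + n} = insert i {Suc i..<i + n}" using n3 by auto
  then show ?case using Suc edge_periodic[of i] by simp
qed

lemma vertex_in_edge: "P m \<in> edge m" "P (Suc m) \<in> edge m" by (auto simp: edge_def)

lemma vertex_in_bd: "P m \<in> bd"
  using bd_eq[of m] vertex_in_edge n3 by force

lemma sum_edges_periodic:
  fixes h :: "nat \<Rightarrow> complex"
  assumes "\<And>m. h (m + n) = h m"
  shows "sum h {i..<i + n} = sum h {..<n}"
proof (induction i)
  case 0 show ?case by (simp add: lessThan_atLeast0)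
next
  case (Suc i)
  have "{Suc i..<Suc i + n} = insert (i + n) {Suc i..<i + n}" "{i..<i + n} = insert i {Suc i..<i + n}" using n3 by auto
  then show ?case using Suc assms[of i] by simp
qed

text \<open>The winding number of the boundary as a sum over edges, which makes it independent of
  the starting vertex and additive under cutting.\<close>

definition turn :: "complex \<Rightarrow> complex" where
  "turn p = (\<Sum>m<n. winding_number (linepath (P m) (P (Suc m))) p)"

lemma winding_number_chain:
  "p \<notin> path_image (chain i d) \<Longrightarrow>
   winding_number (chain i d) p = (\<Sum>m\<in>{i..i + d}. winding_number (linepath (P m) (P (Suc m))) p)"
proof (induction d)
  case (Suc d)
  have "{i..i + Suc d} = insert (i + Suc d) {i..i + d}" by auto
  moreover have "p \<notin> path_image (chain i d)" "p \<notin> edge (i + Suc d)"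
    using Suc.prems unfolding path_image_chain by auto
  ultimately show ?case using Suc.IH by (simp add: winding_number_join edge_def add.commute)
qed simp

text \<open>The subtracted 1 compensates the shift in \<open>chain\<close>: the two chains run from
  \<open>i\<close> to \<open>k\<close> and from \<open>k\<close> to \<open>i + n\<close>.\<close>

lemma winding_number_chains:
  assumes "i < k" "k < i + n" "p \<notin> bd"
  shows "winding_number (chain i (k - i - 1)) p + winding_number (chain k (i + n - k - 1)) p = turn p"
proof -
  let ?h = "\<lambda>m. winding_number (linepath (P m) (P (Suc m))) p"
  have 1: "{i..i + (k - i - 1)} = {i..<k}" "{k..k + (i + n - k - 1)} = {k..<i + n}" using assms by auto
  have "p \<notin> path_image (chain i (k - i - 1))" "p \<notin> path_image (chain k (i + n - k - 1))"
    using assms unfolding path_image_chain 1 bd_eq[of i] by auto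
  then have "winding_number (chain i (k - i - 1)) p + winding_number (chain k (i + n - k - 1)) p
     = sum ?h {i..<k} + sum ?h {k..<i + n}" using winding_number_chain 1 by simp
  also have "\<dots> = sum ?h {i..<i + n}" using assms by (intro sum.atLeastLessThan_concat) auto
  also have "\<dots> = turn p" unfolding turn_def
    by (rule sum_edges_periodic) (use periodic[of "Suc _"] in \<open>simp add: periodic\<close>)
  finally show ?thesis .
qed

lemma chains:
  assumes "i < k" "k < i + n"
  shows "arc (chain i (k - i - 1))" "arc (chain k (i + n - k - 1))"
    "pathfinish (chain i (k - i - 1)) = P k" "pathfinish (chain k (i + n - k - 1)) = P i"
    "path_image (chain i (k - i - 1)) \<union> path_image (chain k (i + n - k - 1)) = bd"
    "path_image (chain i (k - i - 1)) \<inter> path_image (chain k (i + n - k - 1)) = {P i, P k}"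
proof -
  have 1: "{i..i + (k - i - 1)} = {i..<k}" "{k..k + (i + n - k - 1)} = {k..<i + n}" using assms by auto
  show "arc (chain i (k - i - 1))" "arc (chain k (i + n - k - 1))" using assms by (auto intro!: arc_chain)
  show "pathfinish (chain i (k - i - 1)) = P k" using assms by simp
  have e: "Suc (k + (i + n - k - 1)) = i + n" using assms by simp
  show f: "pathfinish (chain k (i + n - k - 1)) = P i" unfolding chain_simps e by (rule periodic)
  have "{i..<i + n} = {i..<k} \<union> {k..<i + n}" using assms by auto
  then show "path_image (chain i (k - i - 1)) \<union> path_image (chain k (i + n - k - 1)) = bd"
    unfolding path_image_chain 1 bd_eq[of i] by auto
  show "path_image (chain i (k - i - 1)) \<inter> path_image (chain k (i + n - k - 1)) = {P i, P k}"
  proof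
    show "{P i, P k} \<subseteq> path_image (chain i (k - i - 1)) \<inter> path_image (chain k (i + n - k - 1))"
      using pathstart_in_path_image[of "chain i (k - i - 1)"] pathfinish_in_path_image[of "chain i (k - i - 1)"]
        pathstart_in_path_image[of "chain k (i + n - k - 1)"] pathfinish_in_path_image[of "chain k (i + n - k - 1)"]
        f assms by (auto simp del: pathstart_in_path_image pathfinish_in_path_image)
    show "path_image (chain i (k - i - 1)) \<inter> path_image (chain k (i + n - k - 1)) \<subseteq> {P i, P k}"
    proof
      fix x assume "x \<in> path_image (chain i (k - i - 1)) \<inter> path_image (chain k (i + n - k - 1))"
      then obtain m m' where m: "i \<le> m" "m < k" "k \<le> m'" "m' < i + n" "x \<in> edge m" "x \<in> edge m'"
        unfolding path_image_chain 1 by auto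
      have "m < m'" "m' < m + n" using m by auto
      then consider "m' = Suc m" "x = P m'" | "Suc m' = m + n" "x = P m" using edge_Int m by blast
      then show "x \<in> {P i, P k}"
      proof cases
        case 1 then have "m' = k" using m by simp
        then show ?thesis using 1 by simp
      next
        case 2 then have "m = i" using m by simp
        then show ?thesis using 2 by simp
      qed
    qed
  qed
qed

text \<open>The boundary is cut at the vertices 0 and 1 into two arcs that share only their
  ends.\<close>

lemma boundary_loop:
  obtains \<gamma> where "simple_path \<gamma>" "pathfinish \<gamma> = pathstart \<gamma>" "path_image \<gamma> = bd"
    "\<And>p. p \<notin> bd \<Longrightarrow> winding_number \<gamma> p = turn p"
proof -
  have ik: "(0::nat) < 1" "1 < 0 + n" using n3 by auto
  note c = chains[OF ik]
  let ?g = "chain 0 (1 - 0 - 1) +++ chain 1 (0 + n - 1 - 1)"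
  show ?thesis
  proof (rule that[of ?g])
    show "simple_path ?g" by (rule simple_path_join_loop[OF c(1,2)]) (use c in auto)
    show "pathfinish ?g = pathstart ?g" using c by auto
    show im: "path_image ?g = bd" using c by (subst path_image_join) auto
    show "winding_number ?g p = turn p" if "p \<notin> bd" for p
      using winding_number_chains[OF ik that] that c(3-5) by (subst winding_number_join) auto
  qed
qed

lemma jordan:
  "open (inside bd)" "connected (inside bd)" "open (outside bd)" "connected (outside bd)"
  "\<not> bounded (outside bd)" "frontier (outside bd) = bd"
proof -
  obtain \<gamma> where g: "simple_path \<gamma>" "pathfinish \<gamma> = pathstart \<gamma>" "path_image \<gamma> = bd" using boundary_loop by metis
  show "open (inside bd)" "connected (inside bd)" "open (outside bd)" "connected (outside bd)"
    "\<not> bounded (outside bd)" "frontier (outside bd) = bd"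
    using Jordan_inside_outside[OF g(1,2)] g(3) by auto
qed

text \<open>The sign records whether the vertices run counterclockwise or clockwise.\<close>

lemma turn_inside:
  obtains \<epsilon> :: real where "\<epsilon> = 1 \<or> \<epsilon> = -1" "\<And>p. p \<in> inside bd \<Longrightarrow> turn p = of_real \<epsilon>"
proof -
  obtain \<gamma> where g: "simple_path \<gamma>" "path_image \<gamma> = bd" "\<And>p. p \<notin> bd \<Longrightarrow> winding_number \<gamma> p = turn p"
    using boundary_loop by metis
  have t: "turn p = winding_number \<gamma> p" if "p \<in> inside bd" for p
    using that g(3) inside_no_overlap by fastforce
  show ?thesis
    by (rule simple_closed_path_winding_number_inside[OF g(1)])
      (use that[of 1] that[of "-1"] t g(2) in auto)
qed

lemma inside_bd_disjoint: "p \<in> inside bd \<Longrightarrow> p \<notin> bd" using inside_no_overlap[of bd] by blast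

lemma vertex_not_inside: "P m \<notin> inside bd" using vertex_in_bd inside_bd_disjoint by auto

section \<open>Splitting the interior along a chord\<close>

context
  fixes i k assumes ik: "i < k" "k < i + n" and st: "strict i k"
begin

definition C1 where "C1 = path_image (chain i (k - i - 1)) \<union> closed_segment (P i) (P k)"
definition C2 where "C2 = path_image (chain k (i + n - k - 1)) \<union> closed_segment (P i) (P k)"

lemma chord_split:
  "inside C1 \<inter> inside C2 = {}" "inside C1 \<union> inside C2 \<union> open_segment (P i) (P k) = inside bd"
proof -
  note c = chains[OF ik]
  have ne: "P i \<noteq> P k" using distinct ik by blast
  let ?c1 = "chain i (k - i - 1)" and ?c2 = "reversepath (chain k (i + n - k - 1))" and ?c = "linepath (P i) (P k)"
  have disj: "open_segment (P i) (P k) \<inter> bd = {}" using st inside_bd_disjoint by (auto simp: strict_def)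
  have seg: "closed_segment (P i) (P k) \<inter> bd = {P i, P k}"
    using disj vertex_in_bd by (auto simp: closed_segment_eq_open)
  have Un: "path_image ?c1 \<union> path_image ?c2 = bd" using c(5) by simp
  have in1: "{P i, P k} \<subseteq> path_image (chain i (k - i - 1))" "{P i, P k} \<subseteq> path_image (chain k (i + n - k - 1))"
    using c(6) by auto
  have "inside (path_image ?c1 \<union> path_image ?c) \<inter> inside (path_image ?c2 \<union> path_image ?c) = {} \<and>
     inside (path_image ?c1 \<union> path_image ?c) \<union> inside (path_image ?c2 \<union> path_image ?c) \<union> (path_image ?c - {P i, P k})
       = inside (path_image ?c1 \<union> path_image ?c2)"
  proof (rule split_inside_simple_closed_curve[of ?c1 "P i" "P k" ?c2 ?c])
    show "simple_path ?c1" "simple_path ?c2"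
      using c(1,2) arc_imp_simple_path simple_path_reversepath by blast+
    show "path_image ?c1 \<inter> path_image ?c2 = {P i, P k}" using c(6) by simp
    show "path_image ?c1 \<inter> path_image ?c = {P i, P k}" using seg c(5) in1 by (auto 0 3)
    show "path_image ?c2 \<inter> path_image ?c = {P i, P k}" using seg c(5) in1 by (auto 0 3)
    have "open_segment (P i) (P k) \<noteq> {}" using ne by simp
    then obtain x where "x \<in> open_segment (P i) (P k)" by blast
    then have "x \<in> path_image ?c" "x \<in> inside bd" using st by (auto simp: strict_def open_closed_segment)
    then show "path_image ?c \<inter> inside (path_image ?c1 \<union> path_image ?c2) \<noteq> {}"
      unfolding Un by blast
  qed (use c ne in auto)
  then show "inside C1 \<inter> inside C2 = {}" "inside C1 \<union> inside C2 \<union> open_segment (P i) (P k) = inside bd"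
    unfolding Un C1_def C2_def by (simp_all add: open_segment_def)
qed

lemma C_closed: "closed C1" "closed C2"
  unfolding C1_def C2_def by (auto intro!: closed_path_image)

text \<open>A point inside \<open>C1\<close> is outside \<open>C2\<close>, so the second loop
  contributes 0. The two loops add up to the boundary, as they traverse the chord in opposite
  directions.\<close>

lemma C1_winding:
  assumes "p \<in> inside C1"
  shows "winding_number (chain i (k - i - 1) +++ linepath (P k) (P i)) p = turn p"
proof -
  note c = chains[OF ik]
  have p: "p \<in> inside bd" "p \<notin> inside C2" using chord_split assms by auto
  have pb: "p \<notin> bd" using p inside_bd_disjoint by auto
  have pC1: "p \<notin> C1" using assms inside_no_overlap by blast
  then have ps: "p \<notin> closed_segment (P i) (P k)" by (auto simp: C1_def)
  have nb: "p \<notin> path_image (chain i (k - i - 1))" "p \<notin> path_image (chain k (i + n - k - 1))" using pb c(5) by auto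
  have "p \<in> outside C2" using p(2) nb ps by (simp add: outside_inside) (simp add: C2_def)
  moreover have im: "path_image (chain k (i + n - k - 1) +++ linepath (P i) (P k)) = C2"
    using c(4) by (subst path_image_join) (auto simp: C2_def)
  ultimately have "winding_number (chain k (i + n - k - 1) +++ linepath (P i) (P k)) p = 0"
    using c(4) by (intro winding_number_zero_in_outside) auto
  then have "winding_number (chain k (i + n - k - 1)) p + winding_number (linepath (P i) (P k)) p = 0"
    using c(4) nb ps by (subst (asm) winding_number_join) auto
  then have "winding_number (chain k (i + n - k - 1)) p = - winding_number (linepath (P i) (P k)) p"
    by (simp only: eq_neg_iff_add_eq_0)
  moreover have "winding_number (linepath (P k) (P i)) p = - winding_number (linepath (P i) (P k)) p"
    using winding_number_reversepath[of "linepath (P i) (P k)" p] ps by simp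
  moreover have "winding_number (chain i (k - i - 1) +++ linepath (P k) (P i)) p
     = winding_number (chain i (k - i - 1)) p + winding_number (linepath (P k) (P i)) p"
    using c(3) nb ps by (intro winding_number_join) (auto simp: closed_segment_commute)
  ultimately show ?thesis using winding_number_chains[OF ik pb] by simp
qed

lemma C2_winding:
  assumes "p \<in> inside C2"
  shows "winding_number (chain i (k - i - 1) +++ linepath (P k) (P i)) p = 0"
proof -
  note c = chains[OF ik]
  have p: "p \<in> inside bd" "p \<notin> inside C1" using chord_split assms by auto
  have pb: "p \<notin> bd" using p inside_bd_disjoint by auto
  have "p \<notin> C2" using assms inside_no_overlap by blast
  then have "p \<notin> C1" using pb c(5) by (auto simp: C1_def C2_def)
  then have "p \<in> outside C1" using p(2) by (simp add: outside_inside)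
  moreover have "path_image (chain i (k - i - 1) +++ linepath (P k) (P i)) = C1"
    using c(3) by (subst path_image_join) (auto simp: C1_def closed_segment_commute)
  ultimately show ?thesis using c(3) by (intro winding_number_zero_in_outside) auto
qed

text \<open>By connectedness \<open>S\<close> lies on one side of the chord. The vertex
  \<open>P j\<close> in its closure belongs to only one of the two loops, which tells the
  side.\<close>

lemma side_of_vertex:
  assumes S: "connected S" "S \<subseteq> inside bd" "S \<inter> closed_segment (P i) (P k) = {}" "P j \<in> closure S" "i < j" "j < i + n" "j \<noteq> k"
  shows "S \<subseteq> (if j < k then inside C1 else inside C2)"
proof -
  note c = chains[OF ik]
  have ne: "P j \<noteq> P i" "P j \<noteq> P k" using distinct[of i j] distinct[of j k] distinct[of k j] assms(5-7) ik
    by (auto simp: neq_iff)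
  have sub: "S \<subseteq> inside C1 \<union> inside C2"
    using S(2,3) chord_split(2) by (auto simp: closed_segment_eq_open)
  have "inside C1 \<inter> S = {} \<or> inside C2 \<inter> S = {}"
    using connectedD[OF S(1) open_inside[OF C_closed(1)] open_inside[OF C_closed(2)] _ sub] chord_split(1) by auto
  then have alt: "S \<subseteq> inside C1 \<or> S \<subseteq> inside C2" using sub by auto
  have nos: "P j \<notin> closed_segment (P i) (P k)" using ne st vertex_not_inside by (auto simp: closed_segment_eq_open strict_def)
  have nin: "P j \<notin> inside C1" "P j \<notin> inside C2" using vertex_not_inside chord_split(2) by auto
  have cl: "P j \<in> C1" if "S \<subseteq> inside C1"
    using S(4) closure_mono[OF that] closure_inside_subset[OF C_closed(1)] nin by auto
  have cl2: "P j \<in> C2" if "S \<subseteq> inside C2"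
    using S(4) closure_mono[OF that] closure_inside_subset[OF C_closed(2)] nin by auto
  show ?thesis
  proof (cases "j < k")
    case True
    have "P j \<in> path_image (chain i (k - i - 1))" unfolding path_image_chain using True assms(5) vertex_in_edge(1)[of j] by force
    then have "P j \<notin> path_image (chain k (i + n - k - 1))" using c(6) ne by auto
    then show ?thesis using cl2 alt nos True by (auto simp: C2_def)
  next
    case False
    have "P j \<in> path_image (chain k (i + n - k - 1))" unfolding path_image_chain using False assms(6) ik vertex_in_edge(1)[of j] by force
    then have "P j \<notin> path_image (chain i (k - i - 1))" using c(6) ne by auto
    then show ?thesis using cl alt nos False by (auto simp: C1_def)
  qed
qed

end

text \<open>Collinear chords through a common inner point would have the same ends, since no strict
  chord has a vertex in its interior.\<close>

lemma parallel_strict_chords_disjoint: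
  assumes "strict i k" "strict j l" "{P i, P k} \<noteq> {P j, P l}"
    "y \<in> open_segment (P i) (P k)" "y \<in> open_segment (P j) (P l)"
  shows "cross2 (P k - P i) (P l - P j) \<noteq> 0"
proof
  assume "cross2 (P k - P i) (P l - P j) = 0"
  then have "{P i, P k} = {P j, P l}"
    using collinear_open_segments_eq[OF assms(4,5)] assms(1,2) vertex_not_inside unfolding strict_def by blast
  then show False using assms(3) by simp
qed

text \<open>The sign is the point: crossing chords with interleaved ends are all oriented like the polygon,
  because each of the two loops cut off by a chord has the winding number of the whole boundary.\<close>

lemma strict_chords_cross:
  assumes o: "i < j" "j < k" "k < l" "l < i + n" and st: "strict i k" "strict j l"
    and \<epsilon>: "\<epsilon> = 1 \<or> \<epsilon> = -1" "\<And>p. p \<in> inside bd \<Longrightarrow> turn p = of_real \<epsilon>"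
  obtains y where "y \<in> open_segment (P i) (P k)" "y \<in> open_segment (P j) (P l)"
    "\<epsilon> * cross2 (P k - P i) (P l - P j) > 0"
proof -
  have ik: "i < k" "k < i + n" using o by auto
  note c = chains[OF ik]
  let ?S = "open_segment (P j) (P l)" and ?T = "closed_segment (P i) (P k)"
  have jl: "P j \<noteq> P l" using distinct[of j l] o by simp
  have S: "connected ?S" "?S \<subseteq> inside bd"
    using st(2) convex_connected[OF convex_open_segment] by (auto simp: strict_def)
  have split: "inside (C1 i k) \<inter> inside (C2 i k) = {}" using chord_split[OF ik st(1)] by blast
  have clS: "P j \<in> closure ?S" "P l \<in> closure ?S" using jl by (auto simp: closure_open_segment)
  \<comment> \<open>Otherwise the chord from \<open>P j\<close> to \<open>P l\<close> would lie on
    one side, although its ends belong to different loops.\<close>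
  have "?S \<inter> ?T \<noteq> {}"
  proof
    assume d: "?S \<inter> ?T = {}"
    have "?S \<subseteq> inside (C1 i k)" using side_of_vertex[OF ik st(1) S d clS(1)] o by simp
    moreover have "?S \<subseteq> inside (C2 i k)" using side_of_vertex[OF ik st(1) S d clS(2)] o by simp
    ultimately have "?S = {}" using split by blast
    then show False using jl by simp
  qed
  then obtain y where y: "y \<in> ?S" "y \<in> ?T" by blast
  have yi: "y \<in> inside bd" using y S by auto
  have yo: "y \<in> open_segment (P i) (P k)" using y(2) yi vertex_not_inside by (auto simp: closed_segment_eq_open)
  define u where "u = P k - P i"
  define v where "v = P l - P j"
  have "P j \<noteq> P i" "P j \<noteq> P k" using distinct[of i j] distinct[of j k] o by auto
  then have cr: "cross2 u v \<noteq> 0" unfolding u_def v_def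
    using parallel_strict_chords_disjoint[OF st _ yo y(1)] by blast
  obtain s where s: "0 < s" "s < 1" "y - P j = s *\<^sub>R v" "P l - y = (1 - s) *\<^sub>R v" "y = P j + s *\<^sub>R v"
    using open_segment_altE[OF y(1)] unfolding v_def by metis
  have only: "y + \<tau> *\<^sub>R v \<notin> ?T" if "\<tau> \<noteq> 0" for \<tau>
  proof
    assume a: "y + \<tau> *\<^sub>R v \<in> ?T"
    obtain r q where "y + \<tau> *\<^sub>R v = P i + r *\<^sub>R u" "y = P i + q *\<^sub>R u"
      using closed_segment_altE[OF a] closed_segment_altE[OF y(2)] unfolding u_def by metis
    then have "\<tau> *\<^sub>R v = (r - q) *\<^sub>R u" by (simp add: algebra_simps)
    then have "cross2 u (\<tau> *\<^sub>R v) = cross2 u ((r - q) *\<^sub>R u)" by simp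
    then have "\<tau> * cross2 u v = 0" by (simp only: cross2_simps mult_zero_right)
    then show False using that cr by simp
  qed
  have yne: "y \<noteq> P j" "y \<noteq> P l" using y by (auto simp: open_segment_def)
  have in_S: "y + \<tau> *\<^sub>R v \<in> ?S" if "- s < \<tau>" "\<tau> < 1 - s" for \<tau>
    by (rule open_segmentI[of _ _ _ "s + \<tau>"]) (use that s jl in \<open>auto simp: v_def algebra_simps\<close>)
  have Sj: "open_segment y (P j) \<subseteq> inside (C1 i k)"
  proof -
    have par: "\<exists>\<tau>. - s < \<tau> \<and> \<tau> < 0 \<and> z = y + \<tau> *\<^sub>R v" if z: "z \<in> open_segment y (P j)" for z
    proof -
      obtain q where q: "0 < q" "q < 1" "z = y + q *\<^sub>R (P j - y)" using open_segment_altE[OF z] by metis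
      have "P j - y = (- s) *\<^sub>R v" using s by (simp add: algebra_simps)
      then have "z = y + (- (q * s)) *\<^sub>R v" using q by simp
      then show ?thesis using q s by (intro exI[of _ "- (q * s)"]) auto
    qed
    have sub: "open_segment y (P j) \<subseteq> inside bd" using par in_S s S(2) by (smt (verit) subset_iff)
    have dis: "open_segment y (P j) \<inter> ?T = {}" using par only by fastforce
    have cl: "P j \<in> closure (open_segment y (P j))" using yne by (simp add: closure_open_segment)
    show ?thesis
      using side_of_vertex[OF ik st(1) convex_connected[OF convex_open_segment] sub dis cl] o by simp
  qed
  have Sl: "open_segment y (P l) \<subseteq> inside (C2 i k)"
  proof -
    have par: "\<exists>\<tau>. 0 < \<tau> \<and> \<tau> < 1 - s \<and> z = y + \<tau> *\<^sub>R v" if z: "z \<in> open_segment y (P l)" for z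
    proof -
      obtain q where q: "0 < q" "q < 1" "z = y + q *\<^sub>R (P l - y)" using open_segment_altE[OF z] by metis
      then have "z = y + (q * (1 - s)) *\<^sub>R v" using s by simp
      then show ?thesis using q s by (intro exI[of _ "q * (1 - s)"]) auto
    qed
    have sub: "open_segment y (P l) \<subseteq> inside bd" using par in_S s S(2) by (smt (verit) subset_iff)
    have dis: "open_segment y (P l) \<inter> ?T = {}" using par only by fastforce
    have cl: "P l \<in> closure (open_segment y (P l))" using yne by (simp add: closure_open_segment)
    show ?thesis
      using side_of_vertex[OF ik st(1) convex_connected[OF convex_open_segment] sub dis cl] o by simp
  qed
  \<comment> \<open>Sample points on the second chord on both sides of the crossing; there the loop
    cut off by the first chord has the winding numbers \<open>\<epsilon>\<close> and 0.\<close>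
  define yj where "yj = y + (- (s / 2)) *\<^sub>R v"
  define yl where "yl = y + ((1 - s) / 2) *\<^sub>R v"
  have "yj \<in> open_segment y (P j)"
    by (rule open_segmentI[OF yne(1), of _ "1/2"]) (use s in \<open>auto simp: yj_def algebra_simps\<close>)
  then have yj: "yj \<in> inside (C1 i k)" using Sj by blast
  have "yl \<in> open_segment y (P l)"
    by (rule open_segmentI[OF yne(2), of _ "1/2"]) (use s in \<open>auto simp: yl_def\<close>)
  then have yl: "yl \<in> inside (C2 i k)" using Sl by blast
  let ?g = "chain i (k - i - 1)" and ?L = "chain i (k - i - 1) +++ linepath (P k) (P i)"
  have wj: "winding_number ?L yj = of_real \<epsilon>"
    using C1_winding[OF ik st(1) yj] \<epsilon>(2)[of yj] yj chord_split(2)[OF ik st(1)] by auto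
  have wl: "winding_number ?L yl = 0" using C2_winding[OF ik st(1) yl] .
  have av: "y + \<tau> *\<^sub>R v \<notin> path_image ?g" if "- s < \<tau>" "\<tau> < 1 - s" for \<tau>
    using in_S[OF that] S(2) inside_bd_disjoint c(5) by blast
  have yo': "y \<in> open_segment (P k) (P i)" using yo by (simp add: open_segment_commute)
  \<comment> \<open>The loop follows the chord from \<open>P k\<close> to \<open>P i\<close>, with
    \<open>P j\<close> on its left iff the cross product is positive. The winding number is larger
    by 1 on the left, which fixes \<open>\<epsilon>\<close> in each case.\<close>
  have "\<epsilon> * cross2 u v > 0"
  proof (cases "cross2 u v > 0")
    case True
    have "winding_number ?L (y + (s / 2) *\<^sub>R (- v)) = winding_number ?L (y - ((1 - s) / 2) *\<^sub>R (- v)) + 1"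
    proof (rule winding_number_jump[OF _ _ _ yo'])
      show "y + \<tau> *\<^sub>R - v \<notin> path_image ?g" if "- ((1 - s) / 2) \<le> \<tau>" "\<tau> \<le> s / 2" for \<tau>
      proof -
        have "- s < - \<tau>" "- \<tau> < 1 - s" using that s(1,2) by (auto simp: field_simps)
        from av[OF this] show ?thesis by simp
      qed
      show "cross2 (P i - P k) (- v) > 0" using True by (simp add: u_def cross2_simps)
    qed (use s c in auto)
    then have "of_real \<epsilon> = (1::complex)" using wj wl by (simp add: yj_def yl_def)
    then show ?thesis using True by simp
  next
    case False
    then have neg: "cross2 u v < 0" using cr by simp
    have "winding_number ?L (y + ((1 - s) / 2) *\<^sub>R v) = winding_number ?L (y - (s / 2) *\<^sub>R v) + 1"
    proof (rule winding_number_jump[OF _ _ _ yo'])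
      show "y + \<tau> *\<^sub>R v \<notin> path_image ?g" if "- (s / 2) \<le> \<tau>" "\<tau> \<le> (1 - s) / 2" for \<tau>
      proof -
        have "- s < \<tau>" "\<tau> < 1 - s" using that s(1,2) by (auto simp: field_simps)
        then show ?thesis by (rule av)
      qed
      show "cross2 (P i - P k) v > 0" using neg by (simp add: u_def cross2_simps)
    qed (use s c in auto)
    then have "of_real \<epsilon> + 1 = (0::complex)" using wj wl by (simp add: yj_def yl_def)
    then have "\<epsilon> = -1" using \<epsilon>(1) by auto
    then show ?thesis using neg by simp
  qed
  then show ?thesis using that[OF yo y(1)] by (simp add: u_def v_def)
qed

text \<open>If a point of the diagonal were not inside, the exterior would enter the union
  \<open>H\<close> of the two triangles. Being connected and unbounded, it would then meet the
  frontier of \<open>H\<close>; but that frontier lies on the four sides, as the open diagonal is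
  interior to \<open>H\<close>.\<close>

lemma quadrilateral_diagonal:
  assumes seg: "closed_segment a y \<subseteq> bd \<union> inside bd" "closed_segment y c \<subseteq> bd \<union> inside bd"
      "closed_segment c z \<subseteq> bd \<union> inside bd" "closed_segment z a \<subseteq> bd \<union> inside bd"
    and y: "cross2 (c - a) (y - a) < 0" and z: "cross2 (c - a) (z - a) > 0"
  shows "open_segment a c \<subseteq> inside bd"
proof
  fix q0 assume q0: "q0 \<in> open_segment a c"
  define H where "H = convex hull {a, c, y} \<union> convex hull {a, c, z}"
  \<comment> \<open>The intersection of the half-planes of the four sides. At a reflex corner it is
    smaller than \<open>H\<close>, but it always is an open neighbourhood of the open
    diagonal.\<close>
  define N where "N = {p. cross2 (c - p) (y - p) < 0} \<inter> {p. cross2 (y - p) (a - p) < 0} \<inter>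
     ({p. 0 < cross2 (c - p) (z - p)} \<inter> {p. 0 < cross2 (z - p) (a - p)})"
  have oN: "open N" unfolding N_def cross2_def
    by (intro open_Int open_Collect_less continuous_intros)
  have NH: "N \<subseteq> H"
  proof
    fix p assume p: "p \<in> N"
    show "p \<in> H"
    proof (cases "cross2 (a - p) (c - p) \<le> 0")
      case True
      have "p \<in> convex hull {a, c, y}"
        by (rule in_triangle_cross2) (use p y True in \<open>auto simp: N_def divide_nonpos_neg divide_neg_neg less_imp_le\<close>)
      then show ?thesis by (simp add: H_def)
    next
      case False
      have "p \<in> convex hull {a, c, z}"
        by (rule in_triangle_cross2) (use p z False in \<open>auto simp: N_def\<close>)
      then show ?thesis by (simp add: H_def)
    qed
  qed
  have qN: "q \<in> N" if q: "q \<in> open_segment a c" for q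
  proof -
    obtain s where s: "0 < s" "s < 1" "q - a = s *\<^sub>R (c - a)" "c - q = (1 - s) *\<^sub>R (c - a)" using open_segment_altE[OF q] by metis
    have aq: "a - q = (- s) *\<^sub>R (c - a)" using s(3) by (simp add: algebra_simps)
    have *: "cross2 (c - q) (x - q) = (1 - s) * cross2 (c - a) (x - a)" "cross2 (x - q) (a - q) = s * cross2 (c - a) (x - a)" for x
    proof -
      have xq: "x - q = (x - a) - s *\<^sub>R (c - a)" using s(3) by (simp add: algebra_simps)
      have g: "cross2 ((1 - s) *\<^sub>R W) (X - s *\<^sub>R W) = (1 - s) * cross2 W X"
        "cross2 (X - s *\<^sub>R W) ((- s) *\<^sub>R W) = s * cross2 W X" for W X
        by (simp_all add: cross2_def algebra_simps)
      show "cross2 (c - q) (x - q) = (1 - s) * cross2 (c - a) (x - a)"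
        unfolding s(4) xq by (rule g)
      show "cross2 (x - q) (a - q) = s * cross2 (c - a) (x - a)"
        unfolding aq xq by (rule g)
    qed
    show ?thesis unfolding N_def Int_iff mem_Collect_eq * using s(1,2) y z by (simp add: mult_pos_neg)
  qed
  have fH: "frontier H \<subseteq> bd \<union> inside bd"
  proof
    fix p assume p: "p \<in> frontier H"
    have "frontier H \<subseteq> frontier (convex hull {a, c, y}) \<union> frontier (convex hull {a, c, z})"
      unfolding H_def by (rule frontier_Un_subset)
    then have "p \<in> closed_segment a c \<union> closed_segment c y \<union> closed_segment y a \<union> (closed_segment a c \<union> closed_segment c z \<union> closed_segment z a)"
      using p by (simp add: frontier_of_triangle) blast
    moreover have "p \<notin> open_segment a c"
    proof
      assume "p \<in> open_segment a c"
      then have "p \<in> interior H" using qN NH oN by (meson interior_maximal subsetD)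
      then show False using p by (simp add: frontier_def)
    qed
    moreover have "a \<in> closed_segment a y" "c \<in> closed_segment y c" by auto
    ultimately show "p \<in> bd \<union> inside bd"
      using seg by (auto simp: closed_segment_commute closed_segment_eq_open[of a c])
  qed
  show "q0 \<in> inside bd"
  proof (rule ccontr)
    assume n: "q0 \<notin> inside bd"
    have "q0 \<in> closure (outside bd)"
    proof (cases "q0 \<in> bd")
      case True then show ?thesis using jordan(6) by (metis Diff_iff frontier_def)
    next
      case False then have "q0 \<in> outside bd" using n by (simp add: outside_inside)
      then show ?thesis using closure_subset by blast
    qed
    then have "outside bd \<inter> N \<noteq> {}" using qN[OF q0] oN by (metis closure_iff_nhds_not_empty inf_commute order_refl)
    then have 1: "outside bd \<inter> H \<noteq> {}" using NH by blast
    have "bounded H" unfolding H_def by (auto intro!: bounded_convex_hull)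
    then have 2: "outside bd - H \<noteq> {}" using jordan(5) bounded_subset by blast
    have "outside bd \<inter> frontier H \<noteq> {}" by (rule connected_Int_frontier[OF jordan(4) 1 2])
    then show False using fH by (auto simp: outside_inside)
  qed
qed

text \<open>The chords from \<^term>\<open>a\<close> and from \<^term>\<open>c\<close> meet in one point on each side of the line
  through \<^term>\<open>P a\<close> and \<^term>\<open>P c\<close>.\<close>

lemma strict_plus:
  assumes o: "a1 < a" "a < a2" "a2 < c1" "c1 < c" "c < c2" "c2 < a1 + n"
    and st: "strict a c1" "strict a c2" "strict a1 c" "strict a2 c"
  shows "strict a c"
proof -
  obtain \<epsilon> where e: "\<epsilon> = 1 \<or> \<epsilon> = -1" "\<And>p. p \<in> inside bd \<Longrightarrow> turn p = of_real \<epsilon>" using turn_inside by metis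
  obtain y where y: "y \<in> open_segment (P a) (P c1)" "y \<in> open_segment (P a2) (P c)" "\<epsilon> * cross2 (P c1 - P a) (P c - P a2) > 0"
    using strict_chords_cross[OF _ _ _ _ st(1,4) e] o by auto
  obtain z where z: "z \<in> open_segment (P a1) (P c)" "z \<in> open_segment (P a) (P c2)" "\<epsilon> * cross2 (P c - P a1) (P c2 - P a) > 0"
    using strict_chords_cross[OF _ _ _ _ st(3,2) e] o by auto
  obtain s where s: "0 < s" "s < 1" "y - P a = s *\<^sub>R (P c1 - P a)" using open_segment_altE[OF y(1)] by metis
  obtain r where r: "0 < r" "r < 1" "P c - y = (1 - r) *\<^sub>R (P c - P a2)" using open_segment_altE[OF y(2)] by metis
  obtain s' where s': "0 < s'" "s' < 1" "z - P a = s' *\<^sub>R (P c2 - P a)" using open_segment_altE[OF z(2)] by metis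
  obtain r' where r': "0 < r'" "r' < 1" "P c - z = (1 - r') *\<^sub>R (P c - P a1)" using open_segment_altE[OF z(1)] by metis
  have g: "cross2 (k *\<^sub>R U) (l *\<^sub>R V) = k * l * cross2 U V" for k l U V by (simp add: cross2_def algebra_simps)
  \<comment> \<open>The vectors \<open>y - P a\<close> and \<open>P c - y\<close> are positive
    multiples of the two crossing chords, so the sign at the crossing gives the side of
    \<open>y\<close>. The same computation puts \<open>z\<close> on the other side.\<close>
  have "cross2 (P c - P a) (y - P a) = - cross2 (y - P a) (P c - y)" by (simp add: cross2_def algebra_simps)
  also have "\<dots> = - (s * (1 - r) * cross2 (P c1 - P a) (P c - P a2))" unfolding s(3) r(3) g by simp
  finally have sy: "\<epsilon> * cross2 (P c - P a) (y - P a) = - (s * (1 - r) * (\<epsilon> * cross2 (P c1 - P a) (P c - P a2)))" by simp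
  have sy': "\<epsilon> * cross2 (P c - P a) (y - P a) < 0" unfolding sy using s r y(3) by simp
  have "cross2 (P c - P a) (z - P a) = cross2 (P c - z) (z - P a)" by (simp add: cross2_def algebra_simps)
  also have "\<dots> = (1 - r') * s' * cross2 (P c - P a1) (P c2 - P a)" unfolding s'(3) r'(3) g by simp
  finally have sz: "\<epsilon> * cross2 (P c - P a) (z - P a) = (1 - r') * s' * (\<epsilon> * cross2 (P c - P a1) (P c2 - P a))" by simp
  have sz': "\<epsilon> * cross2 (P c - P a) (z - P a) > 0" unfolding sz using s' r' z(3) by simp
  have cl: "closed_segment (P i) (P j) \<subseteq> bd \<union> inside bd" if "strict i j" for i j
    using that vertex_in_bd by (auto simp: strict_def closed_segment_eq_open)
  have sub: "closed_segment (P i) w \<subseteq> bd \<union> inside bd" "closed_segment w (P i) \<subseteq> bd \<union> inside bd"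
      "closed_segment w (P j) \<subseteq> bd \<union> inside bd" "closed_segment (P j) w \<subseteq> bd \<union> inside bd"
    if "strict i j" "w \<in> open_segment (P i) (P j)" for i j w
  proof -
    have "w \<in> closed_segment (P i) (P j)" using that by (simp add: open_closed_segment)
    then have "closed_segment (P i) w \<subseteq> closed_segment (P i) (P j)" "closed_segment w (P j) \<subseteq> closed_segment (P i) (P j)"
      by (auto simp: subset_closed_segment)
    then show "closed_segment (P i) w \<subseteq> bd \<union> inside bd" "closed_segment w (P i) \<subseteq> bd \<union> inside bd"
      "closed_segment w (P j) \<subseteq> bd \<union> inside bd" "closed_segment (P j) w \<subseteq> bd \<union> inside bd"
      using cl[OF that(1)] by (auto simp: closed_segment_commute)
  qed
  note Y = sub[OF st(1) y(1)] sub[OF st(4) y(2)] and Z = sub[OF st(3) z(1)] sub[OF st(2) z(2)]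
  show ?thesis unfolding strict_def
  proof (cases "\<epsilon> = 1")
    case True
    then show "open_segment (P a) (P c) \<subseteq> inside bd"
      using sy' sz' by (intro quadrilateral_diagonal[of "P a" y "P c" z]) (use Y Z in auto)
  next
    case False
    then have "\<epsilon> = -1" using e by simp
    then show "open_segment (P a) (P c) \<subseteq> inside bd"
      using sy' sz' by (intro quadrilateral_diagonal[of "P a" z "P c" y]) (use Y Z in auto)
  qed
qed

section \<open>From visible segments to strict chords\<close>

lemma P_mod: "P (m mod n) = P m"
proof -
  have "P (m mod n + q * n) = P (m mod n)" for q
  proof (induction q)
    case (Suc q)
    have "m mod n + Suc q * n = (m mod n + q * n) + n" by simp
    then show ?case using periodic Suc by metis
  qed simp
  from this[of "m div n"] show ?thesis by simp
qed

lemma other_edges_through_point: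
  assumes "m < n" "m' < n" "m \<noteq> m'" "x \<in> edge m" "x \<in> edge m'"
  shows "x \<in> range P"
proof (cases "m < m'")
  case True then show ?thesis using edge_Int[of m m' x] assms by auto
next
  case False then show ?thesis using edge_Int[of m' m x] assms by auto
qed

text \<open>At an inner point of an edge one of the two half-discs is exterior.\<close>

lemma visible_imp_strict:
  assumes vis: "closed_segment (P i) (P j) \<subseteq> bd \<union> inside bd" and no: "open_segment (P i) (P j) \<inter> range P = {}"
    and ne: "P i \<noteq> P j" and nadj: "\<And>m. {P i, P j} \<noteq> {P m, P (Suc m)}"
  shows "strict i j"
  unfolding strict_def
proof (rule ccontr)
  assume "\<not> open_segment (P i) (P j) \<subseteq> inside bd"
  then obtain x where x: "x \<in> open_segment (P i) (P j)" "x \<in> bd"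
    using vis by (auto simp: closed_segment_eq_open)
  obtain m where m: "m < n" "x \<in> edge m" using x by (auto simp: bd_def)
  have xnv: "x \<notin> range P" using x no by auto
  have xe: "x \<in> open_segment (P m) (P (Suc m))" using m xnv by (auto simp: edge_def closed_segment_eq_open)
  have nopen: "P k \<notin> open_segment (P m) (P (Suc m))" for k
  proof
    assume a: "P k \<in> open_segment (P m) (P (Suc m))"
    obtain r where r: "r < n" "P k = P r" using n3 P_mod[of k] by (metis mod_less_divisor not_gr_zero not_numeral_le_zero)
    define k' where "k' = (if m \<le> r then r else r + n)"
    have k': "P k' = P k" "m \<le> k'" "k' < m + n" using m(1) periodic r by (auto simp: k'_def)
    have km: "P k' \<in> edge m" using a k' by (simp add: edge_def open_closed_segment)
    have "k' = m \<or> P k' = P (Suc m) \<or> P k' = P m"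
    proof (cases "k' = m")
      case False
      then have "(k' = Suc m \<and> P k' = P k') \<or> (Suc k' = m + n \<and> P k' = P m)"
        using edge_Int[of m k' "P k'"] k' km vertex_in_edge(1)[of k'] by simp
      then show ?thesis by auto
    qed simp
    then show False using a k' by (auto simp: open_segment_def)
  qed
  define u where "u = P (Suc m) - P m"
  define v where "v = P j - P i"
  have cr: "cross2 u v \<noteq> 0"
  proof
    assume "cross2 u v = 0"
    then have "{P m, P (Suc m)} = {P i, P j}"
      using collinear_open_segments_eq[OF xe x(1)] nopen no unfolding u_def v_def by blast
    then show False using nadj by metis
  qed
  \<comment> \<open>Away from the closed union of the other edges, the boundary near
    \<open>x\<close> is just a piece of the line carrying edge \<open>m\<close>.\<close>
  define F where "F = (\<Union>m'\<in>{..<n} - {m}. edge m')"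
  have "closed F" by (auto simp: F_def edge_def)
  moreover have "x \<notin> F" using other_edges_through_point[OF m(1) _ _ m(2)] xnv by (auto simp: F_def)
  ultimately obtain r1 where r1: "r1 > 0" "ball x r1 \<subseteq> - F" by (metis ComplI open_Compl openE)
  define r where "r = min r1 (min (dist x (P m)) (dist x (P (Suc m))))"
  have r: "r > 0" using r1 xe by (auto simp: r_def open_segment_def)
  have ball: "p \<notin> bd" if "p \<in> ball x r" "cross2 u (p - x) \<noteq> 0" for p
  proof
    assume "p \<in> bd"
    moreover have "p \<notin> F" using that r1 by (auto simp: r_def)
    ultimately have "p \<in> edge m" by (auto simp: bd_def F_def)
    then obtain q where q: "p = P m + q *\<^sub>R u" unfolding edge_def u_def by (rule closed_segment_altE)
    obtain q' where q': "x = P m + q' *\<^sub>R u" using open_segment_altE[OF xe] unfolding u_def by metis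
    have "p - x = (q - q') *\<^sub>R u" using q q' by (simp add: algebra_simps)
    then have "cross2 u (p - x) = 0" by (simp only: cross2_simps mult_zero_right)
    then show False using that by simp
  qed
  have line: "p \<in> bd" if p: "p \<in> ball x r" "cross2 u (p - x) = 0" for p
  proof -
    have "u \<noteq> 0" using xe by (auto simp: u_def)
    then obtain q where q: "p - x = q *\<^sub>R u" using cross2_eq_0_imp_parallel[OF p(2)] by metis
    obtain s where s: "0 < s" "s < 1" "x - P m = s *\<^sub>R u" "P (Suc m) - x = (1 - s) *\<^sub>R u" "x = P m + s *\<^sub>R u"
      using open_segment_altE[OF xe] unfolding u_def by metis
    have "norm (p - x) < norm (x - P m)" "norm (p - x) < norm (P (Suc m) - x)"
      using p(1) by (auto simp: r_def dist_norm norm_minus_commute)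
    then have "\<bar>q\<bar> * norm u < s * norm u" "\<bar>q\<bar> * norm u < (1 - s) * norm u" using q s by auto
    then have "\<bar>q\<bar> < s" "\<bar>q\<bar> < 1 - s" using \<open>u \<noteq> 0\<close> by (auto simp: mult_less_cancel_right)
    moreover have "p = P m + (s + q) *\<^sub>R u" using q s(5) by (simp add: algebra_simps)
    ultimately have "p \<in> edge m" unfolding edge_def in_segment u_def
      by (intro exI[of _ "s + q"]) (auto simp: algebra_simps)
    then show ?thesis using m by (auto simp: bd_def)
  qed
  have "x \<in> closure (outside bd)" using x(2) jordan(6) by (metis Diff_iff frontier_def)
  then obtain w where w: "w \<in> outside bd" "w \<in> ball x r"
    using r by (metis closure_approachable dist_commute mem_ball)
  define \<sigma> where "\<sigma> = cross2 u (w - x)"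
  have s0: "\<sigma> \<noteq> 0" using line[OF w(2)] w(1) outside_no_overlap[of bd] unfolding \<sigma>_def by blast
  \<comment> \<open>The half-disc on the side of a nearby exterior point \<open>w\<close>. It is
    connected and misses the boundary, so it is exterior as a whole.\<close>
  define Hf where "Hf = ball x r \<inter> {p. 0 < \<sigma> * cross2 u (p - x)}"
  have "convex {p. 0 < \<sigma> * cross2 u (p - x)}"
  proof (rule convexI)
    fix p q and k l :: real assume p: "p \<in> {p. 0 < \<sigma> * cross2 u (p - x)}" and q: "q \<in> {p. 0 < \<sigma> * cross2 u (p - x)}"
      and kl: "0 \<le> k" "0 \<le> l" "k + l = 1"
    have "k *\<^sub>R p + l *\<^sub>R q - x = k *\<^sub>R (p - x) + l *\<^sub>R (q - x)"
      using kl(3) by (simp add: algebra_simps) (metis scaleR_left_distrib scaleR_one add.commute)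
    then have "\<sigma> * cross2 u (k *\<^sub>R p + l *\<^sub>R q - x) = k * (\<sigma> * cross2 u (p - x)) + l * (\<sigma> * cross2 u (q - x))"
      by (simp only: cross2_simps) (simp add: algebra_simps)
    also have "\<dots> > 0" using p q kl by (smt (verit) mem_Collect_eq mult_nonneg_nonneg mult_pos_pos)
    finally show "k *\<^sub>R p + l *\<^sub>R q \<in> {p. 0 < \<sigma> * cross2 u (p - x)}" by simp
  qed
  then have conH: "connected Hf" unfolding Hf_def by (intro convex_connected convex_Int convex_ball)
  have Hbd: "Hf \<inter> bd = {}"
  proof (intro equals0I)
    fix p assume p: "p \<in> Hf \<inter> bd"
    then have "cross2 u (p - x) \<noteq> 0" by (auto simp: Hf_def)
    then show False using ball[of p] p by (auto simp: Hf_def)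
  qed
  have wH: "w \<in> Hf" using w s0 by (simp add: Hf_def \<sigma>_def[symmetric]) (metis not_real_square_gt_zero)
  have Hout: "Hf \<subseteq> outside bd"
  proof -
    have sub: "Hf \<subseteq> inside bd \<union> outside bd" using Hbd by auto
    have "inside bd \<inter> Hf = {} \<or> outside bd \<inter> Hf = {}"
      using connectedD[OF conH jordan(1,3) _ sub] inside_Int_outside[of bd] by blast
    then show ?thesis using sub wH w(1) by blast
  qed
  obtain s where s: "0 < s" "s < 1" "x = P i + s *\<^sub>R v" using open_segment_altE[OF x(1)] unfolding v_def by metis
  have v0: "v \<noteq> 0" using ne by (simp add: v_def)
  define k where "k = min (min s (1 - s)) (r / norm v) / 2"
  have k: "0 < k" "k < s" "k < 1 - s" "k * norm v < r"
  proof -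
    define M where "M = min (min s (1 - s)) (r / norm v)"
    have M: "0 < M" "M \<le> s" "M \<le> 1 - s" "M \<le> r / norm v" using s r v0 by (auto simp: M_def)
    have kM: "k = M / 2" by (simp add: k_def M_def)
    show "0 < k" "k < s" "k < 1 - s" using M kM by auto
    have "k < r / norm v" using M kM by auto
    then show "k * norm v < r" using v0 by (simp add: field_simps)
  qed
  \<comment> \<open>The segment is not parallel to the edge, so a short move along it in one of the
    two directions leads into the exterior half-disc.\<close>
  define \<tau> where "\<tau> = (if \<sigma> * cross2 u v > 0 then k else - k)"
  define p where "p = x + \<tau> *\<^sub>R v"
  have "0 < \<sigma> * cross2 u (p - x)"
  proof -
    have "\<sigma> * cross2 u (p - x) = \<tau> * (\<sigma> * cross2 u v)" by (simp add: p_def cross2_simps)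
    moreover have "\<sigma> * cross2 u v \<noteq> 0" using s0 cr by simp
    then have "0 < \<tau> * (\<sigma> * cross2 u v)"
    proof (cases "\<sigma> * cross2 u v > 0")
      case True then show ?thesis using mult_pos_pos[OF k(1) True] by (simp add: \<tau>_def)
    next
      case False
      then have "\<sigma> * cross2 u v < 0" using \<open>\<sigma> * cross2 u v \<noteq> 0\<close> by linarith
      then have "0 < (- k) * (\<sigma> * cross2 u v)" using k(1) by (intro mult_neg_neg) auto
      then show ?thesis unfolding \<tau>_def using False by simp
    qed
    ultimately show ?thesis by (simp only:)
  qed
  moreover have "p \<in> ball x r" using k by (auto simp: p_def \<tau>_def dist_norm)
  ultimately have "p \<in> outside bd" using Hout by (auto simp: Hf_def)
  moreover have "p \<in> open_segment (P i) (P j)"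
    by (rule open_segmentI[OF ne, of _ "s + \<tau>"]) (use k s in \<open>auto simp: p_def \<tau>_def v_def algebra_simps\<close>)
  then have "p \<in> bd \<union> inside bd" using vis open_closed_segment by blast
  ultimately show False by (auto simp: outside_inside)
qed

end

section \<open>Visibility graphs\<close>

text \<open>Carries the interior of a polygon from \<open>real^2\<close> to the complex plane, where
  winding numbers live. Components of the complement are pulled back by the inverse map, and linear
  maps preserve boundedness.\<close>

lemma inside_linear_iso_subset:
  fixes h :: "'a::euclidean_space \<Rightarrow> 'b::euclidean_space"
  assumes h: "linear h" and g: "linear g" and gh: "\<And>x. g (h x) = x" and hg: "\<And>y. h (g y) = y"
  shows "h ` inside S \<subseteq> inside (h ` S)"
proof
  fix y assume "y \<in> h ` inside S"
  then obtain x where x: "y = h x" "x \<notin> S" "bounded (connected_component_set (- S) x)" by (auto simp: inside_def)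
  have "h x \<notin> h ` S" using x gh by (metis imageE)
  moreover have "g ` connected_component_set (- h ` S) (h x) \<subseteq> connected_component_set (- S) x"
  proof
    fix w assume "w \<in> g ` connected_component_set (- h ` S) (h x)"
    then obtain v where v: "w = g v" "connected_component (- h ` S) (h x) v" by auto
    then obtain U where U: "connected U" "U \<subseteq> - h ` S" "h x \<in> U" "v \<in> U" by (auto simp: connected_component_def)
    have "connected (g ` U)" using U(1) g by (intro connected_continuous_image linear_continuous_on) (simp add: linear_conv_bounded_linear)
    moreover have "g ` U \<subseteq> - S"
    proof
      fix q assume "q \<in> g ` U"
      then obtain r where r: "r \<in> U" "q = g r" by blast
      show "q \<in> - S"
      proof
        assume "q \<in> S"
        then have "h q \<in> h ` S" by blast
        then show False using r U(2) hg by auto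
      qed
    qed
    moreover have "x \<in> g ` U" "w \<in> g ` U" using U gh v by (force simp: image_iff)+
    ultimately show "w \<in> connected_component_set (- S) x" by (auto simp: connected_component_def)
  qed
  then have "bounded (g ` connected_component_set (- h ` S) (h x))" using x(3) bounded_subset by blast
  then have "bounded (h ` g ` connected_component_set (- h ` S) (h x))"
    by (rule bounded_linear_image) (use h in \<open>simp add: linear_conv_bounded_linear\<close>)
  then have "bounded (connected_component_set (- h ` S) (h x))" by (simp add: image_image hg)
  ultimately show "y \<in> inside (h ` S)" using x by (auto simp: inside_def)
qed

lemma inside_linear_iso:
  fixes h :: "'a::euclidean_space \<Rightarrow> 'b::euclidean_space"
  assumes h: "linear h" and g: "linear g" and gh: "\<And>x. g (h x) = x" and hg: "\<And>y. h (g y) = y"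
  shows "inside (h ` S) = h ` inside S"
proof
  show "h ` inside S \<subseteq> inside (h ` S)" by (rule inside_linear_iso_subset[OF assms])
  have "g ` inside (h ` S) \<subseteq> inside (g ` h ` S)" by (rule inside_linear_iso_subset[OF g h hg gh])
  then have "g ` inside (h ` S) \<subseteq> inside S" by (simp add: image_image gh)
  then have "h ` g ` inside (h ` S) \<subseteq> h ` inside S" by blast
  then show "inside (h ` S) \<subseteq> h ` inside S" by (simp add: image_image hg)
qed

definition to_complex :: "real^2 \<Rightarrow> complex" where "to_complex v = Complex (v $ 1) (v $ 2)"

definition of_complex2 :: "complex \<Rightarrow> real^2" where "of_complex2 z = (\<chi> i. if i = 1 then Re z else Im z)"

lemma to_complex_linear: "linear to_complex"
  by (rule linearI) (auto simp: to_complex_def complex_eq_iff)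

lemma of_complex2_linear: "linear of_complex2"
  by (rule linearI) (auto simp: of_complex2_def vec_eq_iff)

lemma to_of_complex2: "of_complex2 (to_complex v) = v" "to_complex (of_complex2 z) = z"
  by (auto simp: to_complex_def of_complex2_def vec_eq_iff complex_eq_iff forall_2)

lemma inj_to_complex: "inj to_complex" by (metis injI to_of_complex2(1))

lemma mod_neq_if_close: "a < b \<Longrightarrow> b < a + n \<Longrightarrow> a mod n \<noteq> b mod (n::nat)"
proof
  assume o: "a < b" "b < a + n" and "a mod n = b mod n"
  then have "n dvd b - a" using mod_eq_dvd_iff_nat[of a b n] by simp
  then show False using o dvd_imp_le[of n "b - a"] by simp
qed

lemma simple_polygon_complex:
  assumes "simple_polygon n p"
  defines "z \<equiv> \<lambda>m. to_complex (p (m mod n))"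
  shows "polygon n z" "polygon.bd n z = to_complex ` poly_boundary n p"
    "\<And>i j. i < n \<Longrightarrow> j < n \<Longrightarrow> sees n p (p i) (p j) \<longleftrightarrow>
        closed_segment (z i) (z j) \<subseteq> polygon.bd n z \<union> inside (polygon.bd n z)"
proof -
  have n3: "3 \<le> n" and inj: "inj_on p {..<n}" using assms by (auto simp: simple_polygon_def)
  have sp: "if j = Suc i mod n then poly_edge n p i \<inter> poly_edge n p j = {p j}
         else if i = Suc j mod n then poly_edge n p i \<inter> poly_edge n p j = {p i}
         else poly_edge n p i \<inter> poly_edge n p j = {}" if "i < n" "j < n" "i \<noteq> j" for i j
    using assms(1) that unfolding simple_polygon_def by blast
  have edge: "closed_segment (z m) (z (Suc m)) = to_complex ` poly_edge n p (m mod n)" for m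
    unfolding z_def poly_edge_def by (simp add: closed_segment_linear_image[OF to_complex_linear] mod_Suc_eq)
  have imInt: "to_complex ` A \<inter> to_complex ` B = to_complex ` (A \<inter> B)" for A B
    using image_Int[OF inj_to_complex] by simp
  show pg: "polygon n z"
  proof
    show "3 \<le> n" by fact
    show "z (m + n) = z m" for m by (simp add: z_def)
    show "z i \<noteq> z j" if "i < j" "j < i + n" for i j
    proof
      assume "z i = z j"
      then have "p (i mod n) = p (j mod n)" using inj_to_complex by (simp add: z_def inj_eq)
      then have "i mod n = j mod n" using inj n3 by (auto dest!: inj_onD)
      then show False using mod_neq_if_close[OF that] by simp
    qed
    show "closed_segment (z m) (z (Suc m)) \<inter> closed_segment (z (Suc m)) (z (Suc (Suc m))) = {z (Suc m)}" for m
    proof -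
      have "m mod n \<noteq> Suc m mod n" using mod_neq_if_close[of m "Suc m" n] n3 by simp
      then have "poly_edge n p (m mod n) \<inter> poly_edge n p (Suc m mod n) = {p (Suc m mod n)}"
        using sp[of "m mod n" "Suc m mod n"] n3 by (simp add: mod_Suc_eq)
      then show ?thesis unfolding edge imInt by (simp add: z_def)
    qed
    show "closed_segment (z m) (z (Suc m)) \<inter> closed_segment (z m') (z (Suc m')) = {}"
      if "m + 2 \<le> m'" "m' + 2 \<le> m + n" for m m'
    proof -
      have "m mod n \<noteq> m' mod n" "Suc m mod n \<noteq> m' mod n" "m mod n \<noteq> Suc m' mod n"
        using mod_neq_if_close[of m m' n] mod_neq_if_close[of "Suc m" m' n] mod_neq_if_close[of m "Suc m'" n] that by auto
      then have "poly_edge n p (m mod n) \<inter> poly_edge n p (m' mod n) = {}"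
        using sp[of "m mod n" "m' mod n"] n3 by (auto simp: mod_Suc_eq split: if_splits)
      then show ?thesis unfolding edge imInt by simp
    qed
  qed
  interpret polygon n z by (rule pg)
  show bdeq: "bd = to_complex ` poly_boundary n p"
    unfolding bd_def poly_boundary_def image_UN edge_def edge by simp
  have "inside bd = to_complex ` inside (poly_boundary n p)" unfolding bdeq
    by (rule inside_linear_iso[OF to_complex_linear of_complex2_linear to_of_complex2])
  then have reg: "bd \<union> inside bd = to_complex ` poly_region n p" unfolding poly_region_def image_Un bdeq by simp
  show "sees n p (p i) (p j) \<longleftrightarrow> closed_segment (z i) (z j) \<subseteq> bd \<union> inside bd" if "i < n" "j < n" for i j
  proof -
    have "closed_segment (z i) (z j) = to_complex ` closed_segment (p i) (p j)"
      using that by (simp add: z_def closed_segment_linear_image[OF to_complex_linear])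
    then have "closed_segment (z i) (z j) \<subseteq> bd \<union> inside bd \<longleftrightarrow> closed_segment (p i) (p j) \<subseteq> poly_region n p"
      unfolding reg using inj_image_subset_iff[OF inj_to_complex] by simp
    then show ?thesis unfolding sees_def by blast
  qed
qed

context polygon
begin

definition visible :: "nat \<Rightarrow> nat \<Rightarrow> bool" where
  "visible i j \<longleftrightarrow> closed_segment (P i) (P j) \<subseteq> bd \<union> inside bd"

definition strict_pairs :: "(nat \<times> nat) set" where
  "strict_pairs = {(i, j). i < j \<and> j < n \<and> strict i j}"

text \<open>Both orders of a pair occur, because the first vertex met on a segment depends on the
  end where one starts.\<close>

definition visible_pairs :: "(nat \<times> nat) set" where
  "visible_pairs = {(i, j). i < n \<and> j < n \<and> i \<noteq> j \<and> visible i j}"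

lemma strict_imp_visible: "strict i j \<Longrightarrow> visible i j"
  using vertex_in_bd by (auto simp: strict_def visible_def closed_segment_eq_open)

lemma strict_commute: "strict i j \<longleftrightarrow> strict j i"
  by (simp add: strict_def open_segment_commute)

lemma visible_commute: "visible i j \<longleftrightarrow> visible j i"
  by (simp add: visible_def closed_segment_commute)

lemma P_inj: "i < n \<Longrightarrow> j < n \<Longrightarrow> P i = P j \<Longrightarrow> i = j"
  using distinct[of i j] distinct[of j i] by (metis linorder_neqE_nat trans_less_add2)

text \<open>If two neighbouring indices coincide, the conclusion is one of the hypotheses; the
  strictly increasing case is \<open>strict_plus\<close>.\<close>

lemma plus_closed_strict_pairs: "plus_closed strict_pairs"
  unfolding plus_closed_def
proof (intro allI impI)
  fix a1 a a2 c1 c c2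
  assume *: "a1 \<le> a" "a \<le> a2" "a2 < c1" "c1 \<le> c" "c \<le> c2" "(a, c1) \<in> strict_pairs" "(a, c2) \<in> strict_pairs"
    "(a1, c) \<in> strict_pairs" "(a2, c) \<in> strict_pairs"
  show "(a, c) \<in> strict_pairs"
  proof (cases "a1 = a \<or> a = a2 \<or> c1 = c \<or> c = c2")
    case True then show ?thesis using * by auto
  next
    case False
    then have "strict a c" using * by (intro strict_plus[of a1 a a2 c1 c c2]) (auto simp: strict_pairs_def)
    then show ?thesis using * by (auto simp: strict_pairs_def)
  qed
qed

lemma finite_pairs: "finite strict_pairs" "finite visible_pairs"
  by (rule finite_subset[of _ "{..<n} \<times> {..<n}"]; auto simp: strict_pairs_def visible_pairs_def)+

text \<open>A visible pair whose segment passes through further vertices is charged to the first of them;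
  the vertices beyond it on the ray form a clique.\<close>

definition elementary :: "(nat \<times> nat) set" where
  "elementary = {(i, j) \<in> visible_pairs. open_segment (P i) (P j) \<inter> range P = {}}"

lemma elementary_subset:
  "elementary \<subseteq> strict_pairs \<union> (\<lambda>(i, j). (j, i)) ` strict_pairs \<union>
     (\<lambda>i. (i, Suc i mod n)) ` {..<n} \<union> (\<lambda>i. (Suc i mod n, i)) ` {..<n}"
proof clarify
  fix i j assume e: "(i, j) \<in> elementary" and n1: "(i, j) \<notin> (\<lambda>i. (Suc i mod n, i)) ` {..<n}"
    and n2: "(i, j) \<notin> (\<lambda>i. (i, Suc i mod n)) ` {..<n}"
    and n3: "(i, j) \<notin> (\<lambda>(i, j). (j, i)) ` strict_pairs"
  have ij: "i < n" "j < n" "i \<noteq> j" "visible i j" "open_segment (P i) (P j) \<inter> range P = {}"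
    using e by (auto simp: elementary_def visible_pairs_def)
  have "strict i j"
  proof (rule visible_imp_strict)
    show "closed_segment (P i) (P j) \<subseteq> bd \<union> inside bd" using ij by (simp add: visible_def)
    show "P i \<noteq> P j" using ij P_inj by blast
    show "{P i, P j} \<noteq> {P m, P (Suc m)}" for m
    proof
      assume "{P i, P j} = {P m, P (Suc m)}"
      then have eq: "P i = P (m mod n) \<and> P j = P (Suc m mod n) \<or> P j = P (m mod n) \<and> P i = P (Suc m mod n)"
        by (auto simp: doubleton_eq_iff P_mod)
      have lt: "m mod n < n" "Suc m mod n < n" using polygon.n3[OF polygon_axioms] by auto
      have S: "Suc (m mod n) mod n = Suc m mod n" by (simp add: mod_Suc_eq)
      from eq show False
      proof
        assume "P i = P (m mod n) \<and> P j = P (Suc m mod n)"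
        then have "i = m mod n" "j = Suc m mod n" using P_inj ij lt by blast+
        then show False using n2 S lt by (metis (no_types, lifting) image_eqI lessThan_iff)
      next
        assume "P j = P (m mod n) \<and> P i = P (Suc m mod n)"
        then have "j = m mod n" "i = Suc m mod n" using P_inj ij lt by blast+
        then show False using n1 S lt by (metis (no_types, lifting) image_eqI lessThan_iff)
      qed
    qed
  qed (use ij in auto)
  then show "(i, j) \<in> strict_pairs"
    using n3 ij strict_commute[of i j] by (auto simp: strict_pairs_def image_iff)
qed

lemma card_elementary: "card elementary \<le> 2 * card strict_pairs + 2 * n"
proof -
  have "card elementary \<le> card (strict_pairs \<union> (\<lambda>(i, j). (j, i)) ` strict_pairs \<union>
     (\<lambda>i. (i, Suc i mod n)) ` {..<n} \<union> (\<lambda>i. (Suc i mod n, i)) ` {..<n})"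
    using finite_pairs by (intro card_mono elementary_subset) auto
  also have "\<dots> \<le> card strict_pairs + card strict_pairs + n + n"
    using card_image_le[OF finite_pairs(1)] card_image_le[of "{..<n}"]
    by (intro order.trans[OF card_Un_le] add_mono) auto
  finally show ?thesis by simp
qed

definition beyond :: "nat \<Rightarrow> nat \<Rightarrow> nat set" where
  "beyond i v = {j. (i, j) \<in> visible_pairs \<and> P v \<in> closed_segment (P i) (P j)}"

lemma visible_elementary:
  assumes "(i, j) \<in> visible_pairs"
  obtains v where "(i, v) \<in> elementary" "j \<in> beyond i v"
proof -
  have ij: "i < n" "j < n" "i \<noteq> j" "visible i j" using assms by (auto simp: visible_pairs_def)
  define V where "V = {m. m < n \<and> m \<noteq> i \<and> P m \<in> closed_segment (P i) (P j)}"
  have V: "finite V" "V \<noteq> {}" using ij by (auto simp: V_def)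
  \<comment> \<open>The vertex on the segment nearest to \<open>P i\<close>; the candidate
    \<open>j\<close> itself keeps \<open>V\<close> nonempty.\<close>
  define v where "v = arg_min_on (\<lambda>m. dist (P i) (P m)) V"
  have v: "v \<in> V" "\<And>m. m \<in> V \<Longrightarrow> dist (P i) (P v) \<le> dist (P i) (P m)"
    unfolding v_def by (rule arg_min_if_finite(1)[OF V], rule arg_min_least[OF V])
  have sub: "closed_segment (P i) (P v) \<subseteq> closed_segment (P i) (P j)" using v(1) by (auto simp: V_def subset_closed_segment)
  have "open_segment (P i) (P v) \<inter> range P = {}"
  proof (rule ccontr)
    assume "open_segment (P i) (P v) \<inter> range P \<noteq> {}"
    then obtain w where "P w \<in> open_segment (P i) (P v)" by auto
    then have w: "P (w mod n) \<in> open_segment (P i) (P v)" by (simp add: P_mod)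
    have "w mod n < n" using n3 by simp
    moreover have "w mod n \<noteq> i" using w by (auto simp: open_segment_def)
    moreover have "P (w mod n) \<in> closed_segment (P i) (P j)" using w sub open_closed_segment by blast
    ultimately have "w mod n \<in> V" by (simp add: V_def)
    moreover have "dist (P (w mod n)) (P i) < dist (P i) (P v)" using dist_in_open_segment[OF w] by simp
    ultimately show False using v(2) by (metis dist_commute not_less)
  qed
  moreover have "visible i v" using ij sub by (auto simp: visible_def)
  ultimately have "(i, v) \<in> elementary" using v(1) ij by (auto simp: elementary_def visible_pairs_def V_def)
  moreover have "j \<in> beyond i v" using assms v(1) by (auto simp: beyond_def V_def)
  ultimately show ?thesis by (rule that)
qed

text \<open>Both vertices lie on the ray from \<open>P i\<close> through \<open>P v\<close>, so the
  segment between them is part of the visible segment from \<open>P i\<close> to the farther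
  one.\<close>

lemma beyond_clique:
  assumes iv: "i < n" "v < n" "i \<noteq> v" and j: "j \<in> beyond i v" "j' \<in> beyond i v"
  shows "visible j j'"
proof -
  have ne: "P v \<noteq> P i" using iv P_inj by blast
  have ray: "\<exists>s\<ge>1. P k = P i + s *\<^sub>R (P v - P i)" if k: "k \<in> beyond i v" for k
  proof -
    have "P v \<in> closed_segment (P i) (P k)" using k by (simp add: beyond_def)
    then obtain s where s: "0 \<le> s" "s \<le> 1" "P v = P i + s *\<^sub>R (P k - P i)" by (rule closed_segment_altE)
    have s0: "s \<noteq> 0" using s(3) ne by auto
    have "P v - P i = s *\<^sub>R (P k - P i)" using s(3) by simp
    then have "P k - P i = (1 / s) *\<^sub>R (P v - P i)" using s0 by simp
    then have "P k = P i + (1 / s) *\<^sub>R (P v - P i)" by (simp add: algebra_simps)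
    moreover have "1 / s \<ge> 1" using s s0 by simp
    ultimately show ?thesis by blast
  qed
  have main: "visible k k'" if k: "k \<in> beyond i v" "k' \<in> beyond i v"
     "P k = P i + s *\<^sub>R (P v - P i)" "P k' = P i + s' *\<^sub>R (P v - P i)" "1 \<le> s" "s \<le> s'" for k k' s s'
  proof -
    have "P k' - P i = s' *\<^sub>R (P v - P i)" using k(4) by simp
    then have "(s / s') *\<^sub>R (P k' - P i) = s *\<^sub>R (P v - P i)" using k(5,6) by simp
    then have "P k = P i + (s / s') *\<^sub>R (P k' - P i)" using k(3) by simp
    then have "P k = (1 - s / s') *\<^sub>R P i + (s / s') *\<^sub>R P k'" by (simp add: algebra_simps)
    then have "P k \<in> closed_segment (P i) (P k')" using k by (auto simp: in_segment intro!: exI[of _ "s / s'"])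
    then have "closed_segment (P k) (P k') \<subseteq> closed_segment (P i) (P k')" by (auto simp: subset_closed_segment)
    moreover have "visible i k'" using k by (auto simp: beyond_def visible_pairs_def)
    ultimately show ?thesis by (auto simp: visible_def)
  qed
  obtain s s' where "s \<ge> 1" "P j = P i + s *\<^sub>R (P v - P i)" "s' \<ge> 1" "P j' = P i + s' *\<^sub>R (P v - P i)"
    using ray j by metis
  then show ?thesis using main[of j j' s s'] main[of j' j s' s] j visible_commute by (metis nle_le)
qed

text \<open>A clique with more than \<open>2 * t\<close> vertices contains two disjoint sides of
  size \<open>t\<close>, so at most \<open>2 * t\<close> pairs are charged to each elementary
  pair.\<close>

lemma card_visible_pairs:
  assumes t: "\<And>A B. A \<subseteq> {..<n} \<Longrightarrow> B \<subseteq> {..<n} \<Longrightarrow> A \<inter> B = {} \<Longrightarrow> card A = t \<Longrightarrow> card B = t \<Longrightarrow>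
      (\<And>a b. a \<in> A \<Longrightarrow> b \<in> B \<Longrightarrow> visible a b) \<Longrightarrow> False"
  shows "card visible_pairs \<le> 4 * t * (card strict_pairs + n)"
proof -
  have fb: "finite (beyond i v)" "beyond i v \<subseteq> {..<n}" for i v
    by (auto simp: beyond_def visible_pairs_def intro: finite_subset[of _ "{..<n}"])
  have small: "card (beyond i v) \<le> 2 * t" if e: "(i, v) \<in> elementary" for i v
  proof (rule ccontr)
    assume "\<not> card (beyond i v) \<le> 2 * t"
    then have "t \<le> card (beyond i v)" by simp
    then obtain A where A: "A \<subseteq> beyond i v" "card A = t" "finite A" using obtain_subset_with_card_n by metis
    have "card (beyond i v - A) = card (beyond i v) - t" using A by (simp add: card_Diff_subset)
    then have "t \<le> card (beyond i v - A)" using \<open>\<not> card (beyond i v) \<le> 2 * t\<close> by simp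
    then obtain B where B: "B \<subseteq> beyond i v - A" "card B = t" using obtain_subset_with_card_n by metis
    have iv: "i < n" "v < n" "i \<noteq> v" using e by (auto simp: elementary_def visible_pairs_def)
    show False
    proof (rule t[of A B])
      show "visible a b" if "a \<in> A" "b \<in> B" for a b using beyond_clique[OF iv] that A B by blast
    qed (use A B fb(2)[of i v] in auto)
  qed
  have fe: "finite elementary" using finite_pairs(2) by (rule finite_subset[rotated]) (auto simp: elementary_def)
  have "visible_pairs \<subseteq> (\<Union>e\<in>elementary. Pair (fst e) ` beyond (fst e) (snd e))"
  proof
    fix q assume q: "q \<in> visible_pairs"
    obtain i j where ij: "q = (i, j)" by (cases q)
    obtain v where "(i, v) \<in> elementary" "j \<in> beyond i v" using visible_elementary q ij by metis
    then show "q \<in> (\<Union>e\<in>elementary. Pair (fst e) ` beyond (fst e) (snd e))" using ij by force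
  qed
  then have "card visible_pairs \<le> card (\<Union>e\<in>elementary. Pair (fst e) ` beyond (fst e) (snd e))"
    using fe fb by (intro card_mono) auto
  also have "\<dots> \<le> (\<Sum>e\<in>elementary. card (Pair (fst e) ` beyond (fst e) (snd e)))" by (rule card_UN_le[OF fe])
  also have "\<dots> \<le> (\<Sum>e\<in>elementary. 2 * t)"
    using small by (intro sum_mono order.trans[OF card_image_le]) (auto simp: fb)
  also have "\<dots> = card elementary * (2 * t)" by simp
  also have "\<dots> \<le> (2 * card strict_pairs + 2 * n) * (2 * t)" by (intro mult_le_mono1 card_elementary)
  finally show ?thesis by (simp add: algebra_simps)
qed

end

text \<open>The biclique hypothesis acts twice: on the strict graph, and on the cliques formed by
  collinear vertices.\<close>

lemma card_vis_edges_le: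
  assumes sp: "simple_polygon n p" and K: "\<not> contains_Ktt n (vis_edges n p) t" and t: "t > 0"
    and x: "1 \<le> x" "n \<le> ack k x"
  shows "card (vis_edges n p) \<le> 4 * t * (2 * (288 * t ^ 4) ^ k * (n * (x + 2)) + n)"
proof -
  define z where "z = (\<lambda>m. to_complex (p (m mod n)))"
  interpret polygon n z unfolding z_def by (rule simple_polygon_complex(1)[OF sp])
  have sees: "sees n p (p i) (p j) \<longleftrightarrow> visible i j" if "i < n" "j < n" for i j
    unfolding visible_def using simple_polygon_complex(3)[OF sp that] unfolding z_def .
  have vis: "{i, j} \<in> vis_edges n p" if "i < n" "j < n" "i \<noteq> j" "visible i j" for i j
    using that sees[of i j] by (auto simp: vis_edges_def)
  have noK: False if "A \<subseteq> {..<n}" "B \<subseteq> {..<n}" "A \<inter> B = {}" "card A = t" "card B = t" "\<And>a b. a \<in> A \<Longrightarrow> b \<in> B \<Longrightarrow> visible a b" for A B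
  proof -
    have "\<forall>a\<in>A. \<forall>b\<in>B. {a, b} \<in> vis_edges n p" using that vis by (metis IntI empty_iff lessThan_iff subsetD)
    then show False using K that unfolding contains_Ktt_def by blast
  qed
  have "biclique_free t strict_pairs" unfolding biclique_free_def
  proof (intro allI impI notI)
    fix A B assume A: "card A = t" and B: "card B = t" and AB: "A \<times> B \<subseteq> strict_pairs"
    obtain a0 b0 where ab0: "a0 \<in> A" "b0 \<in> B" using A B t by (metis card_gt_0_iff ex_in_conv)
    show False
    proof (rule noK[OF _ _ _ A B])
      show "A \<subseteq> {..<n}" "B \<subseteq> {..<n}" using AB ab0 by (auto simp: strict_pairs_def)
      show "A \<inter> B = {}" using AB by (auto simp: strict_pairs_def)
      show "visible a b" if "a \<in> A" "b \<in> B" for a b using AB that strict_imp_visible by (auto simp: strict_pairs_def)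
    qed
  qed
  then have s: "card strict_pairs \<le> 2 * (288 * t ^ 4) ^ k * (n * (x + 2))"
    by (intro plus_closed_edge_bound[OF t plus_closed_strict_pairs _ _ x]) (auto simp: strict_pairs_def)
  have "vis_edges n p \<subseteq> (\<lambda>(i, j). {i, j}) ` visible_pairs"
    using sees by (force simp: vis_edges_def visible_pairs_def)
  then have "card (vis_edges n p) \<le> card visible_pairs"
    using finite_pairs(2) by (metis card_image_le card_mono finite_imageI le_trans)
  also have "\<dots> \<le> 4 * t * (card strict_pairs + n)" by (rule card_visible_pairs) (rule noK)
  also have "\<dots> \<le> 4 * t * (2 * (288 * t ^ 4) ^ k * (n * (x + 2)) + n)" using s by (intro mult_le_mono2) simp
  finally show ?thesis .
qed

theorem theorem1p1:
  fixes t :: nat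
  assumes "t > 0"
  shows "\<exists>c C :: real. \<forall>n \<ge> 3. \<forall>p :: nat \<Rightarrow> real^2.
           simple_polygon n p \<longrightarrow> \<not> contains_Ktt n (vis_edges n p) t \<longrightarrow>
           real (card (vis_edges n p)) \<le> C * real n * 2 powr (real (inv_ack n) powr c)"
proof -
  \<comment> \<open>A factor \<open>288 * t ^ 4\<close> for each step of the recursion, and a factor
    2 because \<open>2 ^ \<alpha>\<close> pays for the linear term in
    \<open>\<alpha>\<close>.\<close>
  define L :: real where "L = 2 * (288 * real t ^ 4)"
  have "1 \<le> real t ^ 4" using assms by (intro one_le_power) simp
  then have L2: "L \<ge> 2" by (simp add: L_def)
  \<comment> \<open>For \<open>\<alpha>\<close> at least 2 the power
    \<open>\<alpha> powr (c - 1)\<close> is at least \<open>log 2 L\<close>, which turns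
    \<open>L ^ \<alpha>\<close> into the required form.\<close>
  define c where "c = 1 + log 2 (log 2 L)"
  \<comment> \<open>The extra factor \<open>L\<close> serves \<open>\<alpha> = 1\<close>, where the
    power with exponent \<open>c\<close> stays 1.\<close>
  define C where "C = 28 * real t * L"
  have c0: "log 2 L \<ge> 1" using L2 by simp
  have "real (card (vis_edges n p)) \<le> C * real n * 2 powr (real (inv_ack n) powr c)"
    if n: "n \<ge> 3" and sp: "simple_polygon n p" and K: "\<not> contains_Ktt n (vis_edges n p) t" for n p
  proof -
    define \<alpha> where "\<alpha> = inv_ack n"
    have "n \<le> ack n n" using ack_gt[of n n] by simp
    then have na: "n \<le> ack \<alpha> \<alpha>" unfolding \<alpha>_def inv_ack_def by (rule LeastI)
    \<comment> \<open>Here \<open>n\<close> being at least 3 matters: \<open>ack 0 0\<close> is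
      1.\<close>
    have a1: "1 \<le> \<alpha>" using na n by (cases \<alpha>) auto
    define q where "q = (288 * t ^ 4) ^ \<alpha>"
    have q1: "1 \<le> q" using assms by (simp add: q_def)
    have "card (vis_edges n p) \<le> 4 * t * (2 * q * (n * (\<alpha> + 2)) + n)"
      unfolding q_def by (rule card_vis_edges_le[OF sp K assms a1 na])
    also have "\<dots> \<le> 28 * t * n * (2 ^ \<alpha> * q)"
    proof -
      have a2: "\<alpha> + 1 \<le> 2 ^ \<alpha>" using less_exp[of \<alpha>] by linarith
      have "2 * q * (n * (\<alpha> + 2)) + n \<le> 2 * q * (n * (\<alpha> + 2)) + q * n" using q1 by simp
      also have "\<dots> = q * n * (2 * \<alpha> + 5)" by (simp add: algebra_simps)
      also have "\<dots> \<le> q * n * (7 * 2 ^ \<alpha>)" using a1 a2 by (intro mult_le_mono2) simp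
      finally have "4 * t * (2 * q * (n * (\<alpha> + 2)) + n) \<le> 4 * t * (q * n * (7 * 2 ^ \<alpha>))" by (rule mult_le_mono2)
      then show ?thesis by (simp add: algebra_simps)
    qed
    finally have "real (card (vis_edges n p)) \<le> real (28 * t * n * (2 ^ \<alpha> * q))" by (rule of_nat_mono)
    also have "\<dots> = 28 * real t * real n * L ^ \<alpha>"
      unfolding L_def power_mult_distrib[of 2] by (simp add: q_def)
    also have "\<dots> \<le> 28 * real t * real n * (L * 2 powr (real \<alpha> powr c))"
    proof (rule mult_left_mono)
      show "L ^ \<alpha> \<le> L * 2 powr (real \<alpha> powr c)"
      proof (cases "\<alpha> = 1")
        case True
        have "1 \<le> 2 powr (real \<alpha> powr c)" by (simp add: ge_one_powr_ge_zero)
        then show ?thesis using True L2 by simp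
      next
        case False
        then have a2: "2 \<le> real \<alpha>" using a1 by simp
        have "log 2 L = 2 powr (log 2 (log 2 L))" using c0 by simp
        also have "\<dots> \<le> real \<alpha> powr (log 2 (log 2 L))" using a2 c0 by (intro powr_mono2) auto
        finally have "real \<alpha> * log 2 L \<le> real \<alpha> * real \<alpha> powr (log 2 (log 2 L))" by (intro mult_left_mono) auto
        also have "\<dots> = real \<alpha> powr c" unfolding c_def using a2 by (simp add: powr_add)
        finally have le: "real \<alpha> * log 2 L \<le> real \<alpha> powr c" .
        have "L ^ \<alpha> = L powr real \<alpha>" using L2 by (simp add: powr_realpow)
        also have "\<dots> = (2 powr (log 2 L)) powr real \<alpha>" using L2 by simp
        also have "\<dots> = 2 powr (real \<alpha> * log 2 L)" by (simp add: powr_powr mult.commute)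
        also have "\<dots> \<le> 2 powr (real \<alpha> powr c)" using le by simp
        also have "\<dots> \<le> L * 2 powr (real \<alpha> powr c)" using L2 by simp
        finally show ?thesis .
      qed
    qed simp
    also have "\<dots> = C * real n * 2 powr (real \<alpha> powr c)" by (simp add: C_def)
    finally show ?thesis unfolding \<alpha>_def .
  qed
  then show ?thesis by blast
qed

end
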